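(* Let $r\in\mathbb{N}$. Assume that $G(o,o|z)=\sum_{n\ge0}\mathbb{P}[X_n=o]z^n$ has radius of convergence $\mathscr{R}>1$. Let $\mathbf{R}_n^{(r)}=R^{(r)}([X_0,\dots,X_n])$ be the number of distinct vertices in $\{X_0,\dots,X_n\}$ which are visited exactly $r$ times up to time $n$. Then there exists a constant $\mathfrak{c}^{(r)}_{\mathrm{range}}>0$ such that $$\mathfrak{c}^{(r)}_{\mathrm{range}}=\lim_{n\to\infty}\frac{\mathbf{R}_n^{(r)}}{n}=\lim_{n\to\infty}\frac{R^{(r)}\bigl([X_0,\ldots,X_n]\bigr)}{n}\quad\text{almost surely.}$$
   Context: Notation: $\mathbb{N}=\{1,2,\dots\}$, $\mathbb{N}_0=\mathbb{N}\cup\{0\}$. Free product. Let $V_1,V_2$ be disjoint finite or countable sets with $|V_i|\ge 2$, not both of cardinality $2$, with distinguished elements (roots) $o_i\in V_i$; put $V_i^\times=V_i\setminus\{o_i\}$. For $i\in\{1,2\}$ let $P_i=(p_i(x,y))_{x,y\in V_i}$ be a transition matrix on $V_i$ with $p_i(x,x)=0$ for all $x\in V_i$ and such that for every $x\in V_i$ there is $n_x\in\mathbb{N}$ with $p_i^{(n_x)}(o_i,x)>0$ ($p_i^{(n)}$ denotes $n$-step transition probabilities). The free product $V=V_1*V_2$ is the set of all finite words $v_1\dots v_n$, $n\in\mathbb{N}$, with letters in $V_1^\times\cup V_2^\times$ such that no two consecutive letters lie in the same $V_i^\times$, together with the empty word $o$; both $o_1,o_2$ are identified with $o$, so $V_i\subset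 V$. Type: $\delta(v_1\dots v_n)=i$ if $v_n\in V_i^\times$ ($o$ has no type). Words are concatenated whenever the result lies in $V$, with $uo=ou=u$. Random walk. Fix $\alpha\in(0,1)$. Put $\bar p_i(uv,uw)=p_i(v,w)$ for $u\in V$ with $\delta(u)\ne i$ ($u=o$ allowed) and $v,w\in V_i$, and $\bar p_i(x,y)=0$ otherwise. Let $P=\alpha\bar P_1+(1-\alpha)\bar P_2=(p(x,y))_{x,y\in V}$, and let $(X_n)_{n\in\mathbb{N}_0}$ be the Markov chain on $V$ with transition matrix $P$ and $X_0=o$. A path is a finite sequence $[v_0,\dots,v_n]$, $n\in\mathbb{N}_0$, in $V$ with $p(v_{i-1},v_i)>0$ for each $i$. $\Pi$ is the set of all finite paths. For $u\in V$ and $\pi=[u_0,\dots,u_m]\in\Pi$ let $N(u,\pi)=|\{j\in\{0,\dots,m\}: u_j=u\}|$, and let $R^{(r)}(\pi)=|\{u\in\{u_0,\dots,u_m\}: N(u,\pi)=r\}|$. *)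

theory Defs
  imports "HOL-Probability.Probability"
begin

definition transition_matrix :: "'s set \<Rightarrow> ('s \<Rightarrow> 's \<Rightarrow> real) \<Rightarrow> bool" where
  "transition_matrix S q \<longleftrightarrow>
     (\<forall>x\<in>S. (\<forall>y\<in>S. 0 \<le> q x y) \<and> (q x has_sum 1) S)"

primrec nstep :: "'s set \<Rightarrow> ('s \<Rightarrow> 's \<Rightarrow> real) \<Rightarrow> nat \<Rightarrow> 's \<Rightarrow> 's \<Rightarrow> real" where
  "nstep S q 0 x y = (if x = y then 1 else 0)"
| "nstep S q (Suc n) x y = (\<Sum>\<^sub>\<infinity>z\<in>S. q x z * nstep S q n z y)"

definition rooted_factor :: "'a set \<Rightarrow> 'a \<Rightarrow> ('a \<Rightarrow> 'a \<Rightarrow> real) \<Rightarrow> bool" where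
  "rooted_factor S e q \<longleftrightarrow>
     countable S \<and> (infinite S \<or> 2 \<le> card S) \<and> e \<in> S \<and>
     transition_matrix S q \<and> (\<forall>x\<in>S. q x x = 0) \<and>
     (\<forall>x\<in>S. \<exists>n\<ge>1. 0 < nstep S q n e x)"

text \<open>The factors are indexed by \<open>i \<in> {1, 2}\<close>: \<open>V i\<close> is the vertex set, \<open>rt i\<close> its root and
  \<open>p i\<close> its transition matrix. Values at other indices are never used.\<close>

definition nonroots :: "(nat \<Rightarrow> 'a set) \<Rightarrow> (nat \<Rightarrow> 'a) \<Rightarrow> nat \<Rightarrow> 'a set" where
  "nonroots V rt i = V i - {rt i}"

definition free_product :: "(nat \<Rightarrow> 'a set) \<Rightarrow> (nat \<Rightarrow> 'a) \<Rightarrow> 'a list set" where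
  "free_product V rt =
     {w. set w \<subseteq> nonroots V rt 1 \<union> nonroots V rt 2 \<and>
         (\<forall>k. Suc k < length w \<longrightarrow>
            \<not> (\<exists>i\<in>{1, 2}. w ! k \<in> nonroots V rt i \<and> w ! Suc k \<in> nonroots V rt i))}"

definition has_type :: "(nat \<Rightarrow> 'a set) \<Rightarrow> (nat \<Rightarrow> 'a) \<Rightarrow> 'a list \<Rightarrow> nat \<Rightarrow> bool" where
  "has_type V rt w i \<longleftrightarrow> w \<noteq> [] \<and> last w \<in> nonroots V rt i"

text \<open>The inclusion of a factor into the free product; it identifies both roots with the
  empty word.\<close>

definition word_of :: "'a \<Rightarrow> 'a \<Rightarrow> 'a list" where
  "word_of e v = (if v = e then [] else [v])"

definition same_copy ::
  "(nat \<Rightarrow> 'a set) \<Rightarrow> (nat \<Rightarrow> 'a) \<Rightarrow> nat \<Rightarrow> 'a list \<Rightarrow> 'a list \<Rightarrow> 'a list \<Rightarrow> 'a \<Rightarrow> 'a \<Rightarrow> bool" where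
  "same_copy V rt i x y u v w \<longleftrightarrow>
     u \<in> free_product V rt \<and> \<not> has_type V rt u i \<and> v \<in> V i \<and> w \<in> V i \<and>
     x = u @ word_of (rt i) v \<and> y = u @ word_of (rt i) w"

text \<open>The description is proper since \<open>x\<close> and \<open>y\<close> determine \<open>u\<close>, \<open>v\<close>, \<open>w\<close>; see
  \<open>lifted_matrix_eq\<close> below.\<close>

definition lifted_matrix ::
  "(nat \<Rightarrow> 'a set) \<Rightarrow> (nat \<Rightarrow> 'a) \<Rightarrow> (nat \<Rightarrow> 'a \<Rightarrow> 'a \<Rightarrow> real) \<Rightarrow> nat \<Rightarrow> 'a list \<Rightarrow> 'a list \<Rightarrow> real" where
  "lifted_matrix V rt p i x y =
     (if \<exists>u v w. same_copy V rt i x y u v w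
      then (THE q. \<exists>u v w. same_copy V rt i x y u v w \<and> q = p i v w)
      else 0)"

lemma append_word_of_unique:
  assumes "u @ word_of (rt i) v = u' @ word_of (rt i) v'"
    and "\<not> has_type V rt u i" "\<not> has_type V rt u' i" "v \<in> V i" "v' \<in> V i"
  shows "u = u' \<and> v = v'"
  using assms
  by (cases u rule: rev_cases; cases u' rule: rev_cases)
     (auto simp: word_of_def has_type_def nonroots_def split: if_splits)

lemma lifted_matrix_eq:
  assumes "u \<in> free_product V rt" "\<not> has_type V rt u i" "v \<in> V i" "w \<in> V i"
  shows "lifted_matrix V rt p i (u @ word_of (rt i) v) (u @ word_of (rt i) w) = p i v w"
proof -
  let ?C = "same_copy V rt i (u @ word_of (rt i) v) (u @ word_of (rt i) w)"
  have C: "?C u v w"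
    using assms by (simp add: same_copy_def)
  have "v' = v \<and> w' = w" if "?C u' v' w'" for u' v' w'
    using that assms append_word_of_unique[where V = V and rt = rt and i = i]
    unfolding same_copy_def by metis
  then have "(THE q. \<exists>u v w. ?C u v w \<and> q = p i v w) = p i v w"
    using C by (intro the_equality) blast+
  then show ?thesis
    using C unfolding lifted_matrix_def by auto
qed

definition walk_matrix ::
  "(nat \<Rightarrow> 'a set) \<Rightarrow> (nat \<Rightarrow> 'a) \<Rightarrow> (nat \<Rightarrow> 'a \<Rightarrow> 'a \<Rightarrow> real) \<Rightarrow> real \<Rightarrow> 'a list \<Rightarrow> 'a list \<Rightarrow> real" where
  "walk_matrix V rt p \<alpha> x y =
     \<alpha> * lifted_matrix V rt p 1 x y + (1 - \<alpha>) * lifted_matrix V rt p 2 x y"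

definition markov_chain ::
  "'w measure \<Rightarrow> 's set \<Rightarrow> ('s \<Rightarrow> 's \<Rightarrow> real) \<Rightarrow> 's \<Rightarrow> (nat \<Rightarrow> 'w \<Rightarrow> 's) \<Rightarrow> bool" where
  "markov_chain M S q s X \<longleftrightarrow>
     prob_space M \<and>
     (\<forall>n. X n \<in> measurable M (count_space S)) \<and>
     (AE \<omega> in M. X 0 \<omega> = s) \<and>
     (\<forall>n x. \<forall>y\<in>S.
        0 < \<P>(\<omega> in M. \<forall>k\<le>n. X k \<omega> = x k) \<longrightarrow>
        \<P>(\<omega> in M. X (Suc n) \<omega> = y \<bar> \<forall>k\<le>n. X k \<omega> = x k) = q (x n) y)"

definition visits :: "'s \<Rightarrow> 's list \<Rightarrow> nat" where
  "visits u \<pi> = card {j. j < length \<pi> \<and> \<pi> ! j = u}"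

definition multi_range :: "nat \<Rightarrow> 's list \<Rightarrow> nat" where
  "multi_range r \<pi> = card {u \<in> set \<pi>. visits u \<pi> = r}"

end

theory Submission
  imports Defs "HOL-Library.Sublist"
begin

text \<open>
  The proof cuts the trajectory of the walk into independent pieces that visit disjoint sets of
  vertices, so that the number of vertices visited exactly r times becomes a sum of independent
  variables up to a boundary term.

  The cone of a word w consists of the words with prefix w. A cone can only be entered through w,
  and if w ends with a letter of the first factor, then the walk inside the cone of w, with the
  prefix w removed, moves like the walk that starts at the empty word and makes no step in the
  first factor there. A time k is a regeneration time if w = X_k ends with a letter of the first
  factor, the walk was never in the cone of w before, and it never leaves this cone afterwards.
  Vertices visited before and after a regeneration time are different, so the multiplicities of
  the vertices in the piece between two consecutive regeneration times are decided by this piece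
  alone. Since the probability of a path is the product of its transition probabilities, the pieces
  are independent and identically distributed (\<open>regeneration\<close>, \<open>Z_law\<close>). The strong law of
  large numbers for their lengths and for their numbers of vertices of multiplicity r then gives
  the limit as a quotient of two means (\<open>multi_range_limit\<close>).

  The mean length of a piece has to be finite. If u_k is the probability that k is a regeneration
  time and t_j the probability that none of the times 1, ..., j is one, then splitting according to
  the last regeneration time up to n gives that the sum of u_k t_(n-k) over k is at most 1. Hence
  the sum of the t_j, which is the mean length, is finite as soon as u_0 + ... + u_n grows linearly
  in n (\<open>no_regen_prob_summable\<close>). Now u_k is the probability that the walk from the empty word
  makes no step in the first factor at the root up to time k and at time k sees a word of the first
  type that it has not seen before; so the sum is an expected number of distinct words. It grows linearly because each visited word is left for ever with a
  probability that is bounded below (\<open>fresh_sum_linear_growth\<close>).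

  This lower bound comes from the return probabilities of the empty word, which are summable
  because the radius of convergence exceeds 1. By the Borel-Cantelli lemma the walk then avoids the
  empty word for ever with positive probability; it does so on one of the two sides, and one step
  into the other factor followed by such an escape yields an escape on the other side
  (\<open>escape_prob_pos\<close>). The same bound shows that almost surely the walk at some time enters a cone
  that it never leaves (\<open>AE_eventually_stay\<close>), and from then on the limit theorem applies.
  Finally, the limit is positive since with positive probability the walk visits the root exactly r
  times and then moves into a cone for ever (\<open>visits_root_prob_pos\<close>).
\<close>

section \<open>The strong law of large numbers\<close>

context prob_space begin

text \<open>Both families have the same product measure as their joint law.\<close>
lemma shifted_sums_same_expectation:
  fixes X :: "nat \<Rightarrow> 'a \<Rightarrow> real" and g :: "(nat \<Rightarrow> real) \<Rightarrow> real"
  assumes ind: "indep_vars (\<lambda>_. borel) X UNIV"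
    and id: "\<And>i. distr M borel (X i) = distr M borel (X 0)"
    and g: "g \<in> borel_measurable (PiM {..<n} (\<lambda>_. borel))"
  shows "expectation (\<lambda>\<omega>. g (\<lambda>i\<in>{..<n}. X (Suc i) \<omega>)) = expectation (\<lambda>\<omega>. g (\<lambda>i\<in>{..<n}. X i \<omega>))"
proof (cases "n = 0")
  case False
  then have ne: "{..<n} \<noteq> {}" by auto
  have rv[measurable]: "X i \<in> borel_measurable M" for i
    using ind by (auto simp: indep_vars_def)
  have 1: "indep_vars (\<lambda>_. borel) (\<lambda>i. X (Suc i)) {..<n}"
    unfolding indep_vars_def2
  proof safe
    let ?F = "\<lambda>i. {X i -` A \<inter> space M |A. A \<in> sets borel}"
    have F: "indep_sets ?F UNIV" using ind unfolding indep_vars_def2 by simp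
    show "indep_sets (\<lambda>i. {X (Suc i) -` A \<inter> space M |A. A \<in> sets borel}) {..<n}"
    proof (rule indep_setsI)
      fix A J assume J: "J \<noteq> {}" "J \<subseteq> {..<n}" "finite J"
        and A: "\<forall>j\<in>J. A j \<in> {X (Suc j) -` A \<inter> space M |A. A \<in> sets borel}"
      have "prob (\<Inter>j\<in>Suc ` J. A (j - 1)) = (\<Prod>j\<in>Suc ` J. prob (A (j - 1)))"
        by (rule indep_setsD[OF F]) (use J A in auto)
      then show "prob (\<Inter> (A ` J)) = (\<Prod>j\<in>J. prob (A j))"
        by (simp add: prod.reindex image_image)
    qed auto
  qed auto
  have 2: "indep_vars (\<lambda>_. borel) X {..<n}"
    by (rule indep_vars_subset[OF ind]) auto
  have "distr M (PiM {..<n} (\<lambda>_. borel)) (\<lambda>\<omega>. \<lambda>i\<in>{..<n}. X (Suc i) \<omega>) =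
        distr M (PiM {..<n} (\<lambda>_. borel)) (\<lambda>\<omega>. \<lambda>i\<in>{..<n}. X i \<omega>)"
    using 1 2 indep_vars_iff_distr_eq_PiM[OF ne, where M' = "\<lambda>_. borel" and X = X]
      indep_vars_iff_distr_eq_PiM[OF ne, where M' = "\<lambda>_. borel" and X = "\<lambda>i. X (Suc i)"]
      PiM_cong[OF refl, of "{..<n}" "\<lambda>i. distr M borel (X (Suc i))" "\<lambda>_. distr M borel (X 0)", OF id]
      PiM_cong[OF refl, of "{..<n}" "\<lambda>i. distr M borel (X i)" "\<lambda>_. distr M borel (X 0)", OF id]
    by simp
  moreover have "expectation (\<lambda>\<omega>. g (\<lambda>i\<in>{..<n}. Y i \<omega>)) =
     integral\<^sup>L (distr M (PiM {..<n} (\<lambda>_. borel)) (\<lambda>\<omega>. \<lambda>i\<in>{..<n}. Y i \<omega>)) g"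
    if [measurable]: "\<And>i. Y i \<in> borel_measurable M" for Y
    by (rule integral_distr[symmetric]) (use g in measurable)
  ultimately show ?thesis by simp
qed (simp add: restrict_def)

text \<open>Garsia's argument for the maximal ergodic inequality.\<close>

text \<open>The maximum is over partial sums of at most n terms; the empty sum makes it nonnegative.\<close>
definition running_max :: "nat \<Rightarrow> (nat \<Rightarrow> real) \<Rightarrow> real" where
  "running_max n x = Max ((\<lambda>k. \<Sum>i<k. x i) ` {..n})"

lemma running_max_restrict: "running_max n (\<lambda>i\<in>{..<n}. x i) = running_max n x"
  unfolding running_max_def by (intro arg_cong[where f=Max] image_cong sum.cong) auto

lemma running_max_nonneg: "0 \<le> running_max n x"
  unfolding running_max_def by (rule Max_ge) (auto intro!: image_eqI[of _ _ 0])

text \<open>If the maximum is positive, it is attained by a nonempty sum, and removing the first term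
  leaves a partial sum of the shifted sequence.\<close>
lemma running_max_le_shift:
  assumes "0 < running_max n x"
  shows "running_max n x \<le> x 0 + running_max n (\<lambda>i. x (Suc i))"
proof -
  have "running_max n x \<in> (\<lambda>k. \<Sum>i<k. x i) ` {..n}"
    unfolding running_max_def by (rule Max_in) auto
  then obtain k where k: "k \<le> n" "running_max n x = (\<Sum>i<k. x i)" by auto
  with assms obtain j where j: "k = Suc j" by (cases k) auto
  have "(\<Sum>i<j. x (Suc i)) \<le> running_max n (\<lambda>i. x (Suc i))"
    unfolding running_max_def by (rule Max_ge) (use j k in auto)
  then show ?thesis
    unfolding k j sum.lessThan_Suc_shift by simp
qed

lemma running_max_abs_le: "\<bar>running_max n x\<bar> \<le> (\<Sum>i<n. \<bar>x i\<bar>)"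
proof -
  have "running_max n x \<in> (\<lambda>k. \<Sum>i<k. x i) ` {..n}"
    unfolding running_max_def by (rule Max_in) auto
  then obtain k where k: "k \<le> n" "running_max n x = (\<Sum>i<k. x i)" by auto
  have "\<bar>\<Sum>i<k. x i\<bar> \<le> (\<Sum>i<k. \<bar>x i\<bar>)" by (rule sum_abs)
  also have "\<dots> \<le> (\<Sum>i<n. \<bar>x i\<bar>)" using k by (intro sum_mono2) auto
  finally show ?thesis using k by simp
qed

text \<open>The maximal inequality says that the expectation of the first term over the event that some
  partial sum is positive is nonnegative. If the partial sums were unbounded with probability 1, then
  this event would have full measure, against the negative mean. Unboundedness of the partial sums is
  a tail event, so Kolmogorov's law leaves only probability 0.\<close>
lemma iid_sums_bounded_above:
  fixes X :: "nat \<Rightarrow> 'a \<Rightarrow> real"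
  assumes ind: "indep_vars (\<lambda>_. borel) X UNIV"
    and id: "\<And>i. distr M borel (X i) = distr M borel (X 0)"
    and int: "integrable M (X 0)" and neg: "expectation (X 0) < 0"
  shows "AE \<omega> in M. \<exists>K. \<forall>n. (\<Sum>i<n. X i \<omega>) \<le> K"
proof -
  have rv[measurable]: "X i \<in> borel_measurable M" for i
    using ind by (auto simp: indep_vars_def)
  have inti: "integrable M (X i)" for i
  proof -
    have "integrable (distr M borel (X i)) (\<lambda>x. x)"
      unfolding id[of i] using int by (subst integrable_distr_eq) auto
    then show ?thesis by (subst (asm) integrable_distr_eq) auto
  qed
  have rm[measurable]: "(\<lambda>\<omega>. running_max n (\<lambda>i. X (j i) \<omega>)) \<in> borel_measurable M" for n j
    unfolding running_max_def by (intro borel_measurable_Max) auto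
  have rmP[measurable]: "running_max n \<in> borel_measurable (PiM {..<n} (\<lambda>_. borel))" for n
    unfolding running_max_def
    by (intro borel_measurable_Max borel_measurable_sum measurable_component_singleton) auto
  have intM: "integrable M (\<lambda>\<omega>. running_max n (\<lambda>i. X (j i) \<omega>))" for n j
    by (rule Bochner_Integration.integrable_bound[where f="\<lambda>\<omega>. \<Sum>i<n. \<bar>X (j i) \<omega>\<bar>"])
       (use inti running_max_abs_le in \<open>auto intro!: always_eventually order_trans[OF running_max_abs_le]\<close>)
  define U where "U n = {\<omega>\<in>space M. 0 < running_max n (\<lambda>i. X i \<omega>)}" for n
  have [measurable]: "U n \<in> events" for n unfolding U_def by measurable
  (* The first term dominates the difference of two maxima with equal expectation. *)
  have max_ineq: "0 \<le> expectation (\<lambda>\<omega>. X 0 \<omega> * indicator (U n) \<omega>)" for n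
  proof -
    let ?M = "\<lambda>\<omega>. running_max n (\<lambda>i. X i \<omega>)" and ?M' = "\<lambda>\<omega>. running_max n (\<lambda>i. X (Suc i) \<omega>)"
    have "expectation ?M' = expectation ?M"
      using shifted_sums_same_expectation[OF ind id rmP[of n]]
      by (simp add: running_max_restrict)
    then have "0 = expectation (\<lambda>\<omega>. ?M \<omega> - ?M' \<omega>)"
      using intM[of n "\<lambda>i. i"] intM[of n Suc] by (subst Bochner_Integration.integral_diff) auto
    also have "\<dots> \<le> expectation (\<lambda>\<omega>. X 0 \<omega> * indicator (U n) \<omega>)"
    proof (rule integral_mono)
      show "integrable M (\<lambda>\<omega>. ?M \<omega> - ?M' \<omega>)"
        using intM[of n "\<lambda>i. i"] intM[of n Suc] by auto
      show "integrable M (\<lambda>\<omega>. X 0 \<omega> * indicator (U n) \<omega>)"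
        using int by (intro integrable_real_mult_indicator) auto
      fix \<omega> assume "\<omega> \<in> space M"
      then show "?M \<omega> - ?M' \<omega> \<le> X 0 \<omega> * indicator (U n) \<omega>"
        using running_max_le_shift[of n "\<lambda>i. X i \<omega>"] running_max_nonneg[of n "\<lambda>i. X (Suc i) \<omega>"]
          running_max_nonneg[of n "\<lambda>i. X i \<omega>"]
        by (cases "0 < ?M \<omega>") (auto simp: U_def)
    qed
    finally show ?thesis .
  qed
  define B where "B = {\<omega>\<in>space M. \<forall>K::nat. \<exists>n. real K < (\<Sum>i<n. X i \<omega>)}"
  have [measurable]: "B \<in> events" unfolding B_def by measurable
  have "prob B = 0 \<or> prob B = 1"
  proof (rule kolmogorov_0_1_law)
    let ?A = "\<lambda>i. sigma_sets (space M) {X i -` A \<inter> space M |A. A \<in> sets borel}"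
    show "sigma_algebra (space M) (?A i)" for i by (rule sigma_algebra_sigma_sets) auto
    show "indep_sets ?A UNIV" using ind unfolding indep_vars_def by simp
    show "B \<in> tail_events ?A"
      unfolding tail_events_def
    proof safe
      fix n
      let ?G = "\<Union>i\<in>{n..}. ?A i"
      define F where "F = sigma (space M) ?G"
      have "?A i \<subseteq> Pow (space M)" for i
        using sigma_sets_into_sp[of "{X i -` A \<inter> space M |A. A \<in> sets borel}" "space M"] by blast
      then have G: "?G \<subseteq> Pow (space M)" by blast
      then have F: "space F = space M" "sets F = sigma_sets (space M) ?G"
        by (auto simp: F_def space_measure_of sets_measure_of)
      have [measurable]: "X (i + n) \<in> borel_measurable F" for i
      proof (rule measurableI)
        fix A :: "real set" assume "A \<in> sets borel"
        then have "X (i + n) -` A \<inter> space M \<in> ?G"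
          by (intro UN_I[of "i + n"]) (auto intro!: sigma_sets.Basic)
        then show "X (i + n) -` A \<inter> space F \<in> sets F"
          unfolding F by (rule sigma_sets.Basic)
      qed auto
      (* Removing the first n terms changes the partial sums by a bounded amount. *)
      have eq: "(\<forall>K::nat. \<exists>k. real K < (\<Sum>i<k. x i)) \<longleftrightarrow> (\<forall>K::nat. \<exists>k. real K < (\<Sum>i<k. x (i + n)))"
        (is "?L \<longleftrightarrow> ?R") for x :: "nat \<Rightarrow> real"
      proof
        assume L: ?L
        show ?R
        proof
          fix K :: nat
          define D where "D = (\<Sum>i<n. \<bar>x i\<bar>)"
          obtain K' :: nat where K': "real K + D \<le> real K'" using real_arch_simple by blast
          obtain k where k: "real K' < (\<Sum>i<k. x i)" using L by blast
          have "(\<Sum>i<k. x i) \<le> D" if "k \<le> n"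
          proof -
            have "(\<Sum>i<k. x i) \<le> (\<Sum>i<k. \<bar>x i\<bar>)" by (intro sum_mono) auto
            also have "\<dots> \<le> D" unfolding D_def using that by (intro sum_mono2) auto
            finally show ?thesis .
          qed
          with k K' have "n \<le> k" by linarith
          then obtain l where l: "k = l + n" using le_Suc_ex by (metis add.commute)
          have "(\<Sum>i<k. x i) = (\<Sum>i<n. x i) + (\<Sum>i<l. x (i + n))"
            unfolding l by (induction l) (auto simp: add_ac)
          also have "(\<Sum>i<n. x i) \<le> D" unfolding D_def by (intro sum_mono) auto
          finally have "real K < (\<Sum>i<l. x (i + n))" using k K' by linarith
          then show "\<exists>k. real K < (\<Sum>i<k. x (i + n))" ..
        qed
      next
        assume R: ?R
        show ?L
        proof
          fix K :: nat
          define D where "D = (\<Sum>i<n. \<bar>x i\<bar>)"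
          obtain K' :: nat where K': "real K + D \<le> real K'" using real_arch_simple by blast
          obtain l where k: "real K' < (\<Sum>i<l. x (i + n))" using R by blast
          have "(\<Sum>i<l + n. x i) = (\<Sum>i<n. x i) + (\<Sum>i<l. x (i + n))"
            by (induction l) (auto simp: add_ac)
          moreover have "- (\<Sum>i<n. x i) \<le> D"
            unfolding D_def by (simp add: sum_negf[symmetric] sum_mono)
          ultimately have "real K < (\<Sum>i<l + n. x i)" using k K' by linarith
          then show "\<exists>k. real K < (\<Sum>i<k. x i)" ..
        qed
      qed
      have "B = {\<omega>\<in>space F. \<forall>K::nat. \<exists>k. real K < (\<Sum>i<k. X (i + n) \<omega>)}"
        unfolding B_def F eq[of "\<lambda>i. X i _"] by simp
      also have "\<dots> \<in> sets F" by measurable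
      finally show "B \<in> sigma_sets (space M) ?G" by (simp add: F)
    qed
  qed
  moreover have "prob B \<noteq> 1"
  proof
    assume "prob B = 1"
    then have aeB: "AE \<omega> in M. \<omega> \<in> B" by (simp add: prob_eq_1)
    have "(\<lambda>n. expectation (\<lambda>\<omega>. X 0 \<omega> * indicator (U n) \<omega>)) \<longlonglongrightarrow> expectation (X 0)"
    proof (rule integral_dominated_convergence[where w="\<lambda>\<omega>. \<bar>X 0 \<omega>\<bar>"])
      show "AE \<omega> in M. (\<lambda>n. X 0 \<omega> * indicator (U n) \<omega>) \<longlonglongrightarrow> X 0 \<omega>"
        using aeB
      proof eventually_elim
        fix \<omega> assume "\<omega> \<in> B"
        then obtain n where n: "0 < (\<Sum>i<n. X i \<omega>)" and sp: "\<omega> \<in> space M"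
          unfolding B_def by (auto dest!: spec[of _ 0])
        have "\<omega> \<in> U m" if "m \<ge> n" for m
        proof -
          have "(\<Sum>i<n. X i \<omega>) \<le> running_max m (\<lambda>i. X i \<omega>)"
            unfolding running_max_def by (rule Max_ge) (use that in auto)
          then show ?thesis using n sp by (simp add: U_def)
        qed
        then have "eventually (\<lambda>m. X 0 \<omega> * indicator (U m) \<omega> = X 0 \<omega>) sequentially"
          by (auto simp: eventually_sequentially intro!: exI[of _ n])
        then show "(\<lambda>n. X 0 \<omega> * indicator (U n) \<omega>) \<longlonglongrightarrow> X 0 \<omega>" by (rule tendsto_eventually)
      qed
    qed (use int in \<open>auto intro!: always_eventually split: split_indicator\<close>)
    then have "0 \<le> expectation (X 0)"
      using max_ineq by (intro LIMSEQ_le_const) auto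
    with neg show False by simp
  qed
  ultimately have "prob B = 0" by simp
  then have "AE \<omega> in M. \<omega> \<notin> B" by (simp add: prob_eq_0)
  with AE_space show ?thesis
  proof eventually_elim
    case (elim \<omega>)
    then obtain K :: nat where "\<forall>n. \<not> real K < (\<Sum>i<n. X i \<omega>)" unfolding B_def by auto
    then show ?case by (intro exI[of _ "real K"]) (auto simp: not_less)
  qed
qed

text \<open>Subtracting slightly more than the mean gives variables with negative mean.\<close>
lemma iid_averages_eventually_le:
  fixes X :: "nat \<Rightarrow> 'a \<Rightarrow> real"
  assumes ind: "indep_vars (\<lambda>_. borel) X UNIV"
    and id: "\<And>i. distr M borel (X i) = distr M borel (X 0)"
    and int: "integrable M (X 0)" and e: "0 < e"
  shows "AE \<omega> in M. eventually (\<lambda>n. (\<Sum>i<n. X i \<omega>) / real n < expectation (X 0) + e) sequentially"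
proof -
  define c where "c = expectation (X 0) + e / 2"
  have rv[measurable]: "X i \<in> borel_measurable M" for i
    using ind by (auto simp: indep_vars_def)
  have "AE \<omega> in M. \<exists>K. \<forall>n. (\<Sum>i<n. X i \<omega> - c) \<le> K"
  proof (rule iid_sums_bounded_above)
    show "indep_vars (\<lambda>_. borel) (\<lambda>i \<omega>. X i \<omega> - c) UNIV"
      by (rule indep_vars_compose2[OF ind, where Y="\<lambda>_ x. x - c"]) auto
    have "distr M borel (\<lambda>\<omega>. X i \<omega> - c) = distr (distr M borel (X i)) borel (\<lambda>x. x - c)" for i
      by (subst distr_distr) (auto simp: comp_def)
    then show "distr M borel (\<lambda>\<omega>. X i \<omega> - c) = distr M borel (\<lambda>\<omega>. X 0 \<omega> - c)" for i
      by (simp add: id[of i])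
    show "integrable M (\<lambda>\<omega>. X 0 \<omega> - c)" using int by auto
    show "expectation (\<lambda>\<omega>. X 0 \<omega> - c) < 0"
      using int e by (simp add: c_def prob_space)
  qed
  then show ?thesis
  proof eventually_elim
    case (elim \<omega>)
    then obtain K where K: "\<And>n. (\<Sum>i<n. X i \<omega> - c) \<le> K" by blast
    have "(\<lambda>n. K / real n) \<longlonglongrightarrow> 0" by real_asymp
    then have "eventually (\<lambda>n. K / real n < e / 2) sequentially"
      using e by (intro order_tendstoD) auto
    with eventually_gt_at_top[of 0] show ?case
    proof eventually_elim
      case (elim n)
      have "(\<Sum>i<n. X i \<omega>) \<le> K + real n * c" using K[of n] by (simp add: sum_subtractf)
      then have "(\<Sum>i<n. X i \<omega>) / real n \<le> (K + real n * c) / real n"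
        by (rule divide_right_mono) simp
      also have "\<dots> = K / real n + c" using elim by (simp add: field_simps)
      also have "\<dots> < e / 2 + c" using elim(2) by (rule add_strict_right_mono)
      also have "e / 2 + c = expectation (X 0) + e" by (simp add: c_def)
      finally show ?case .
    qed
  qed
qed

theorem strong_law_of_large_numbers:
  fixes X :: "nat \<Rightarrow> 'a \<Rightarrow> real"
  assumes ind: "indep_vars (\<lambda>_. borel) X UNIV"
    and id: "\<And>i. distr M borel (X i) = distr M borel (X 0)"
    and int: "integrable M (X 0)"
  shows "AE \<omega> in M. (\<lambda>n. (\<Sum>i<n. X i \<omega>) / real n) \<longlonglongrightarrow> expectation (X 0)"
proof -
  have rv[measurable]: "X i \<in> borel_measurable M" for i
    using ind by (auto simp: indep_vars_def)
  have up: "AE \<omega> in M. \<forall>k. eventually (\<lambda>n. (\<Sum>i<n. X i \<omega>) / real n < expectation (X 0) + 1 / real (Suc k)) sequentially"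
    unfolding AE_all_countable by (intro allI iid_averages_eventually_le[OF assms]) auto
  have "AE \<omega> in M. \<forall>k. eventually (\<lambda>n. (\<Sum>i<n. - X i \<omega>) / real n < expectation (\<lambda>\<omega>. - X 0 \<omega>) + 1 / real (Suc k)) sequentially"
    unfolding AE_all_countable
  proof (intro allI iid_averages_eventually_le)
    show "indep_vars (\<lambda>_. borel) (\<lambda>i \<omega>. - X i \<omega>) UNIV"
      by (rule indep_vars_compose2[OF ind, where Y="\<lambda>_ x. - x"]) auto
    have "distr M borel (\<lambda>\<omega>. - X i \<omega>) = distr (distr M borel (X i)) borel (\<lambda>x. - x)" for i
      by (subst distr_distr) (auto simp: comp_def)
    then show "distr M borel (\<lambda>\<omega>. - X i \<omega>) = distr M borel (\<lambda>\<omega>. - X 0 \<omega>)" for i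
      by (simp add: id[of i])
  qed (use int in auto)
  with up show ?thesis
  proof eventually_elim
    case (elim \<omega>)
    let ?m = "expectation (X 0)" and ?s = "\<lambda>n. (\<Sum>i<n. X i \<omega>) / real n"
    show ?case
    proof (rule LIMSEQ_I)
      fix e :: real assume "0 < e"
      then obtain k where k: "1 / real (Suc k) < e" using nat_approx_posE by blast
      have "eventually (\<lambda>n. norm (?s n - ?m) < e) sequentially"
        using elim(1)[rule_format, of k] elim(2)[rule_format, of k]
        by eventually_elim (use k in \<open>auto simp: sum_negf abs_less_iff simp del: of_nat_Suc\<close>)
      then show "\<exists>N. \<forall>n\<ge>N. norm (?s n - ?m) < e" by (simp add: eventually_sequentially)
    qed
  qed
qed

end

section \<open>Countably valued random variables\<close>

context prob_space begin

text \<open>Two events have proportional probabilities if this holds on each level set of a pair of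
  countably valued variables. All identities between path probabilities below are reduced in this
  way to identities between the probabilities of single paths.\<close>
lemma prob_proportional_by_values:
  assumes C: "countable C"
    and A[measurable]: "Measurable.pred M A" and B[measurable]: "Measurable.pred M B"
    and Y: "Y \<in> measurable M (count_space C)" and Z: "Z \<in> measurable M (count_space C)"
    and k: "0 \<le> k"
    and eq: "\<And>c. c \<in> C \<Longrightarrow> \<P>(\<omega> in M. A \<omega> \<and> Y \<omega> = c) = k * \<P>(\<omega> in M. B \<omega> \<and> Z \<omega> = c)"
  shows "\<P>(\<omega> in M. A \<omega>) = k * \<P>(\<omega> in M. B \<omega>)"
proof -
  have split: "emeasure M {\<omega>\<in>space M. A \<omega>} = (\<integral>\<^sup>+c. emeasure M {\<omega>\<in>space M. A \<omega> \<and> Y \<omega> = c} \<partial>count_space C)"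
    if [measurable]: "Measurable.pred M A" and Y: "Y \<in> measurable M (count_space C)" for A Y
  proof -
    have [measurable]: "Measurable.pred M (\<lambda>\<omega>. Y \<omega> = c)" if "c \<in> C" for c
      using Y that by measurable
    have "{\<omega>\<in>space M. A \<omega>} = (\<Union>c\<in>C. {\<omega>\<in>space M. A \<omega> \<and> Y \<omega> = c})"
      using measurable_space[OF Y] by auto
    then show ?thesis
      by (simp only:) (rule emeasure_UN_countable, auto simp: C disjoint_family_on_def)
  qed
  have "emeasure M {\<omega>\<in>space M. A \<omega>} = (\<integral>\<^sup>+c. emeasure M {\<omega>\<in>space M. A \<omega> \<and> Y \<omega> = c} \<partial>count_space C)"
    by (rule split[OF A Y])
  also have "\<dots> = (\<integral>\<^sup>+c. ennreal k * emeasure M {\<omega>\<in>space M. B \<omega> \<and> Z \<omega> = c} \<partial>count_space C)"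
    by (rule nn_integral_cong) (use k in \<open>simp add: emeasure_eq_measure eq ennreal_mult\<close>)
  also have "\<dots> = ennreal k * emeasure M {\<omega>\<in>space M. B \<omega>}"
    by (subst nn_integral_cmult) (auto simp: split[OF B Z])
  finally show ?thesis
    using k by (simp add: emeasure_eq_measure flip: ennreal_mult)
qed

text \<open>The points are replaced by sets one coordinate after the other.\<close>
lemma prob_product_sets_of_points:
  fixes Z :: "nat \<Rightarrow> 'a \<Rightarrow> 'z::countable"
  assumes Z[measurable]: "\<And>i. Z i \<in> measurable M (count_space UNIV)"
    and law: "\<And>m z. \<P>(\<omega> in M. \<forall>i<m. Z i \<omega> = z i) = (\<Prod>i<m. f (z i))"
  shows "\<P>(\<omega> in M. \<forall>i<m. Z i \<omega> \<in> E i) = (\<Prod>i<m. \<P>(\<omega> in M. Z 0 \<omega> \<in> E i))"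
proof -
  have f: "f z = \<P>(\<omega> in M. Z 0 \<omega> = z)" for z
    using law[of 1 "\<lambda>_. z"] by simp
  have f0: "0 \<le> f z" for z unfolding f by simp
  have "\<P>(\<omega> in M. (\<forall>i<j. Z i \<omega> \<in> E i) \<and> (\<forall>i\<in>{j..<m}. Z i \<omega> = z i)) =
      (\<Prod>i<j. \<P>(\<omega> in M. Z 0 \<omega> \<in> E i)) * (\<Prod>i\<in>{j..<m}. f (z i))" if "j \<le> m" for j z
    using that
  proof (induction j arbitrary: z)
    case 0
    then show ?case using law[of m z] by (simp add: atLeast0LessThan Ball_def)
  next
    case (Suc j)
    let ?k = "(\<Prod>i<j. \<P>(\<omega> in M. Z 0 \<omega> \<in> E i)) * (\<Prod>i\<in>{Suc j..<m}. f (z i))"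
    have k0: "0 \<le> ?k" by (intro mult_nonneg_nonneg prod_nonneg) (auto simp: f0)
    have "\<P>(\<omega> in M. (\<forall>i<Suc j. Z i \<omega> \<in> E i) \<and> (\<forall>i\<in>{Suc j..<m}. Z i \<omega> = z i)) =
        ?k * \<P>(\<omega> in M. Z 0 \<omega> \<in> E j)"
    proof (rule prob_proportional_by_values[where C=UNIV and Y="Z j" and Z="Z 0"])
      fix c :: 'z
      show "\<P>(\<omega> in M. ((\<forall>i<Suc j. Z i \<omega> \<in> E i) \<and> (\<forall>i\<in>{Suc j..<m}. Z i \<omega> = z i)) \<and> Z j \<omega> = c) =
          ?k * \<P>(\<omega> in M. Z 0 \<omega> \<in> E j \<and> Z 0 \<omega> = c)"
      proof (cases "c \<in> E j")
        case True
        have ins: "{j..<m} = insert j {Suc j..<m}" using Suc.prems by auto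
        have "((\<forall>i<Suc j. Z i \<omega> \<in> E i) \<and> (\<forall>i\<in>{Suc j..<m}. Z i \<omega> = z i)) \<and> Z j \<omega> = c \<longleftrightarrow>
            (\<forall>i<j. Z i \<omega> \<in> E i) \<and> (\<forall>i\<in>{j..<m}. Z i \<omega> = (z(j := c)) i)" for \<omega>
        proof -
          have "(\<forall>i\<in>{Suc j..<m}. Z i \<omega> = (z(j := c)) i) \<longleftrightarrow> (\<forall>i\<in>{Suc j..<m}. Z i \<omega> = z i)"
            by (intro ball_cong) auto
          then show ?thesis using True by (auto simp: ins All_less_Suc fun_upd_same simp del: fun_upd_apply)
        qed
        moreover have "(\<Prod>i\<in>{Suc j..<m}. f ((z(j := c)) i)) = (\<Prod>i\<in>{Suc j..<m}. f (z i))"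
          by (intro prod.cong) auto
        then have "(\<Prod>i\<in>{j..<m}. f ((z(j := c)) i)) = f c * (\<Prod>i\<in>{Suc j..<m}. f (z i))"
          unfolding ins by simp
        moreover have "Z 0 \<omega> \<in> E j \<and> Z 0 \<omega> = c \<longleftrightarrow> Z 0 \<omega> = c" for \<omega> using True by auto
        ultimately show ?thesis
          using Suc.IH[of "z(j := c)"] Suc.prems by (simp add: f mult_ac del: fun_upd_apply)
      next
        case False
        then have none: "{\<omega>\<in>space M. ((\<forall>i<Suc j. Z i \<omega> \<in> E i) \<and> (\<forall>i\<in>{Suc j..<m}. Z i \<omega> = z i)) \<and> Z j \<omega> = c} = {}"
          "{\<omega>\<in>space M. Z 0 \<omega> \<in> E j \<and> Z 0 \<omega> = c} = {}" by auto
        show ?thesis unfolding none by simp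
      qed
    qed (use k0 in auto)
    then show ?case by (simp add: mult_ac)
  qed
  from this[of m undefined] show ?thesis by simp
qed

text \<open>Events about finitely many of the variables are events about an initial segment in which the
  remaining variables are unrestricted.\<close>
lemma iid_if_point_probabilities_multiply:
  fixes Z :: "nat \<Rightarrow> 'a \<Rightarrow> 'z::countable"
  assumes Z[measurable]: "\<And>i. Z i \<in> measurable M (count_space UNIV)"
    and law: "\<And>m z. \<P>(\<omega> in M. \<forall>i<m. Z i \<omega> = z i) = (\<Prod>i<m. f (z i))"
  shows "indep_vars (\<lambda>_. count_space UNIV) Z UNIV"
    and "\<And>i. distr M (count_space UNIV) (Z i) = distr M (count_space UNIV) (Z 0)"
proof -
  note prod = prob_product_sets_of_points[OF Z law]
  have one: "\<P>(\<omega> in M. Z i \<omega> \<in> E) = \<P>(\<omega> in M. Z 0 \<omega> \<in> E)" for i E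
  proof -
    have "\<P>(\<omega> in M. Z i \<omega> \<in> E) = \<P>(\<omega> in M. \<forall>j<Suc i. Z j \<omega> \<in> (if j = i then E else UNIV))"
      by (rule arg_cong[where f="measure M"]) (auto simp: less_Suc_eq)
    also have "\<dots> = (\<Prod>j<Suc i. \<P>(\<omega> in M. Z 0 \<omega> \<in> (if j = i then E else UNIV)))"
      by (rule prod)
    also have "\<dots> = (\<Prod>j<i. 1) * \<P>(\<omega> in M. Z 0 \<omega> \<in> E)"
      by (simp add: prob_space)
    finally show ?thesis by simp
  qed
  have vim: "Z i -` E \<inter> space M = {\<omega>\<in>space M. Z i \<omega> \<in> E}" for i E by auto
  show "distr M (count_space UNIV) (Z i) = distr M (count_space UNIV) (Z 0)" for i
  proof (rule measure_eqI)
    fix A show "emeasure (distr M (count_space UNIV) (Z i)) A = emeasure (distr M (count_space UNIV) (Z 0)) A"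
      using one[of i A] by (simp add: emeasure_distr emeasure_eq_measure vim)
  qed simp
  show "indep_vars (\<lambda>_. count_space UNIV) Z UNIV"
    unfolding indep_vars_def2
  proof safe
    show "indep_sets (\<lambda>i. {Z i -` A \<inter> space M |A. A \<in> sets (count_space UNIV)}) UNIV"
    proof (rule indep_setsI)
      fix A J assume J: "J \<noteq> {}" "finite J"
        and A: "\<forall>j\<in>J. A j \<in> {Z j -` A \<inter> space M |A. A \<in> sets (count_space UNIV)}"
      then have "\<forall>j\<in>J. \<exists>E. A j = Z j -` E \<inter> space M" by blast
      then obtain E where E: "\<And>j. j \<in> J \<Longrightarrow> A j = Z j -` E j \<inter> space M" by metis
      define m where "m = Suc (Max J)"
      have Jm: "J \<subseteq> {..<m}" using J by (auto simp: m_def less_Suc_eq_le)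
      define E' where "E' j = (if j \<in> J then E j else UNIV)" for j
      have "prob (\<Inter> (A ` J)) = \<P>(\<omega> in M. \<forall>i<m. Z i \<omega> \<in> E' i)"
        using J Jm by (intro arg_cong[where f=prob]) (auto simp: E E'_def)
      also have "\<dots> = (\<Prod>i<m. \<P>(\<omega> in M. Z 0 \<omega> \<in> E' i))" by (rule prod)
      also have "\<dots> = (\<Prod>i\<in>J. \<P>(\<omega> in M. Z 0 \<omega> \<in> E' i))"
        using Jm by (intro prod.mono_neutral_right) (auto simp: E'_def prob_space)
      also have "\<dots> = (\<Prod>i\<in>J. prob (A i))"
      proof (intro prod.cong refl)
        fix i assume "i \<in> J"
        then show "\<P>(\<omega> in M. Z 0 \<omega> \<in> E' i) = prob (A i)"
          using one[of i "E i"] by (simp add: E'_def E vim)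
      qed
      finally show "prob (\<Inter> (A ` J)) = (\<Prod>i\<in>J. prob (A i))" .
    qed auto
  qed auto
qed

end

section \<open>Markov chains on words\<close>

definition adapted :: "nat \<Rightarrow> ((nat \<Rightarrow> 's) \<Rightarrow> bool) \<Rightarrow> bool" where
  "adapted n P \<longleftrightarrow> (\<forall>x y. (\<forall>k\<le>n. x k = y k) \<longrightarrow> P x = P y)"

lemma adaptedD: "adapted n P \<Longrightarrow> (\<And>k. k \<le> n \<Longrightarrow> x k = y k) \<Longrightarrow> P x = P y"
  unfolding adapted_def by blast

lemma adapted_mono: "adapted n P \<Longrightarrow> n \<le> m \<Longrightarrow> adapted m P"
  unfolding adapted_def by (meson order_trans)

lemma adapted_const: "adapted n (\<lambda>y. c)"
  by (simp add: adapted_def)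

lemma adapted_conj: "adapted n P \<Longrightarrow> adapted n Q \<Longrightarrow> adapted n (\<lambda>y. P y \<and> Q y)"
  unfolding adapted_def by metis

text \<open>An adapted event depends on a countably valued initial segment of the path, so it is
  measurable without any assumption on the predicate.\<close>
lemma pred_adapted:
  assumes S: "countable S" and Y: "\<And>k. Y k \<in> measurable N (count_space S)" and P: "adapted n P"
  shows "Measurable.pred N (\<lambda>\<omega>. P (\<lambda>k. Y k \<omega>))"
    and "(\<lambda>\<omega>. \<lambda>k\<in>{..n}. Y k \<omega>) \<in> measurable N (count_space (PiE {..n} (\<lambda>_. S)))"
proof -
  let ?Z = "\<lambda>\<omega>. \<lambda>k\<in>{..n}. Y k \<omega>"
  have C: "countable (PiE {..n} (\<lambda>_. S))" by (intro countable_PiE) (use S in auto)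
  show Z: "?Z \<in> measurable N (count_space (PiE {..n} (\<lambda>_. S)))"
    unfolding measurable_count_space_eq_countable[OF C]
  proof (intro conjI ballI funcsetI)
    fix \<omega> assume "\<omega> \<in> space N"
    then show "?Z \<omega> \<in> PiE {..n} (\<lambda>_. S)" using measurable_space[OF Y] by auto
  next
    fix x assume x: "x \<in> PiE {..n} (\<lambda>_. S)"
    have "?Z \<omega> = x \<longleftrightarrow> (\<forall>k\<le>n. Y k \<omega> = x k)" for \<omega>
    proof
      assume "?Z \<omega> = x"
      then have "?Z \<omega> k = x k" for k by simp
      then show "\<forall>k\<le>n. Y k \<omega> = x k" by (metis atMost_iff restrict_apply')
    next
      assume "\<forall>k\<le>n. Y k \<omega> = x k"
      then show "?Z \<omega> = x" using x by (intro PiE_ext[of _ "{..n}" "\<lambda>_. UNIV"]) (auto simp: PiE_iff)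
    qed
    then have "?Z -` {x} \<inter> space N = (\<Inter>k\<in>{..n}. Y k -` {x k} \<inter> space N)" by auto
    also have "\<dots> \<in> sets N"
    proof (rule sets.finite_INT)
      fix k assume "k \<in> {..n}"
      then show "Y k -` {x k} \<inter> space N \<in> sets N"
        using x by (intro measurable_sets[OF Y]) auto
    qed auto
    finally show "?Z -` {x} \<inter> space N \<in> sets N" .
  qed
  have "(\<lambda>\<omega>. P (\<lambda>k. Y k \<omega>)) = (\<lambda>\<omega>. P (?Z \<omega>))" by (intro ext adaptedD[OF P]) simp
  also have "Measurable.pred N \<dots>" by (rule measurable_compose[OF Z]) simp
  finally show "Measurable.pred N (\<lambda>\<omega>. P (\<lambda>k. Y k \<omega>))" .
qed

text \<open>The path seen from time n on, relative to its position at that time. It is meaningful as long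
  as the path stays in the cone of its position at time n; outside, letters are dropped blindly.\<close>
definition shift :: "nat \<Rightarrow> (nat \<Rightarrow> 'a list) \<Rightarrow> nat \<Rightarrow> 'a list" where
  "shift n y s = drop (length (y n)) (y (n + s))"

lemma shift_0: "shift n y 0 = []" by (simp add: shift_def)

lemma adapted_shift: "adapted m Q \<Longrightarrow> adapted (n + m) (\<lambda>y. Q (shift n y))"
  unfolding adapted_def shift_def by (smt (verit) add_le_cancel_left le_add1)

locale word_chain =
  fixes M :: "'w measure" and S :: "'a list set" and q :: "'a list \<Rightarrow> 'a list \<Rightarrow> real"
    and X :: "nat \<Rightarrow> 'w \<Rightarrow> 'a list"
  assumes chain: "markov_chain M S q [] X" and countable_S: "countable S"
begin

sublocale prob_space M
  using chain by (simp add: markov_chain_def)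

abbreviation traj :: "'w \<Rightarrow> nat \<Rightarrow> 'a list" where
  "traj \<omega> \<equiv> \<lambda>k. X k \<omega>"

lemma X_measurable[measurable]: "X n \<in> measurable M (count_space S)"
  using chain by (simp add: markov_chain_def)

lemma X_in_S: "\<omega> \<in> space M \<Longrightarrow> X n \<omega> \<in> S"
  using measurable_space[OF X_measurable] by simp

lemma X_0: "AE \<omega> in M. X 0 \<omega> = []"
  using chain by (simp add: markov_chain_def)

lemma pred_X: "adapted n P \<Longrightarrow> Measurable.pred M (\<lambda>\<omega>. P (traj \<omega>))"
  by (rule pred_adapted(1)[OF countable_S X_measurable])

lemma X_eq_measurable[measurable]: "Measurable.pred M (\<lambda>\<omega>. X n \<omega> = x)"
  using pred_X[of n "\<lambda>y. y n = x"] by (simp add: adapted_def)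

lemma X_pred_measurable[measurable]: "Measurable.pred M (\<lambda>\<omega>. A (X n \<omega>))"
  using pred_X[of n "\<lambda>y. A (y n)"] by (simp add: adapted_def)

lemma X_pred2_measurable[measurable]: "Measurable.pred M (\<lambda>\<omega>. A (X n \<omega>) (X m \<omega>))"
  using pred_X[of "max n m" "\<lambda>y. A (y n) (y m)"] by (simp add: adapted_def)

lemma path_probability:
  assumes "\<And>k. k \<le> n \<Longrightarrow> x k \<in> S"
  shows "\<P>(\<omega> in M. \<forall>k\<le>n. X k \<omega> = x k) = (if x 0 = [] then \<Prod>k<n. q (x k) (x (Suc k)) else 0)"
  using assms
proof (induction n)
  case 0
  have "\<P>(\<omega> in M. X 0 \<omega> = x 0) = \<P>(\<omega> in M. [] = x 0)"
    by (rule finite_measure_eq_AE) (use X_0 in auto)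
  then show ?case by (auto simp: prob_space)
next
  case (Suc n)
  let ?Q = "\<lambda>\<omega>. \<forall>k\<le>n. X k \<omega> = x k"
  have IH: "prob {\<omega>\<in>space M. ?Q \<omega>} = (if x 0 = [] then \<Prod>k<n. q (x k) (x (Suc k)) else 0)"
    using Suc by simp
  have eq: "{\<omega>\<in>space M. \<forall>k\<le>Suc n. X k \<omega> = x k} = {\<omega>\<in>space M. X (Suc n) \<omega> = x (Suc n) \<and> ?Q \<omega>}"
    by (auto simp: le_Suc_eq)
  show ?case
  proof (cases "prob {\<omega>\<in>space M. ?Q \<omega>} = 0")
    case True
    have "prob {\<omega>\<in>space M. \<forall>k\<le>Suc n. X k \<omega> = x k} \<le> prob {\<omega>\<in>space M. ?Q \<omega>}"
      by (rule finite_measure_mono) auto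
    then show ?thesis using True IH by (auto simp: measure_le_0_iff)
  next
    case False
    then have "0 < prob {\<omega>\<in>space M. ?Q \<omega>}" by (simp add: zero_less_measure_iff)
    then have "\<P>(\<omega> in M. X (Suc n) \<omega> = x (Suc n) \<bar> ?Q \<omega>) = q (x n) (x (Suc n))"
      using chain Suc.prems unfolding markov_chain_def by auto
    then show ?thesis
      using False IH unfolding eq cond_prob_def by (auto simp: field_simps split: if_splits)
  qed
qed

text \<open>Placing u in front of the words of \<open>\<Theta>\<close> preserves transition probabilities, also for steps that
  start at u itself.\<close>
definition translates :: "'a list \<Rightarrow> 'a list set \<Rightarrow> bool" where
  "translates u \<Theta> \<longleftrightarrow> \<Theta> \<subseteq> S \<and> (\<forall>b\<in>\<Theta>. u @ b \<in> S) \<and>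
     (\<forall>a\<in>insert [] \<Theta>. \<forall>b\<in>\<Theta>. q (u @ a) (u @ b) = q a b)"

lemma translates_mono: "translates u \<Theta> \<Longrightarrow> \<Theta>' \<subseteq> \<Theta> \<Longrightarrow> translates u \<Theta>'"
  unfolding translates_def by blast

lemma path_probability_graft:
  assumes x: "\<And>k. k \<le> n \<Longrightarrow> x k \<in> S" and z: "\<And>s. s \<in> {1..m} \<Longrightarrow> z s \<in> \<Theta>" and z0: "z 0 = []"
    and tr: "translates (x n) \<Theta>" and e: "[] \<in> S"
  shows "\<P>(\<omega> in M. (\<forall>k\<le>n. X k \<omega> = x k) \<and> (\<forall>s\<le>m. X (n + s) \<omega> = x n @ z s)) =
    \<P>(\<omega> in M. \<forall>k\<le>n. X k \<omega> = x k) * \<P>(\<omega> in M. \<forall>s\<le>m. X s \<omega> = z s)"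
proof -
  define y where "y k = (if k \<le> n then x k else x n @ z (k - n))" for k
  have yn: "y (n + s) = x n @ z s" for s using z0 by (cases s) (auto simp: y_def)
  have yk: "y k = x k" if "k \<le> n" for k using that by (simp add: y_def)
  have yS: "y k \<in> S" if "k \<le> n + m" for k
    using that x[of k] z[of "k - n"] tr unfolding y_def translates_def
    by (cases "k \<le> n") (auto simp: Suc_le_eq)
  have "(\<forall>k\<le>n. X k \<omega> = x k) \<and> (\<forall>s\<le>m. X (n + s) \<omega> = x n @ z s) \<longleftrightarrow> (\<forall>k\<le>n + m. X k \<omega> = y k)" for \<omega>
  proof safe
    fix k assume *: "\<forall>k\<le>n. X k \<omega> = x k" "\<forall>s\<le>m. X (n + s) \<omega> = x n @ z s" "k \<le> n + m"
    show "X k \<omega> = y k"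
    proof (cases "k \<le> n")
      case False
      then obtain s where "k = n + s" using le_Suc_ex nat_le_linear by blast
      then show ?thesis using * yn by auto
    qed (use * yk in auto)
  next
    fix k assume "\<forall>k\<le>n + m. X k \<omega> = y k" "k \<le> n"
    then show "X k \<omega> = x k" using yk[of k] by simp
  next
    fix s assume "\<forall>k\<le>n + m. X k \<omega> = y k" "s \<le> m"
    then show "X (n + s) \<omega> = x n @ z s" using yn by simp
  qed
  then have "\<P>(\<omega> in M. (\<forall>k\<le>n. X k \<omega> = x k) \<and> (\<forall>s\<le>m. X (n + s) \<omega> = x n @ z s)) =
      \<P>(\<omega> in M. \<forall>k\<le>n + m. X k \<omega> = y k)" by simp
  also have "\<dots> = (if y 0 = [] then \<Prod>k<n + m. q (y k) (y (Suc k)) else 0)"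
    by (rule path_probability) (rule yS)
  also have "(\<Prod>k<n + m. q (y k) (y (Suc k))) = (\<Prod>k<n. q (x k) (x (Suc k))) * (\<Prod>k<m. q (z k) (z (Suc k)))"
  proof -
    have zz: "q (y (n + k)) (y (n + Suc k)) = q (z k) (z (Suc k))" if "k < m" for k
      using tr z[of "Suc k"] z[of k] z0 that unfolding yn translates_def by (cases k) auto
    have "(\<Prod>k<n + j. q (y k) (y (Suc k))) = (\<Prod>k<n. q (x k) (x (Suc k))) * (\<Prod>k<j. q (z k) (z (Suc k)))"
      if "j \<le> m" for j
      using that
    proof (induction j)
      case 0
      show ?case by (auto intro!: prod.cong simp: yk)
    next
      case (Suc j)
      then show ?case using zz[of j] by simp
    qed
    then show ?thesis by blast
  qed
  finally show ?thesis
  proof (rule trans)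
    have zS: "z s \<in> S" if "s \<le> m" for s
      using z[of s] z0 e tr that unfolding translates_def by (cases s) auto
    show "(if y 0 = [] then (\<Prod>k<n. q (x k) (x (Suc k))) * (\<Prod>k<m. q (z k) (z (Suc k))) else 0) =
      \<P>(\<omega> in M. \<forall>k\<le>n. X k \<omega> = x k) * \<P>(\<omega> in M. \<forall>s\<le>m. X s \<omega> = z s)"
      using path_probability[of n x, OF x] path_probability[of m z, OF zS] z0 yk[of 0] by simp
  qed
qed

lemma Nil_in_S: "[] \<in> S"
proof -
  have "\<exists>\<omega>\<in>space M. X 0 \<omega> = []"
  proof (rule ccontr)
    assume "\<not> ?thesis"
    with X_0 have "AE \<omega> in M. False" by (auto elim!: eventually_elim2[OF AE_space])
    then show False by simp
  qed
  then show ?thesis using X_in_S by metis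
qed

text \<open>The Markov property at time n, with the future described relative to the position at time n
  and restricted to the words that the position may be put in front of. The set \<open>\<Theta>\<close> varies in the
  applications: the whole space at the root, a cone with or without its apex, or one further
  letter.\<close>
lemma markov_property_translated:
  assumes P: "adapted n P" and Q: "adapted m Q"
    and tr: "\<And>x. P x \<Longrightarrow> (\<And>k. k \<le> n \<Longrightarrow> x k \<in> S) \<Longrightarrow> translates (x n) \<Theta>"
  shows "\<P>(\<omega> in M. P (traj \<omega>) \<and> (\<forall>s\<in>{1..m}. \<exists>b\<in>\<Theta>. X (n + s) \<omega> = X n \<omega> @ b) \<and> Q (shift n (traj \<omega>))) =
    \<P>(\<omega> in M. P (traj \<omega>)) * \<P>(\<omega> in M. (\<forall>s\<in>{1..m}. X s \<omega> \<in> \<Theta>) \<and> Q (traj \<omega>))"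
proof -
  let ?I = "PiE {..n} (\<lambda>_. S)" and ?J = "PiE {..m} (\<lambda>_. S)"
  let ?L = "\<lambda>\<omega>. P (traj \<omega>) \<and> (\<forall>s\<in>{1..m}. \<exists>b\<in>\<Theta>. X (n + s) \<omega> = X n \<omega> @ b) \<and> Q (shift n (traj \<omega>))"
  let ?R = "\<lambda>\<omega>. (\<forall>s\<in>{1..m}. X s \<omega> \<in> \<Theta>) \<and> Q (traj \<omega>) \<and> X 0 \<omega> = []"
  let ?R' = "\<lambda>\<omega>. (\<forall>s\<in>{1..m}. X s \<omega> \<in> \<Theta>) \<and> Q (traj \<omega>)"
  note [measurable] = pred_X[OF P] pred_X[OF Q]
  have "adapted (n + m) (\<lambda>y. P y \<and> (\<forall>s\<in>{1..m}. \<exists>b\<in>\<Theta>. y (n + s) = y n @ b) \<and> Q (shift n y))"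
    by (intro adapted_conj adapted_mono[OF P] adapted_shift[OF Q]) (auto simp: adapted_def)
  from pred_X[OF this] have mL[measurable]: "Measurable.pred M ?L" .
  have [measurable]: "Measurable.pred M ?R" "Measurable.pred M ?R'" by measurable
  define Zx where "Zx \<omega> = (\<lambda>k\<in>{..n}. X k \<omega>)" for \<omega>
  define Zz where "Zz \<omega> = (\<lambda>k\<in>{..m}. X k \<omega>)" for \<omega>
  define Zs where "Zs \<omega> = (\<lambda>s\<in>{..m}. shift n (traj \<omega>) s)" for \<omega>
  have CI: "countable ?I" "countable ?J" by (intro countable_PiE; use countable_S in auto)+
  have mZx[measurable]: "Zx \<in> measurable M (count_space ?I)" "Zz \<in> measurable M (count_space ?J)"
    unfolding Zx_def Zz_def
    using pred_adapted(2)[OF countable_S X_measurable adapted_const[where c=True]] by auto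
  (* The relative future need not consist of words of S; it lives in the countable set of all
     final segments of words of S. *)
  let ?J' = "PiE {..m} (\<lambda>_. UNIV \<inter> (\<lambda>(k, w). drop k w) ` (UNIV \<times> S))"
  have CJ': "countable ?J'" by (intro countable_PiE) (auto intro!: countable_Int2 countable_image countable_SIGMA simp: countable_S)
  have mZs: "Zs \<in> measurable M (count_space ?J')"
    unfolding measurable_count_space_eq_countable[OF CJ']
  proof (intro conjI ballI funcsetI)
    fix \<omega> assume "\<omega> \<in> space M"
    then show "Zs \<omega> \<in> ?J'" using X_in_S unfolding Zs_def shift_def
      by (auto simp: PiE_def intro!: image_eqI[where x="(_, _)"])
  next
    fix z assume z: "z \<in> ?J'"
    have "adapted (n + m) (\<lambda>y. (\<lambda>s\<in>{..m}. shift n y s) = z)"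
      by (auto simp: adapted_def shift_def restrict_def fun_eq_iff)
    from pred_X[OF this] show "Zs -` {z} \<inter> space M \<in> sets M"
      unfolding Zs_def by (simp add: vimage_def Int_def conj_commute pred_def)
  qed
  have mZz': "Zz \<in> measurable M (count_space ?J')"
  proof -
    have "?J \<subseteq> ?J'" by (intro PiE_mono) (auto intro!: image_eqI[where x="(0, _)"])
    moreover have *: "Zz \<in> space M \<rightarrow> ?J \<and> (\<forall>z\<in>?J. Zz -` {z} \<inter> space M \<in> sets M)"
      using mZx(2) unfolding measurable_count_space_eq_countable[OF CI(2)] .
    moreover have "Zz -` {z} \<inter> space M \<in> sets M" for z
    proof (cases "z \<in> ?J")
      case False
      then have "Zz -` {z} \<inter> space M = {}" using funcset_mem[OF conjunct1[OF *]] by blast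
      then show ?thesis by simp
    next
      case True
      then show ?thesis by (rule conjunct2[OF *, rule_format])
    qed
    ultimately show ?thesis
      unfolding measurable_count_space_eq_countable[OF CJ'] by (meson Pi_mono subset_iff)
  qed
  have step: "\<P>(\<omega> in M. ?L \<omega> \<and> Zx \<omega> = x) = \<P>(\<omega> in M. ?R \<omega>) * \<P>(\<omega> in M. P (traj \<omega>) \<and> Zx \<omega> = x)"
    if x: "x \<in> ?I" for x
  proof -
    have [measurable]: "Measurable.pred M (\<lambda>\<omega>. Zx \<omega> = x)" using x by measurable
    then have mLx: "Measurable.pred M (\<lambda>\<omega>. ?L \<omega> \<and> Zx \<omega> = x)" by (rule pred_intros_logic(3)[OF mL])
    have zx: "Zx \<omega> = x \<longleftrightarrow> (\<forall>k\<le>n. X k \<omega> = x k)" for \<omega>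
      using x by (auto simp: Zx_def fun_eq_iff restrict_def PiE_def extensional_def)
    have Px: "Zx \<omega> = x \<Longrightarrow> P (traj \<omega>) = P x" for \<omega>
      unfolding zx by (intro adaptedD[OF P]) auto
    have "\<P>(\<omega> in M. ?L \<omega> \<and> Zx \<omega> = x) = \<P>(\<omega> in M. P (traj \<omega>) \<and> Zx \<omega> = x) * \<P>(\<omega> in M. ?R \<omega>)"
    proof (rule prob_proportional_by_values[OF CJ' mLx _ mZs mZz'])
      fix z assume z: "z \<in> ?J'"
      have zz: "Zz \<omega> = z \<longleftrightarrow> (\<forall>k\<le>m. X k \<omega> = z k)" for \<omega>
        using z by (auto simp: Zz_def fun_eq_iff restrict_def PiE_def extensional_def)
      have zs: "Zs \<omega> = z \<longleftrightarrow> (\<forall>k\<le>m. shift n (traj \<omega>) k = z k)" for \<omega>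
        using z by (auto simp: Zs_def fun_eq_iff restrict_def PiE_def extensional_def)
      have Qz: "Zz \<omega> = z \<Longrightarrow> Q (traj \<omega>) = Q z" for \<omega>
        unfolding zz by (intro adaptedD[OF Q]) auto
      have Qs: "Zs \<omega> = z \<Longrightarrow> Q (shift n (traj \<omega>)) = Q z" for \<omega>
        unfolding zs by (intro adaptedD[OF Q]) auto
      show "\<P>(\<omega> in M. (?L \<omega> \<and> Zx \<omega> = x) \<and> Zs \<omega> = z) =
         \<P>(\<omega> in M. P (traj \<omega>) \<and> Zx \<omega> = x) * \<P>(\<omega> in M. ?R \<omega> \<and> Zz \<omega> = z)"
      proof (cases "P x \<and> Q z \<and> z 0 = [] \<and> (\<forall>s\<in>{1..m}. z s \<in> \<Theta>)")
        case True
        have L: "((?L \<omega> \<and> Zx \<omega> = x) \<and> Zs \<omega> = z) \<longleftrightarrow>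
            (\<forall>k\<le>n. X k \<omega> = x k) \<and> (\<forall>s\<le>m. X (n + s) \<omega> = x n @ z s)" for \<omega>
        proof
          assume A: "(?L \<omega> \<and> Zx \<omega> = x) \<and> Zs \<omega> = z"
          then have xk: "\<forall>k\<le>n. X k \<omega> = x k" by (simp add: zx)
          have "X (n + s) \<omega> = x n @ z s" if "s \<le> m" for s
          proof (cases "s = 0")
            case False
            then have "s \<in> {1..m}" using that by auto
            then obtain b where "X (n + s) \<omega> = X n \<omega> @ b" using A by blast
            moreover have "shift n (traj \<omega>) s = z s" using A that by (simp add: zs)
            ultimately show ?thesis using xk by (simp add: shift_def)
          qed (use xk True in simp)
          with xk show "(\<forall>k\<le>n. X k \<omega> = x k) \<and> (\<forall>s\<le>m. X (n + s) \<omega> = x n @ z s)" by blast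
        next
          assume A: "(\<forall>k\<le>n. X k \<omega> = x k) \<and> (\<forall>s\<le>m. X (n + s) \<omega> = x n @ z s)"
          then have 1: "Zx \<omega> = x" by (simp add: zx)
          have 2: "Zs \<omega> = z" using A unfolding zs by (simp add: shift_def)
          show "(?L \<omega> \<and> Zx \<omega> = x) \<and> Zs \<omega> = z"
            using 1 2 Px[OF 1] Qs[OF 2] A True by auto
        qed
        have R: "(?R \<omega> \<and> Zz \<omega> = z) \<longleftrightarrow> (\<forall>s\<le>m. X s \<omega> = z s)" for \<omega>
          using Qz[of \<omega>] True unfolding zz by auto
        have PX: "(P (traj \<omega>) \<and> Zx \<omega> = x) \<longleftrightarrow> (\<forall>k\<le>n. X k \<omega> = x k)" for \<omega>
          using Px[of \<omega>] True unfolding zx by auto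
        show ?thesis unfolding L R PX
          by (rule path_probability_graft[where \<Theta>=\<Theta>])
             (use True x tr Nil_in_S in \<open>auto simp: PiE_iff\<close>)
      next
        case False
        have L: "((?L \<omega> \<and> Zx \<omega> = x) \<and> Zs \<omega> = z) \<longleftrightarrow> False" for \<omega>
        proof
          assume A: "(?L \<omega> \<and> Zx \<omega> = x) \<and> Zs \<omega> = z"
          have "P x" "Q z" using A Px[of \<omega>] Qs[of \<omega>] by blast+
          moreover have "z 0 = []" using A unfolding zs by (auto simp: shift_0 dest: spec[of _ 0])
          moreover have "z s \<in> \<Theta>" if s: "s \<in> {1..m}" for s
          proof -
            obtain b where "b \<in> \<Theta>" "X (n + s) \<omega> = X n \<omega> @ b" using A s by blast
            moreover have "shift n (traj \<omega>) s = z s" using A s by (simp add: zs)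
            ultimately show ?thesis by (simp add: shift_def)
          qed
          ultimately show False using False by blast
        qed blast
        have R: "((P (traj \<omega>) \<and> Zx \<omega> = x) \<and> (?R \<omega>' \<and> Zz \<omega>' = z)) \<longleftrightarrow> False" for \<omega> \<omega>'
        proof
          assume A: "(P (traj \<omega>) \<and> Zx \<omega> = x) \<and> (?R \<omega>' \<and> Zz \<omega>' = z)"
          then have zk: "X k \<omega>' = z k" if "k \<le> m" for k using that zz[of \<omega>'] by blast
          have "P x" "Q z" using A Px[of \<omega>] Qz[of \<omega>'] by blast+
          moreover have "z 0 = []" using A zk[of 0] by simp
          moreover have "\<forall>s\<in>{1..m}. z s \<in> \<Theta>" using A zk by (metis atLeastAtMost_iff)
          ultimately show False using False by blast
        qed blast
        have "(\<forall>\<omega>. (P (traj \<omega>) \<and> Zx \<omega> = x) = False) \<or> (\<forall>\<omega>. (?R \<omega> \<and> Zz \<omega> = z) = False)"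
          using R by blast
        then have "\<P>(\<omega> in M. P (traj \<omega>) \<and> Zx \<omega> = x) * \<P>(\<omega> in M. ?R \<omega> \<and> Zz \<omega> = z) = 0"
        proof
          assume z: "\<forall>\<omega>. (P (traj \<omega>) \<and> Zx \<omega> = x) = False"
          show ?thesis unfolding z[rule_format] by simp
        next
          assume z: "\<forall>\<omega>. (?R \<omega> \<and> Zz \<omega> = z) = False"
          show ?thesis unfolding z[rule_format] by simp
        qed
        then show ?thesis unfolding L by simp
      qed
    qed auto
    then show ?thesis by (simp add: mult.commute)
  qed
  have "\<P>(\<omega> in M. ?L \<omega>) = \<P>(\<omega> in M. ?R \<omega>) * \<P>(\<omega> in M. P (traj \<omega>))"
    by (rule prob_proportional_by_values[OF CI(1) mL pred_X[OF P] mZx(1) mZx(1)]) (auto simp only: step measure_nonneg)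
  also have "\<P>(\<omega> in M. ?R \<omega>) = \<P>(\<omega> in M. ?R' \<omega>)"
    by (rule finite_measure_eq_AE) (use X_0 in auto)
  finally show ?thesis by (simp add: mult.commute)
qed

text \<open>Letting the time horizon tend to infinity.\<close>

lemma prob_forall_from_1:
  assumes [measurable]: "\<And>s. Measurable.pred M (A s)" "Measurable.pred M B"
  shows "(\<lambda>m. \<P>(\<omega> in M. B \<omega> \<and> (\<forall>s\<in>{1..m}. A s \<omega>))) \<longlonglongrightarrow> \<P>(\<omega> in M. B \<omega> \<and> (\<forall>s\<ge>1::nat. A s \<omega>))"
proof -
  have "(\<lambda>m. \<P>(\<omega> in M. B \<omega> \<and> (\<forall>s\<in>{1..m}. A s \<omega>))) \<longlonglongrightarrow>
     prob (\<Inter>m. {\<omega>\<in>space M. B \<omega> \<and> (\<forall>s\<in>{1..m}. A s \<omega>)})"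
    by (rule finite_Lim_measure_decseq) (auto simp: decseq_def)
  moreover have "(\<forall>m. \<forall>s\<in>{1..m}. A s \<omega>) \<longleftrightarrow> (\<forall>s\<ge>1. A s \<omega>)" for \<omega>
    by (metis atLeastAtMost_iff order_refl)
  then have "(\<Inter>m. {\<omega>\<in>space M. B \<omega> \<and> (\<forall>s\<in>{1..m}. A s \<omega>)}) = {\<omega>\<in>space M. B \<omega> \<and> (\<forall>s\<ge>1. A s \<omega>)}"
    by auto
  ultimately show ?thesis by simp
qed

lemma markov_property_forever:
  assumes P: "adapted n P"
    and tr: "\<And>x. P x \<Longrightarrow> (\<And>k. k \<le> n \<Longrightarrow> x k \<in> S) \<Longrightarrow> translates (x n) \<Theta>"
  shows "\<P>(\<omega> in M. P (traj \<omega>) \<and> (\<forall>s\<ge>1. \<exists>b\<in>\<Theta>. X (n + s) \<omega> = X n \<omega> @ b)) =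
    \<P>(\<omega> in M. P (traj \<omega>)) * \<P>(\<omega> in M. \<forall>s\<ge>1. X s \<omega> \<in> \<Theta>)"
proof (rule LIMSEQ_unique)
  note [measurable] = pred_X[OF P]
  let ?f = "\<lambda>m. \<P>(\<omega> in M. P (traj \<omega>) \<and> (\<forall>s\<in>{1..m}. \<exists>b\<in>\<Theta>. X (n + s) \<omega> = X n \<omega> @ b))"
  show "?f \<longlonglongrightarrow> \<P>(\<omega> in M. P (traj \<omega>) \<and> (\<forall>s\<ge>1. \<exists>b\<in>\<Theta>. X (n + s) \<omega> = X n \<omega> @ b))"
    by (rule prob_forall_from_1) measurable
  have "?f m = \<P>(\<omega> in M. P (traj \<omega>)) * \<P>(\<omega> in M. \<forall>s\<in>{1..m}. X s \<omega> \<in> \<Theta>)" for m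
  proof -
    have "\<P>(\<omega> in M. P (traj \<omega>) \<and> (\<forall>s\<in>{1..m}. \<exists>b\<in>\<Theta>. X (n + s) \<omega> = X n \<omega> @ b) \<and> True) =
      \<P>(\<omega> in M. P (traj \<omega>)) * \<P>(\<omega> in M. (\<forall>s\<in>{1..m}. X s \<omega> \<in> \<Theta>) \<and> True)"
      by (rule markov_property_translated[where Q = "\<lambda>_. True"]) (use P tr adapted_const in auto)
    then show ?thesis by simp
  qed
  moreover have "(\<lambda>m. \<P>(\<omega> in M. \<forall>s\<in>{1..m}. X s \<omega> \<in> \<Theta>)) \<longlonglongrightarrow> \<P>(\<omega> in M. \<forall>s\<ge>1. X s \<omega> \<in> \<Theta>)"
    using prob_forall_from_1[of "\<lambda>s \<omega>. X s \<omega> \<in> \<Theta>" "\<lambda>_. True"] by simp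
  ultimately show "?f \<longlonglongrightarrow> \<P>(\<omega> in M. P (traj \<omega>)) * \<P>(\<omega> in M. \<forall>s\<ge>1. X s \<omega> \<in> \<Theta>)"
    by (simp add: tendsto_mult)
qed

end

section \<open>Regeneration times of a path\<close>

lemma visits_eq_filter: "visits u xs = length (filter (\<lambda>x. x = u) xs)"
  unfolding visits_def length_filter_conv_card by (rule refl)

lemma visits_append: "visits u (xs @ ys) = visits u xs + visits u ys"
  by (simp add: visits_eq_filter)

lemma visits_eq_0_iff: "visits u xs = 0 \<longleftrightarrow> u \<notin> set xs"
  by (auto simp: visits_eq_filter filter_empty_conv)

lemma multi_range_le_length: "multi_range r xs \<le> length xs"
  unfolding multi_range_def
  by (rule order_trans[OF card_mono card_length]) auto

lemma multi_range_append_disjoint: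
  assumes "set xs \<inter> set ys = {}"
  shows "multi_range r (xs @ ys) = multi_range r xs + multi_range r ys"
proof -
  have "{u \<in> set (xs @ ys). visits u (xs @ ys) = r} =
      {u \<in> set xs. visits u xs = r} \<union> {u \<in> set ys. visits u ys = r}"
  proof -
    have "visits u xs = 0 \<or> visits u ys = 0" for u using assms by (auto simp: visits_eq_0_iff)
    moreover have "u \<in> set zs \<longleftrightarrow> visits u zs \<noteq> 0" for u and zs :: "'a list" by (simp add: visits_eq_0_iff)
    ultimately show ?thesis using assms
      by (auto simp: visits_append disjoint_iff)
  qed
  then show ?thesis
    unfolding multi_range_def using assms by (simp only:) (rule card_Un_disjoint; auto)
qed

lemma visits_map_inj: "inj_on f (insert u (set xs)) \<Longrightarrow> visits (f u) (map f xs) = visits u xs"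
  unfolding visits_eq_filter filter_map comp_def length_map
  by (rule arg_cong[where f=length], rule filter_cong) (auto simp: inj_on_def)

lemma multi_range_map_inj:
  assumes f: "inj_on f (set xs)"
  shows "multi_range r (map f xs) = multi_range r xs"
proof -
  have v: "visits (f u) (map f xs) = visits u xs" if "u \<in> set xs" for u
    by (rule visits_map_inj) (use that f in \<open>simp add: insert_absorb\<close>)
  then have "{u \<in> set (map f xs). visits u (map f xs) = r} = f ` {u \<in> set xs. visits u xs = r}"
    by auto
  then show ?thesis
    unfolding multi_range_def using inj_on_subset[OF f] by (simp add: card_image)
qed

text \<open>The renewal reward theorem along one path. Here e lists the renewal times and g the rewards; between two renewal times the reward is only
  known up to the length of the gap, which is negligible because the gaps have a mean.\<close>
lemma renewal_reward_limit:
  fixes e g R :: "nat \<Rightarrow> nat" and \<tau> \<rho> :: real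
  assumes mono: "strict_mono e" and e0: "e 0 = 0"
    and bounds: "\<And>k n. e k \<le> n \<Longrightarrow> n < e (Suc k) \<Longrightarrow>
       (\<Sum>i<k. g i) \<le> R n \<and> R n \<le> (\<Sum>i<k. g i) + (e (Suc k) - e k)"
    and e_lim: "(\<lambda>k. real (e k) / real k) \<longlonglongrightarrow> \<tau>" and \<tau>: "0 < \<tau>"
    and g_lim: "(\<lambda>k. real (\<Sum>i<k. g i) / real k) \<longlonglongrightarrow> \<rho>"
  shows "(\<lambda>n. real (R n) / real n) \<longlonglongrightarrow> \<rho> / \<tau>"
proof -
  have ek: "k \<le> e k" for k by (rule strict_mono_imp_increasing[OF mono])
  have "\<exists>k. e k \<le> n \<and> n < e (Suc k)" for n
  proof (induction n)
    case 0
    then show ?case using e0 ek[of 1] by (intro exI[of _ 0]) auto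
  next
    case (Suc n)
    then obtain k where k: "e k \<le> n" "n < e (Suc k)" by blast
    show ?case
    proof (cases "Suc n < e (Suc k)")
      case False
      then have "e (Suc k) = Suc n" using k by simp
      then show ?thesis using strict_monoD[OF mono, of "Suc k" "Suc (Suc k)"]
        by (intro exI[of _ "Suc k"]) auto
    qed (use k in \<open>intro exI[of _ k]; auto\<close>)
  qed
  then obtain \<kappa> where \<kappa>: "\<And>n. e (\<kappa> n) \<le> n" "\<And>n. n < e (Suc (\<kappa> n))" by metis
  have \<kappa>_lim: "filterlim \<kappa> at_top sequentially"
    unfolding filterlim_at_top
  proof
    fix K
    have "K \<le> \<kappa> n" if "e K \<le> n" for n
      using strict_mono_less[OF mono, of K "Suc (\<kappa> n)"] that \<kappa>(2)[of n] by simp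
    then show "eventually (\<lambda>n. K \<le> \<kappa> n) sequentially"
      by (auto simp: eventually_sequentially)
  qed
  define G where "G k = real (\<Sum>i<k. g i)" for k
  have e_Suc: "(\<lambda>k. real (e (Suc k)) / real k) \<longlonglongrightarrow> \<tau>"
  proof (rule Lim_transform_eventually)
    have "(\<lambda>k. real (Suc k) / real k) \<longlonglongrightarrow> 1" by real_asymp
    then show "(\<lambda>k. (real (e (Suc k)) / real (Suc k)) * (real (Suc k) / real k)) \<longlonglongrightarrow> \<tau>"
      using tendsto_mult[OF LIMSEQ_Suc[OF e_lim]] by fastforce
    show "\<forall>\<^sub>F k in sequentially. real (e (Suc k)) / real (Suc k) * (real (Suc k) / real k) = real (e (Suc k)) / real k"
      by (simp add: divide_simps del: of_nat_Suc)
  qed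
  have lo: "(\<lambda>k. G k / real (e (Suc k))) \<longlonglongrightarrow> \<rho> / \<tau>"
  proof (rule Lim_transform_eventually)
    show "(\<lambda>k. (G k / real k) / (real (e (Suc k)) / real k)) \<longlonglongrightarrow> \<rho> / \<tau>"
      using g_lim e_Suc \<tau> unfolding G_def by (intro tendsto_divide) auto
    show "\<forall>\<^sub>F k in sequentially. (G k / real k) / (real (e (Suc k)) / real k) = G k / real (e (Suc k))"
      using eventually_gt_at_top[of 0] by eventually_elim simp
  qed
  have hi: "(\<lambda>k. (G k + (real (e (Suc k)) - real (e k))) / real (e k)) \<longlonglongrightarrow> \<rho> / \<tau>"
  proof (rule Lim_transform_eventually)
    have "(\<lambda>k. (G k / real k + (real (e (Suc k)) / real k - real (e k) / real k)) / (real (e k) / real k))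
        \<longlonglongrightarrow> (\<rho> + (\<tau> - \<tau>)) / \<tau>"
      using g_lim e_Suc e_lim \<tau> unfolding G_def by (intro tendsto_divide tendsto_add tendsto_diff) auto
    then show "(\<lambda>k. (G k / real k + (real (e (Suc k)) / real k - real (e k) / real k)) / (real (e k) / real k))
        \<longlonglongrightarrow> \<rho> / \<tau>" by simp
    show "\<forall>\<^sub>F k in sequentially. (G k / real k + (real (e (Suc k)) / real k - real (e k) / real k)) / (real (e k) / real k)
        = (G k + (real (e (Suc k)) - real (e k))) / real (e k)"
      using eventually_gt_at_top[of 0]
      by eventually_elim (simp add: add_divide_distrib[symmetric] diff_divide_distrib[symmetric])
  qed
  show ?thesis
  proof (rule tendsto_sandwich)
    show "(\<lambda>n. G (\<kappa> n) / real (e (Suc (\<kappa> n)))) \<longlonglongrightarrow> \<rho> / \<tau>"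
      by (rule filterlim_compose[OF lo \<kappa>_lim])
    show "(\<lambda>n. (G (\<kappa> n) + (real (e (Suc (\<kappa> n))) - real (e (\<kappa> n)))) / real (e (\<kappa> n))) \<longlonglongrightarrow> \<rho> / \<tau>"
      by (rule filterlim_compose[OF hi \<kappa>_lim])
    have R: "G (\<kappa> n) \<le> real (R n) \<and> real (R n) \<le> G (\<kappa> n) + (real (e (Suc (\<kappa> n))) - real (e (\<kappa> n)))" for n
    proof -
      have "e (\<kappa> n) \<le> e (Suc (\<kappa> n))" using \<kappa>[of n] by simp
      then show ?thesis using bounds[OF \<kappa>] unfolding G_def
        by (metis of_nat_add of_nat_diff of_nat_le_iff)
    qed
    have G0: "0 \<le> G k" for k unfolding G_def by (rule of_nat_0_le_iff)
    show "\<forall>\<^sub>F n in sequentially. G (\<kappa> n) / real (e (Suc (\<kappa> n))) \<le> real (R n) / real n"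
      using eventually_gt_at_top[of 0]
    proof eventually_elim
      case (elim n)
      then show ?case using R[of n] \<kappa>(2)[of n] G0[of "\<kappa> n"] by (intro frac_le) auto
    qed
    have "\<forall>\<^sub>F n in sequentially. 1 \<le> \<kappa> n" using \<kappa>_lim by (simp add: filterlim_at_top)
    then show "\<forall>\<^sub>F n in sequentially. real (R n) / real n
        \<le> (G (\<kappa> n) + (real (e (Suc (\<kappa> n))) - real (e (\<kappa> n)))) / real (e (\<kappa> n))"
    proof eventually_elim
      case (elim n)
      then have "0 < e (\<kappa> n)" using ek[of "\<kappa> n"] by simp
      then show ?case using R[of n] \<kappa>(1)[of n] by (intro frac_le) auto
    qed
  qed
qed

text \<open>The word at time k is of the distinguished kind T and its cone is entered at time k for the
  first time. Time 0 always counts, although the empty word is not of kind T: in the intended use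
  the path is already relative to a word of kind T.\<close>
definition fresh :: "('a list \<Rightarrow> bool) \<Rightarrow> (nat \<Rightarrow> 'a list) \<Rightarrow> nat \<Rightarrow> bool" where
  "fresh T y k \<longleftrightarrow> k = 0 \<or> (T (y k) \<and> (\<forall>j<k. \<not> prefix (y k) (y j)))"

definition regen :: "('a list \<Rightarrow> bool) \<Rightarrow> (nat \<Rightarrow> 'a list) \<Rightarrow> nat \<Rightarrow> bool" where
  "regen T y k \<longleftrightarrow> fresh T y k \<and> (\<forall>s\<ge>k. prefix (y k) (y s))"

definition first_regen :: "('a list \<Rightarrow> bool) \<Rightarrow> (nat \<Rightarrow> 'a list) \<Rightarrow> nat \<Rightarrow> bool" where
  "first_regen T y a \<longleftrightarrow> 0 < a \<and> regen T y a \<and> (\<forall>j\<in>{0<..<a}. \<not> regen T y j)"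

text \<open>This is the part of \<open>first_regen\<close> that can be read off from the path up to time a: given that
  a is a regeneration time, an earlier time is one if and only if its cone is not left before time
  a.\<close>
definition indecomposable :: "('a list \<Rightarrow> bool) \<Rightarrow> (nat \<Rightarrow> 'a list) \<Rightarrow> nat \<Rightarrow> bool" where
  "indecomposable T y a \<longleftrightarrow> 0 < a \<and> (\<forall>j\<in>{0<..<a}. \<not> (fresh T y j \<and> (\<forall>s\<in>{j..a}. prefix (y j) (y s))))"

lemma adapted_fresh: "k \<le> n \<Longrightarrow> adapted n (\<lambda>y. fresh T y k)"
proof (unfold adapted_def fresh_def, safe)
qed (auto)

lemma adapted_prefix: "j \<le> n \<Longrightarrow> k \<le> n \<Longrightarrow> adapted n (\<lambda>y. prefix (y j) (y k))"
  by (auto simp: adapted_def)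

lemma adapted_all: "(\<And>i. i \<in> I \<Longrightarrow> adapted n (P i)) \<Longrightarrow> adapted n (\<lambda>y. \<forall>i\<in>I. P i y)"
  unfolding adapted_def by metis

lemma adapted_not: "adapted n P \<Longrightarrow> adapted n (\<lambda>y. \<not> P y)"
  unfolding adapted_def by metis

lemma adapted_indecomposable: "adapted a (\<lambda>y. indecomposable T y a)"
  unfolding indecomposable_def
  by (intro adapted_conj adapted_const adapted_all adapted_not adapted_fresh adapted_prefix) auto

lemma adapted_map: "adapted n (\<lambda>y. F (map y [i..<j]))" if "j \<le> Suc n"
  unfolding adapted_def
proof (intro allI impI)
  fix x y :: "nat \<Rightarrow> 'a" assume "\<forall>k\<le>n. x k = y k"
  then have "map x [i..<j] = map y [i..<j]" using that by (intro map_cong) auto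
  then show "F (map x [i..<j]) = F (map y [i..<j])" by (simp only:)
qed

lemma regen_Nil_0: "y 0 = [] \<Longrightarrow> regen T y 0"
  by (simp add: regen_def fresh_def)

lemma first_regen_iff: "first_regen T y a \<longleftrightarrow> indecomposable T y a \<and> regen T y a"
proof -
  have "regen T y j \<longleftrightarrow> fresh T y j \<and> (\<forall>s\<in>{j..a}. prefix (y j) (y s))"
    if a: "regen T y a" and j: "j \<le> a" for j
  proof
    assume r: "fresh T y j \<and> (\<forall>s\<in>{j..a}. prefix (y j) (y s))"
    have "prefix (y j) (y s)" if "s \<ge> j" for s
    proof (cases "s \<le> a")
      case False
      then have "prefix (y a) (y s)" using a by (simp add: regen_def)
      moreover have "prefix (y j) (y a)" using r j by auto
      ultimately show ?thesis by (rule prefix_order.trans[rotated])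
    qed (use r that in auto)
    then show "regen T y j" using r by (simp add: regen_def)
  qed (auto simp: regen_def)
  then show ?thesis unfolding first_regen_def indecomposable_def by auto
qed

lemma regen_append_shift: "regen T y k \<Longrightarrow> y (k + s) = y k @ shift k y s"
  by (auto simp: regen_def shift_def prefix_def dest!: spec[of _ "k + s"])

text \<open>Kinds like that of the words whose last letter lies in the first factor.\<close>
locale typed_words =
  fixes T :: "'a list \<Rightarrow> bool"
  assumes T_append: "v \<noteq> [] \<Longrightarrow> T (u @ v) = T v" and T_Nil: "\<not> T []"
begin

lemma fresh_shift:
  assumes y0: "y 0 = []" and f: "fresh T y k" and st: "\<And>s. s \<le> j \<Longrightarrow> prefix (y k) (y (k + s))"
  shows "fresh T (shift k y) j \<longleftrightarrow> fresh T y (k + j)"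
proof (cases "j = 0")
  case False
  have ap: "y (k + s) = y k @ shift k y s" if "s \<le> j" for s
    using st[OF that] by (auto simp: shift_def prefix_def)
  show ?thesis
  proof
    assume "fresh T (shift k y) j"
    then have T: "T (shift k y j)" and n: "\<And>i. i < j \<Longrightarrow> \<not> prefix (shift k y j) (shift k y i)"
      using False by (auto simp: fresh_def)
    have ne: "shift k y j \<noteq> []" using T T_Nil by auto
    have "T (y (k + j))" using T T_append[OF ne] ap[of j] by simp
    moreover have "\<not> prefix (y (k + j)) (y i)" if i: "i < k + j" for i
    proof (cases "i < k")
      case True
      show ?thesis
      proof
        assume "prefix (y (k + j)) (y i)"
        with st[of j] have "prefix (y k) (y i)" by (meson order_refl prefix_order.trans)
        then show False using f True by (auto simp: fresh_def)
      qed
    next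
      case False
      then obtain l where l: "i = k + l" using le_Suc_ex not_less by blast
      then have "l < j" using i by simp
      then show ?thesis using n[of l] ap[of j] ap[of l] l by simp
    qed
    ultimately show "fresh T y (k + j)" by (simp add: fresh_def)
  next
    assume "fresh T y (k + j)"
    then have T: "T (y (k + j))" and n: "\<And>i. i < k + j \<Longrightarrow> \<not> prefix (y (k + j)) (y i)"
      using False by (auto simp: fresh_def)
    have ne: "shift k y j \<noteq> []"
      using n[of k] False ap[of j] by auto
    have "T (shift k y j)" using T T_append[OF ne] ap[of j] by simp
    moreover have "\<not> prefix (shift k y j) (shift k y i)" if "i < j" for i
      using n[of "k + i"] that ap[of i] ap[of j] by simp
    ultimately show "fresh T (shift k y) j" by (simp add: fresh_def)
  qed
qed (use f in \<open>simp add: fresh_def\<close>)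

text \<open>The regeneration times after k are those of the path relative to its position at time k. This
  is why the pieces between them form a renewal structure.\<close>
lemma regen_shift:
  assumes y0: "y 0 = []" and r: "regen T y k"
  shows "regen T (shift k y) j \<longleftrightarrow> regen T y (k + j)"
proof -
  have f: "fresh T (shift k y) j \<longleftrightarrow> fresh T y (k + j)"
    by (rule fresh_shift[where y=y, OF y0]) (use r in \<open>auto simp: regen_def\<close>)
  have "(\<forall>s\<ge>j. prefix (shift k y j) (shift k y s)) \<longleftrightarrow> (\<forall>s\<ge>k + j. prefix (y (k + j)) (y s))"
  proof
    assume *: "\<forall>s\<ge>j. prefix (shift k y j) (shift k y s)"
    show "\<forall>s\<ge>k + j. prefix (y (k + j)) (y s)"
    proof safe
      fix s assume "s \<ge> k + j"
      then obtain l where l: "s = k + l" "j \<le> l" by (metis add_le_cancel_left le_Suc_ex add_leD1)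
      then show "prefix (y (k + j)) (y s)"
        using * regen_append_shift[OF r] by simp
    qed
  next
    assume *: "\<forall>s\<ge>k + j. prefix (y (k + j)) (y s)"
    show "\<forall>s\<ge>j. prefix (shift k y j) (shift k y s)"
    proof safe
      fix s assume "s \<ge> j"
      then have "prefix (y (k + j)) (y (k + s))" using * by simp
      then show "prefix (shift k y j) (shift k y s)"
        using regen_append_shift[OF r] by simp
    qed
  qed
  with f show ?thesis by (simp add: regen_def)
qed

end

lemma first_regen_unique: "first_regen T y a \<Longrightarrow> first_regen T y b \<Longrightarrow> a = b"
  unfolding first_regen_def by (cases a b rule: linorder_cases) auto

lemma map_upt_shift:
  assumes "regen T y k"
  shows "map y [k..<k + a] = map ((@) (y k)) (map (shift k y) [0..<a])"
  by (rule nth_equalityI) (auto simp: regen_append_shift[OF assms])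

definition regen_times :: "('a list \<Rightarrow> bool) \<Rightarrow> (nat \<Rightarrow> 'a list) \<Rightarrow> nat \<Rightarrow> nat" where
  "regen_times T y = enumerate {k. regen T y k}"

text \<open>A piece is recorded by its length and its number of vertices of multiplicity r. Counting
  vertices piece by piece is correct because the pieces visit disjoint sets of vertices.\<close>
definition block :: "('a list \<Rightarrow> bool) \<Rightarrow> nat \<Rightarrow> nat \<Rightarrow> (nat \<Rightarrow> 'a list) \<Rightarrow> nat \<times> nat" where
  "block T r k y = (regen_times T y (Suc k) - regen_times T y k,
     multi_range r (map y [regen_times T y k..<regen_times T y (Suc k)]))"

definition first_block :: "('a list \<Rightarrow> bool) \<Rightarrow> nat \<Rightarrow> (nat \<Rightarrow> 'a list) \<Rightarrow> nat \<times> nat \<Rightarrow> bool" where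
  "first_block T r y z \<longleftrightarrow> multi_range r (map y [0..<fst z]) = snd z \<and> first_regen T y (fst z)"

text \<open>The adapted part of the event that the first m pieces have the values z.\<close>
primrec blocks_cylinder ::
  "('a list \<Rightarrow> bool) \<Rightarrow> nat \<Rightarrow> (nat \<Rightarrow> nat \<times> nat) \<Rightarrow> nat \<Rightarrow> (nat \<Rightarrow> 'a list) \<Rightarrow> bool" where
  "blocks_cylinder T r z 0 y \<longleftrightarrow> True"
| "blocks_cylinder T r z (Suc m) y \<longleftrightarrow>
     (let t = (\<Sum>i<m. fst (z i)); a = fst (z m) in
      blocks_cylinder T r z m y \<and> fresh T y t \<and> (\<forall>s\<in>{..a}. prefix (y t) (y (t + s))) \<and>
      multi_range r (map (shift t y) [0..<a]) = snd (z m) \<and> indecomposable T (shift t y) a)"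

lemma adapted_blocks_cylinder: "adapted (\<Sum>i<m. fst (z i)) (blocks_cylinder T r z m)"
proof (induction m)
  case 0
  show ?case by (simp add: adapted_def)
next
  case (Suc m)
  have 1: "adapted (fst (z m)) (\<lambda>y. multi_range r (map y [0..<fst (z m)]) = snd (z m) \<and> indecomposable T y (fst (z m)))"
    by (intro adapted_conj adapted_indecomposable adapted_map) simp
  have eq: "blocks_cylinder T r z (Suc m) = (\<lambda>y. blocks_cylinder T r z m y \<and>
      fresh T y (\<Sum>i<m. fst (z i)) \<and> (\<forall>s\<in>{..fst (z m)}. prefix (y (\<Sum>i<m. fst (z i))) (y ((\<Sum>i<m. fst (z i)) + s))) \<and>
      multi_range r (map (shift (\<Sum>i<m. fst (z i)) y) [0..<fst (z m)]) = snd (z m) \<and>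
      indecomposable T (shift (\<Sum>i<m. fst (z i)) y) (fst (z m)))"
    by (auto simp: Let_def)
  show ?case unfolding eq sum.lessThan_Suc
    by (intro adapted_conj[OF adapted_mono[OF Suc]] adapted_conj[OF adapted_fresh] adapted_conj[OF adapted_all]
        adapted_prefix adapted_shift[OF 1]) auto
qed

context typed_words
begin

lemma blocks_cylinder_Suc_regen:
  assumes y0: "y 0 = []" and t: "t = (\<Sum>i<m. fst (z i))"
  shows "blocks_cylinder T r z (Suc m) y \<and> regen T y (t + fst (z m)) \<longleftrightarrow>
     blocks_cylinder T r z m y \<and> regen T y t \<and> first_block T r (shift t y) (z m)"
proof
  assume L: "blocks_cylinder T r z (Suc m) y \<and> regen T y (t + fst (z m))"
  then have f: "fresh T y t" and p: "\<And>s. s \<le> fst (z m) \<Longrightarrow> prefix (y t) (y (t + s))"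
    by (auto simp: Let_def t)
  have "prefix (y t) (y s)" if "t \<le> s" for s
  proof (cases "s \<le> t + fst (z m)")
    case True
    then show ?thesis using p[of "s - t"] that by simp
  next
    case False
    then have "prefix (y (t + fst (z m))) (y s)" using L by (simp add: regen_def)
    with p[of "fst (z m)"] show ?thesis by (meson order_refl prefix_order.trans)
  qed
  then have r: "regen T y t" using f by (simp add: regen_def)
  then show "blocks_cylinder T r z m y \<and> regen T y t \<and> first_block T r (shift t y) (z m)"
    using L regen_shift[where y=y, OF y0 r, of "fst (z m)"]
    by (auto simp: first_block_def first_regen_iff Let_def t)
next
  assume R: "blocks_cylinder T r z m y \<and> regen T y t \<and> first_block T r (shift t y) (z m)"
  then show "blocks_cylinder T r z (Suc m) y \<and> regen T y (t + fst (z m))"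
    using regen_shift[where y=y, OF y0, of t "fst (z m)"]
    by (auto simp: first_block_def first_regen_iff Let_def t[symmetric]) (auto simp: regen_def)
qed

lemma regen_times_props:
  assumes y0: "y 0 = []" and inf: "infinite {k. regen T y k}"
  shows "regen_times T y 0 = 0" "strict_mono (regen_times T y)" "regen T y (regen_times T y k)"
    "first_regen T (shift (regen_times T y k) y) (regen_times T y (Suc k) - regen_times T y k)"
proof -
  let ?e = "regen_times T y"
  show "?e 0 = 0"
    unfolding regen_times_def enumerate_0 using regen_Nil_0[of y T, OF y0] by (intro Least_equality) auto
  show mono: "strict_mono ?e" unfolding regen_times_def by (rule strict_mono_enumerate[OF inf])
  show r: "regen T y (?e k)" for k unfolding regen_times_def using enumerate_in_set[OF inf] by simp
  have lt: "?e k < ?e (Suc k)" using mono by (simp add: strict_mono_def)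
  show "first_regen T (shift (?e k) y) (?e (Suc k) - ?e k)"
    unfolding first_regen_def
  proof (intro conjI ballI)
    show "0 < ?e (Suc k) - ?e k" using lt by simp
    show "regen T (shift (?e k) y) (?e (Suc k) - ?e k)"
      using regen_shift[where y=y, OF y0 r[of k]] r[of "Suc k"] lt by simp
    fix j assume j: "j \<in> {0<..<?e (Suc k) - ?e k}"
    show "\<not> regen T (shift (?e k) y) j"
    proof
      assume "regen T (shift (?e k) y) j"
      then have "regen T y (?e k + j)" using regen_shift[where y=y, OF y0 r[of k]] by simp
      then have "?e (Suc k) \<le> ?e k + j"
        unfolding regen_times_def enumerate_Suc''[OF inf]
        by (intro Least_le) (use j in auto)
      then show False using j by auto
    qed
  qed
qed

text \<open>On paths with infinitely many regeneration times, prescribing the first m pieces means an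
  adapted condition together with a regeneration at the time where these pieces end.\<close>
lemma blocks_cylinder_iff:
  assumes y0: "y 0 = []" and inf: "infinite {k. regen T y k}"
  shows "blocks_cylinder T r z m y \<and> regen T y (\<Sum>i<m. fst (z i)) \<longleftrightarrow> (\<forall>i<m. block T r i y = z i)"
    and "(\<forall>i<m. block T r i y = z i) \<Longrightarrow> regen_times T y m = (\<Sum>i<m. fst (z i))"
proof -
  note rt = regen_times_props[where y=y, OF y0 inf]
  show time: "(\<forall>i<m. block T r i y = z i) \<Longrightarrow> regen_times T y m = (\<Sum>i<m. fst (z i))" for m
  proof (induction m)
    case 0
    show ?case using rt(1) by simp
  next
    case (Suc m)
    have "fst (z m) = regen_times T y (Suc m) - regen_times T y m"
      using Suc.prems by (metis block_def fst_conv lessI)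
    moreover have "regen_times T y m < regen_times T y (Suc m)" using rt(2) by (simp add: strict_mono_def)
    ultimately show ?case using Suc by simp
  qed
  show "blocks_cylinder T r z m y \<and> regen T y (\<Sum>i<m. fst (z i)) \<longleftrightarrow> (\<forall>i<m. block T r i y = z i)"
  proof (induction m)
    case 0
    show ?case using regen_Nil_0[of y T, OF y0] by simp
  next
    case (Suc m)
    let ?t = "\<Sum>i<m. fst (z i)"
    have "blocks_cylinder T r z (Suc m) y \<and> regen T y (\<Sum>i<Suc m. fst (z i)) \<longleftrightarrow>
       (\<forall>i<m. block T r i y = z i) \<and> first_block T r (shift ?t y) (z m)"
      unfolding sum.lessThan_Suc blocks_cylinder_Suc_regen[where y=y, OF y0 refl]
      using Suc by blast
    also have "\<dots> \<longleftrightarrow> (\<forall>i<Suc m. block T r i y = z i)"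
    proof (cases "\<forall>i<m. block T r i y = z i")
      case True
      let ?e = "regen_times T y"
      have t: "?e m = ?t" using time[OF True] .
      have lt: "?e m < ?e (Suc m)" using rt(2) by (simp add: strict_mono_def)
      have fr: "first_regen T (shift ?t y) (?e (Suc m) - ?e m)" using rt(4)[of m] t by simp
      have mr: "multi_range r (map y [?e m..<?e (Suc m)]) =
          multi_range r (map (shift ?t y) [0..<?e (Suc m) - ?e m])"
      proof -
        obtain d where d: "?e (Suc m) = ?e m + d" using lt less_imp_add_positive by metis
        have "map y [?e m..<?e m + d] = map ((@) (y (?e m))) (map (shift (?e m) y) [0..<d])"
          by (rule map_upt_shift[OF rt(3)])
        moreover have "multi_range r (map ((@) (y (?e m))) (map (shift (?e m) y) [0..<d])) =
            multi_range r (map (shift (?e m) y) [0..<d])"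
          by (rule multi_range_map_inj) (simp add: inj_on_def)
        ultimately show ?thesis unfolding d t diff_add_inverse by (simp only:)
      qed
      have "first_block T r (shift ?t y) (z m) \<longleftrightarrow> block T r m y = z m"
      proof
        assume b: "first_block T r (shift ?t y) (z m)"
        then have "fst (z m) = ?e (Suc m) - ?e m"
          unfolding first_block_def using first_regen_unique[OF fr] by metis
        with b mr show "block T r m y = z m"
          unfolding first_block_def block_def by (metis prod.collapse)
      next
        assume "block T r m y = z m"
        then have "fst (z m) = ?e (Suc m) - ?e m" "snd (z m) = multi_range r (map y [?e m..<?e (Suc m)])"
          unfolding block_def by (metis fst_conv, metis snd_conv)
        then show "first_block T r (shift ?t y) (z m)"
          unfolding first_block_def using fr mr by metis
      qed
      then show ?thesis using True by (auto simp: less_Suc_eq)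
    qed (auto simp: less_Suc_eq)
    finally show ?case .
  qed
qed

text \<open>Before a regeneration time the path is outside the cone of the word at this time, and
  afterwards inside, so the counts of the pieces add up. The unfinished last piece contributes at
  most its length.\<close>
lemma multi_range_between_regens:
  assumes y0: "y 0 = []" and inf: "infinite {k. regen T y k}"
    and n: "regen_times T y k \<le> n" "n < regen_times T y (Suc k)"
  shows "(\<Sum>i<k. snd (block T r i y)) \<le> multi_range r (map y [0..<Suc n]) \<and>
     multi_range r (map y [0..<Suc n]) \<le>
       (\<Sum>i<k. snd (block T r i y)) + (regen_times T y (Suc k) - regen_times T y k)"
proof -
  note rt = regen_times_props[where y=y, OF y0 inf]
  let ?e = "regen_times T y"
  have split: "multi_range r (map y [0..<l]) = multi_range r (map y [0..<?e k]) + multi_range r (map y [?e k..<l])"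
    if l: "?e k \<le> l" for k l
  proof -
    have "set (map y [0..<?e k]) \<inter> set (map y [?e k..<l]) = {}"
    proof (cases "?e k = 0")
      case False
      have "\<not> prefix (y (?e k)) (y j)" if "j < ?e k" for j
        using rt(3)[of k] False that by (auto simp: regen_def fresh_def)
      moreover have "prefix (y (?e k)) (y j)" if "j \<ge> ?e k" for j
        using rt(3)[of k] that by (auto simp: regen_def)
      ultimately show ?thesis by (auto simp: disjoint_iff) metis
    qed simp
    moreover have "[0..<l] = [0..<?e k] @ [?e k..<l]"
      using l upt_add_eq_append[of 0 "?e k" "l - ?e k"] by simp
    ultimately show ?thesis using multi_range_append_disjoint by (metis map_append)
  qed
  have "multi_range r (map y [0..<?e k]) = (\<Sum>i<k. snd (block T r i y))"
  proof (induction k)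
    case 0
    show ?case using rt(1) by (simp add: multi_range_def)
  next
    case (Suc k)
    have "?e k < ?e (Suc k)" using rt(2) by (simp add: strict_mono_def)
    then show ?case using Suc split[of k "?e (Suc k)"] by (simp add: block_def)
  qed
  moreover have "multi_range r (map y [?e k..<Suc n]) \<le> ?e (Suc k) - ?e k"
    using multi_range_le_length[of r "map y [?e k..<Suc n]"] n by simp
  ultimately show ?thesis using split[of k "Suc n"] n by linarith
qed

end

section \<open>Regenerative processes\<close>

text \<open>The limit is a ratio of means under the law of one block, so it depends on the process only
  through this law.\<close>

definition limit_of_law :: "(nat \<times> nat \<Rightarrow> real) \<Rightarrow> real" where
  "limit_of_law f = (\<integral>z. real (snd z) \<partial>density (count_space UNIV) (\<lambda>z. ennreal (f z))) /
     (\<integral>z. real (fst z) \<partial>density (count_space UNIV) (\<lambda>z. ennreal (f z)))"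

text \<open>At a regeneration time the process starts afresh, independently of its past. The linear growth
  of the expected number of regeneration times up to n excludes that their gaps have an infinite
  mean.\<close>
locale regenerative_process = typed_words T + prob_space N
  for T :: "'a list \<Rightarrow> bool" and N :: "'w measure" +
  fixes S :: "'a list set" and Y :: "nat \<Rightarrow> 'w \<Rightarrow> 'a list" and r :: nat and c :: real
  assumes countable_S: "countable S"
    and Y_measurable[measurable]: "\<And>n. Y n \<in> measurable N (count_space S)"
    and Y_0: "\<And>\<omega>. \<omega> \<in> space N \<Longrightarrow> Y 0 \<omega> = []"
    and regeneration: "\<And>n m P Q. adapted n P \<Longrightarrow> adapted m Q \<Longrightarrow>
      \<P>(\<omega> in N. P (\<lambda>k. Y k \<omega>) \<and> regen T (\<lambda>k. Y k \<omega>) n \<and>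
         Q (shift n (\<lambda>k. Y k \<omega>)) \<and> regen T (shift n (\<lambda>k. Y k \<omega>)) m) =
      \<P>(\<omega> in N. P (\<lambda>k. Y k \<omega>) \<and> regen T (\<lambda>k. Y k \<omega>) n) * \<P>(\<omega> in N. Q (\<lambda>k. Y k \<omega>) \<and> regen T (\<lambda>k. Y k \<omega>) m)"
    and c_pos: "0 < c"
    and linear_growth: "\<And>n. c * real n \<le> (\<Sum>k\<le>n. \<P>(\<omega> in N. regen T (\<lambda>k. Y k \<omega>) k))"
begin

abbreviation traj :: "'w \<Rightarrow> nat \<Rightarrow> 'a list" where
  "traj \<omega> \<equiv> \<lambda>k. Y k \<omega>"

lemma pred_Y: "adapted n P \<Longrightarrow> Measurable.pred N (\<lambda>\<omega>. P (traj \<omega>))"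
  by (rule pred_adapted(1)[OF countable_S Y_measurable])

lemma pred_Y_shift: "adapted n P \<Longrightarrow> Measurable.pred N (\<lambda>\<omega>. P (shift k (traj \<omega>)))"
  by (rule pred_Y[OF adapted_shift])

lemma pred_regen_shift[measurable]: "Measurable.pred N (\<lambda>\<omega>. regen T (shift k (traj \<omega>)) n)"
proof -
  have "Measurable.pred N (\<lambda>\<omega>. fresh T (shift k (traj \<omega>)) n)"
    by (rule pred_Y_shift[OF adapted_fresh[OF order_refl]])
  moreover have "Measurable.pred N (\<lambda>\<omega>. prefix (shift k (traj \<omega>) n) (shift k (traj \<omega>) s))" for s
    by (rule pred_Y_shift[OF adapted_prefix[of n "max n s" s]]) auto
  ultimately show ?thesis unfolding regen_def by measurable
qed

lemma shift_zero: "\<omega> \<in> space N \<Longrightarrow> shift 0 (traj \<omega>) = (traj \<omega>)"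
  by (simp add: shift_def Y_0 fun_eq_iff)

lemma pred_regen[measurable]: "Measurable.pred N (\<lambda>\<omega>. regen T (traj \<omega>) n)"
  using pred_regen_shift[of 0 n] by (simp add: shift_zero cong: measurable_cong)

lemma pred_first_regen[measurable]:
  "Measurable.pred N (\<lambda>\<omega>. first_regen T (traj \<omega>) n)"
  "Measurable.pred N (\<lambda>\<omega>. first_regen T (shift k (traj \<omega>)) n)"
  unfolding first_regen_def by measurable

lemma regeneration_first:
  assumes P: "adapted n P" and Q: "adapted a Q"
  shows "\<P>(\<omega> in N. P (traj \<omega>) \<and> regen T (traj \<omega>) n \<and>
         Q (shift n (traj \<omega>)) \<and> first_regen T (shift n (traj \<omega>)) a) =
      \<P>(\<omega> in N. P (traj \<omega>) \<and> regen T (traj \<omega>) n) * \<P>(\<omega> in N. Q (traj \<omega>) \<and> first_regen T (traj \<omega>) a)"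
  using regeneration[OF P adapted_conj[OF Q adapted_indecomposable[of a T]]]
  unfolding first_regen_iff by (simp add: conj_assoc)

definition regen_prob :: "nat \<Rightarrow> real" where "regen_prob k = \<P>(\<omega> in N. regen T (traj \<omega>) k)"

definition no_regen_prob :: "nat \<Rightarrow> real" where "no_regen_prob j = \<P>(\<omega> in N. \<forall>i\<in>{1..j}. \<not> regen T (traj \<omega>) i)"

lemma no_regen_prob_nonneg: "0 \<le> no_regen_prob j" by (simp add: no_regen_prob_def)

text \<open>After a regeneration at time k, the next one follows after exactly j + 1 steps with the
  same conditional probability as after time 0; this is subtracted from j to j + 1.\<close>
lemma regen_then_none:
  "\<P>(\<omega> in N. regen T (traj \<omega>) k \<and> (\<forall>i\<in>{1..j}. \<not> regen T (shift k (traj \<omega>)) i)) = regen_prob k * no_regen_prob j"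
proof (induction j)
  case 0
  show ?case by (simp add: regen_prob_def no_regen_prob_def prob_space)
next
  case (Suc j)
  let ?Y = "\<lambda>\<omega> k. Y k \<omega>"
  have split: "\<P>(\<omega> in N. A \<omega> \<and> (\<forall>i\<in>{1..j}. \<not> regen T (s \<omega>) i)) =
      \<P>(\<omega> in N. A \<omega> \<and> (\<forall>i\<in>{1..Suc j}. \<not> regen T (s \<omega>) i)) + \<P>(\<omega> in N. A \<omega> \<and> first_regen T (s \<omega>) (Suc j))"
    if [measurable]: "Measurable.pred N A" "\<And>i. Measurable.pred N (\<lambda>\<omega>. regen T (s \<omega>) i)" for A s
  proof -
    have [measurable]: "Measurable.pred N (\<lambda>\<omega>. first_regen T (s \<omega>) (Suc j))"
      unfolding first_regen_def by measurable
    have I: "{0<..<Suc j} = {1..j}" "{1..Suc j} = insert (Suc j) {1..j}" by auto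
    have eq: "{\<omega>\<in>space N. A \<omega> \<and> (\<forall>i\<in>{1..j}. \<not> regen T (s \<omega>) i)} =
      {\<omega>\<in>space N. A \<omega> \<and> (\<forall>i\<in>{1..Suc j}. \<not> regen T (s \<omega>) i)} \<union> {\<omega>\<in>space N. A \<omega> \<and> first_regen T (s \<omega>) (Suc j)}"
      unfolding first_regen_def I by auto
    show ?thesis unfolding eq
      by (rule finite_measure_Union) (auto simp: first_regen_def I)
  qed
  have "\<P>(\<omega> in N. regen T (?Y \<omega>) k \<and> first_regen T (shift k (?Y \<omega>)) (Suc j)) =
      regen_prob k * \<P>(\<omega> in N. first_regen T (?Y \<omega>) (Suc j))"
    using regeneration_first[OF adapted_const[of k True] adapted_const[of "Suc j" True]]
    by (simp add: regen_prob_def)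
  moreover have "no_regen_prob j = no_regen_prob (Suc j) + \<P>(\<omega> in N. first_regen T (?Y \<omega>) (Suc j))"
    unfolding no_regen_prob_def using split[of "\<lambda>_. True" ?Y] by simp
  moreover note split[of "\<lambda>\<omega>. regen T (?Y \<omega>) k" "\<lambda>\<omega>. shift k (?Y \<omega>)"] Suc
  ultimately show ?case by (simp add: algebra_simps)
qed

text \<open>For different k, the events that k is the last regeneration time up to n are disjoint.\<close>
lemma last_regen_sum: "(\<Sum>k\<le>n. regen_prob k * no_regen_prob (n - k)) \<le> 1"
proof -
  let ?E = "\<lambda>k. {\<omega>\<in>space N. regen T (traj \<omega>) k \<and> (\<forall>i\<in>{1..n - k}. \<not> regen T (shift k (traj \<omega>)) i)}"
  have no: False if "\<omega> \<in> ?E k" "\<omega> \<in> ?E k'" "k < k'" "k' \<le> n" for \<omega> k k'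
  proof -
    have "regen T (shift k (traj \<omega>)) (k' - k)"
      using that regen_shift[of "\<lambda>k. Y k \<omega>" k "k' - k"] Y_0 by simp
    moreover have "k' - k \<in> {1..n - k}" using that by auto
    ultimately show False using that by blast
  qed
  have "disjoint_family_on ?E {..n}"
    unfolding disjoint_family_on_def
  proof (intro ballI impI)
    fix k k' assume "k \<in> {..n}" "k' \<in> {..n}" "k \<noteq> k'"
    then show "?E k \<inter> ?E k' = {}"
      using no[of _ k k'] no[of _ k' k] by (cases k k' rule: linorder_cases) blast+
  qed
  then have "(\<Sum>k\<le>n. prob (?E k)) = prob (\<Union>k\<in>{..n}. ?E k)"
    by (intro finite_measure_finite_Union[symmetric]) auto
  also have "\<dots> \<le> 1" by (rule prob_le_1)
  finally show ?thesis using regen_then_none by simp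
qed

text \<open>Summing the previous inequality over all n up to 2 m bounds the product of the first m + 1
  terms of both sequences by 2 m + 1, and one factor grows linearly.\<close>
lemma no_regen_prob_summable: "summable no_regen_prob"
proof (rule summableI_nonneg_bounded)
  have u0: "0 \<le> regen_prob k" for k by (simp add: regen_prob_def)
  have le: "(\<Sum>j\<le>m. no_regen_prob j) \<le> 3 / c" if "1 \<le> m" for m
  proof -
    have "(\<Sum>k\<le>m. regen_prob k) * (\<Sum>j\<le>m. no_regen_prob j) = (\<Sum>(k, j)\<in>{..m} \<times> {..m}. regen_prob k * no_regen_prob j)"
      by (simp add: sum_product sum.cartesian_product)
    also have "\<dots> \<le> (\<Sum>(k, j)\<in>{(k, j). k + j \<le> 2 * m}. regen_prob k * no_regen_prob j)"
    proof (rule sum_mono2)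
      have "{(k, j). k + j \<le> 2 * m} \<subseteq> {..2*m} \<times> {..2*m}" by auto
      then show "finite {(k, j). k + j \<le> 2 * m}" by (rule finite_subset) auto
    qed (auto simp: u0 no_regen_prob_nonneg)
    also have "\<dots> = (\<Sum>n\<le>2 * m. \<Sum>k\<le>n. regen_prob k * no_regen_prob (n - k))"
      by (rule sum.triangle_reindex_eq)
    also have "\<dots> \<le> (\<Sum>n\<le>2 * m. 1)" by (intro sum_mono last_regen_sum)
    also have "\<dots> \<le> 3 * real m" using that by simp
    finally have "(\<Sum>k\<le>m. regen_prob k) * (\<Sum>j\<le>m. no_regen_prob j) \<le> 3 * real m" .
    moreover have "c * real m * (\<Sum>j\<le>m. no_regen_prob j) \<le> (\<Sum>k\<le>m. regen_prob k) * (\<Sum>j\<le>m. no_regen_prob j)"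
      using linear_growth[of m] unfolding regen_prob_def by (intro mult_right_mono sum_nonneg no_regen_prob_nonneg)
    ultimately have "real m * (c * (\<Sum>j\<le>m. no_regen_prob j)) \<le> real m * 3" by (simp add: mult_ac)
    then show ?thesis using that c_pos by (simp add: field_simps)
  qed
  show "(\<Sum>j<n. no_regen_prob j) \<le> 3 / c" for n
  proof -
    have "(\<Sum>j<n. no_regen_prob j) \<le> (\<Sum>j\<le>max 1 n. no_regen_prob j)"
      by (intro sum_mono2) (auto simp: no_regen_prob_nonneg)
    also have "\<dots> \<le> 3 / c" by (rule le) simp
    finally show ?thesis .
  qed
qed (rule no_regen_prob_nonneg)

text \<open>The probability that k is the last regeneration time is at most \<open>regen_prob k * no_regen_prob j\<close>
  for all j, which tends to 0.\<close>
lemma AE_infinitely_many_regens: "AE \<omega> in N. infinite {k. regen T (traj \<omega>) k}"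
proof -
  have "AE \<omega> in N. \<forall>k. \<not> (regen T (traj \<omega>) k \<and> (\<forall>i\<ge>1. \<not> regen T (shift k (traj \<omega>)) i))"
    unfolding AE_all_countable
  proof
    fix k
    let ?E = "{\<omega>\<in>space N. regen T (traj \<omega>) k \<and> (\<forall>i\<ge>1. \<not> regen T (shift k (traj \<omega>)) i)}"
    have "prob ?E \<le> regen_prob k * no_regen_prob j" for j
      unfolding regen_then_none[symmetric] by (rule finite_measure_mono) auto
    moreover have "(\<lambda>j. regen_prob k * no_regen_prob j) \<longlonglongrightarrow> regen_prob k * 0"
      by (intro tendsto_mult tendsto_const summable_LIMSEQ_zero no_regen_prob_summable)
    ultimately have "prob ?E \<le> regen_prob k * 0"
      by (intro LIMSEQ_le_const[where X="\<lambda>j. regen_prob k * no_regen_prob j"]) auto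
    then have "prob ?E = 0" by (simp add: measure_le_0_iff)
    then show "AE \<omega> in N. \<not> (regen T (traj \<omega>) k \<and> (\<forall>i\<ge>1. \<not> regen T (shift k (traj \<omega>)) i))"
      by (subst (asm) prob_Collect_eq_0) auto
  qed
  with AE_space show ?thesis
  proof eventually_elim
    fix \<omega> assume \<omega>: "\<omega> \<in> space N"
      and nl: "\<forall>k. \<not> (regen T (traj \<omega>) k \<and> (\<forall>i\<ge>1. \<not> regen T (shift k (traj \<omega>)) i))"
    let ?R = "{k. regen T (traj \<omega>) k}"
    have next': "\<exists>j\<in>?R. k < j" if "k \<in> ?R" for k
    proof -
      from nl that obtain i where "i \<ge> 1" "regen T (shift k (traj \<omega>)) i" by auto
      then show ?thesis using regen_shift[of "\<lambda>k. Y k \<omega>" k i] Y_0[OF \<omega>] that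
        by (intro bexI[of _ "k + i"]) auto
    qed
    show "infinite ?R"
    proof
      assume fin: "finite ?R"
      have "0 \<in> ?R" using regen_Nil_0[of "\<lambda>k. Y k \<omega>"] Y_0[OF \<omega>] by simp
      then have "Max ?R \<in> ?R" using fin by (intro Max_in) auto
      then obtain j where "j \<in> ?R" "Max ?R < j" using next' by blast
      then show False using Max_ge[OF fin] by force
    qed
  qed
qed

definition block_law :: "nat \<times> nat \<Rightarrow> real" where
  "block_law z = \<P>(\<omega> in N. first_block T r (traj \<omega>) z)"

lemma blocks_cylinder_prob:
  "\<P>(\<omega> in N. blocks_cylinder T r z m (traj \<omega>) \<and> regen T (traj \<omega>) (\<Sum>i<m. fst (z i))) =
     (\<Prod>i<m. block_law (z i))"
proof (induction m)
  case 0
  have "regen T (traj \<omega>) 0" if "\<omega> \<in> space N" for \<omega>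
    using regen_Nil_0[of "\<lambda>k. Y k \<omega>"] Y_0[OF that] by simp
  then have "{\<omega>\<in>space N. regen T (traj \<omega>) 0} = space N" by blast
  then show ?case by (simp add: prob_space)
next
  case (Suc m)
  let ?t = "\<Sum>i<m. fst (z i)"
  have Q: "adapted (fst (z m)) (\<lambda>y. multi_range r (map y [0..<fst (z m)]) = snd (z m))"
    by (rule adapted_map) simp
  have "\<P>(\<omega> in N. blocks_cylinder T r z (Suc m) (traj \<omega>) \<and> regen T (traj \<omega>) (\<Sum>i<Suc m. fst (z i))) =
     \<P>(\<omega> in N. blocks_cylinder T r z m (traj \<omega>) \<and> regen T (traj \<omega>) ?t \<and>
        first_block T r (shift ?t (traj \<omega>)) (z m))"
    unfolding sum.lessThan_Suc
    by (intro arg_cong[where f=prob] Collect_cong conj_cong refl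
        blocks_cylinder_Suc_regen[OF _ refl] Y_0)
  also have "\<dots> = (\<Prod>i<m. block_law (z i)) * block_law (z m)"
    unfolding first_block_def regeneration_first[OF adapted_blocks_cylinder Q] Suc
    by (simp add: block_law_def first_block_def)
  finally show ?case by simp
qed

text \<open>The sequence of pieces. On the null set of paths with finitely many regeneration times, where
  the enumeration of these times is meaningless, it gets an arbitrary constant value in order to be
  measurable.\<close>
definition Z :: "nat \<Rightarrow> 'w \<Rightarrow> nat \<times> nat" where
  "Z k \<omega> = (if infinite {k. regen T (traj \<omega>) k} then block T r k (traj \<omega>) else (0, 0))"

lemma pred_infinite[measurable]: "Measurable.pred N (\<lambda>\<omega>. infinite {k. regen T (traj \<omega>) k})"
  unfolding infinite_nat_iff_unbounded_le by (simp only: mem_Collect_eq) measurable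

lemma pred_cylinder[measurable]: "Measurable.pred N (\<lambda>\<omega>. blocks_cylinder T r z m (traj \<omega>))"
  by (rule pred_Y[OF adapted_blocks_cylinder])

lemma Z_measurable[measurable]: "Z k \<in> measurable N (count_space UNIV)"
proof -
  have "Measurable.pred N (\<lambda>\<omega>. Z k \<omega> = z)" for z
  proof -
    let ?C = "\<lambda>zs \<omega>. blocks_cylinder T r (\<lambda>i. (zs @ [z]) ! i) (Suc k) (traj \<omega>) \<and>
        regen T (traj \<omega>) (\<Sum>i<Suc k. fst ((zs @ [z]) ! i))"
    have eq: "Z k \<omega> = z \<longleftrightarrow> (if infinite {k. regen T (traj \<omega>) k}
        then \<exists>zs. length zs = k \<and> ?C zs \<omega> else z = (0, 0))" if \<omega>: "\<omega> \<in> space N" for \<omega>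
    proof (cases "infinite {k. regen T (traj \<omega>) k}")
      case True
      have "(\<exists>zs. length zs = k \<and> (\<forall>i<Suc k. block T r i (traj \<omega>) = (zs @ [z]) ! i)) \<longleftrightarrow>
          block T r k (traj \<omega>) = z"
      proof
        assume "block T r k (traj \<omega>) = z"
        then show "\<exists>zs. length zs = k \<and> (\<forall>i<Suc k. block T r i (traj \<omega>) = (zs @ [z]) ! i)"
          by (intro exI[of _ "map (\<lambda>i. block T r i (traj \<omega>)) [0..<k]"])
             (auto simp: nth_append less_Suc_eq)
      qed (auto simp: nth_append)
      then show ?thesis
        using True blocks_cylinder_iff(1)[OF _ True, where r=r] Y_0[OF \<omega>]
        by (simp add: Z_def del: blocks_cylinder.simps sum.lessThan_Suc)
    qed (auto simp: Z_def)
    have "Measurable.pred N (\<lambda>\<omega>. if infinite {k. regen T (traj \<omega>) k}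
        then \<exists>zs. length zs = k \<and> ?C zs \<omega> else z = (0, 0))"
      by measurable
    then show ?thesis by (subst measurable_cong[OF eq])
  qed
  then show ?thesis
    by (subst measurable_count_space_eq2_countable) (auto simp: pred_def vimage_def Int_def conj_commute)
qed

lemma Z_law: "\<P>(\<omega> in N. \<forall>i<m. Z i \<omega> = z i) = (\<Prod>i<m. block_law (z i))"
  unfolding blocks_cylinder_prob[symmetric]
proof (rule finite_measure_eq_AE)
  show "AE \<omega> in N. \<omega> \<in> {\<omega>\<in>space N. \<forall>i<m. Z i \<omega> = z i} \<longleftrightarrow>
     \<omega> \<in> {\<omega>\<in>space N. blocks_cylinder T r z m (traj \<omega>) \<and> regen T (traj \<omega>) (\<Sum>i<m. fst (z i))}"
    using AE_infinitely_many_regens AE_space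
  proof eventually_elim
    case (elim \<omega>)
    then show ?case using blocks_cylinder_iff(1)[OF _ elim(1), where r=r] Y_0 by (simp add: Z_def)
  qed
qed auto

lemma Z_indep: "indep_vars (\<lambda>_. count_space UNIV) Z UNIV"
  and Z_id: "distr N (count_space UNIV) (Z i) = distr N (count_space UNIV) (Z 0)"
  using iid_if_point_probabilities_multiply[of Z block_law, OF Z_measurable Z_law] by auto

lemma Z_distr: "distr N (count_space UNIV) (Z 0) = density (count_space UNIV) (\<lambda>z. ennreal (block_law z))"
proof (rule measure_eqI_countable[where A=UNIV])
  fix z :: "nat \<times> nat"
  have "emeasure (distr N (count_space UNIV) (Z 0)) {z} = ennreal (\<P>(\<omega> in N. Z 0 \<omega> = z))"
    by (subst emeasure_distr) (auto simp: emeasure_eq_measure vimage_def Int_def conj_commute)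
  also have "\<dots> = emeasure (density (count_space UNIV) (\<lambda>z. ennreal (block_law z))) {z}"
    using Z_law[of 1 "\<lambda>_. z"] by (simp add: emeasure_density nn_integral_indicator_singleton)
  finally show "emeasure (distr N (count_space UNIV) (Z 0)) {z} =
    emeasure (density (count_space UNIV) (\<lambda>z. ennreal (block_law z))) {z}" .
qed auto

lemma averages:
  fixes F :: "nat \<times> nat \<Rightarrow> real"
  assumes "integrable N (\<lambda>\<omega>. F (Z 0 \<omega>))"
  shows "AE \<omega> in N. (\<lambda>n. (\<Sum>i<n. F (Z i \<omega>)) / real n) \<longlonglongrightarrow> (\<integral>z. F z \<partial>density (count_space UNIV) (\<lambda>z. ennreal (block_law z)))"
proof -
  have "AE \<omega> in N. (\<lambda>n. (\<Sum>i<n. F (Z i \<omega>)) / real n) \<longlonglongrightarrow> expectation (\<lambda>\<omega>. F (Z 0 \<omega>))"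
  proof (rule strong_law_of_large_numbers)
    show "indep_vars (\<lambda>_. borel) (\<lambda>i \<omega>. F (Z i \<omega>)) UNIV"
      by (rule indep_vars_compose2[OF Z_indep]) auto
    have "distr N borel (\<lambda>\<omega>. F (Z i \<omega>)) = distr (distr N (count_space UNIV) (Z i)) borel F" for i
      by (subst distr_distr) (auto simp: comp_def)
    then show "distr N borel (\<lambda>\<omega>. F (Z i \<omega>)) = distr N borel (\<lambda>\<omega>. F (Z 0 \<omega>))" for i
      by (simp add: Z_id[of i])
  qed fact
  also have "expectation (\<lambda>\<omega>. F (Z 0 \<omega>)) = (\<integral>z. F z \<partial>distr N (count_space UNIV) (Z 0))"
    by (rule integral_distr[symmetric]) auto
  finally show ?thesis unfolding Z_distr .
qed

lemma first_block_Z_0: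
  assumes "\<omega> \<in> space N" "infinite {k. regen T (traj \<omega>) k}"
  shows "first_regen T (traj \<omega>) (fst (Z 0 \<omega>))"
    and "snd (Z 0 \<omega>) = multi_range r (map (traj \<omega>) [0..<fst (Z 0 \<omega>)])"
proof -
  note rt = regen_times_props[of "\<lambda>k. Y k \<omega>", OF Y_0[OF assms(1)] assms(2)]
  have Z: "Z 0 \<omega> = block T r 0 (traj \<omega>)" using assms(2) by (simp add: Z_def)
  show "first_regen T (traj \<omega>) (fst (Z 0 \<omega>))"
    using rt(4)[of 0] unfolding Z block_def rt(1) shift_zero[OF assms(1)] by simp
  show "snd (Z 0 \<omega>) = multi_range r (map (traj \<omega>) [0..<fst (Z 0 \<omega>)])"
    unfolding Z block_def rt(1) by simp
qed

text \<open>The mean of a natural number is the sum of its tail probabilities, which are the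
  \<open>no_regen_prob j\<close>.\<close>
lemma gap_integrable: "integrable N (\<lambda>\<omega>. real (fst (Z 0 \<omega>)))"
proof (rule integrableI_nonneg)
  have tail: "emeasure N {\<omega>\<in>space N. j < fst (Z 0 \<omega>)} = ennreal (no_regen_prob j)" for j
  proof -
    have "\<P>(\<omega> in N. j < fst (Z 0 \<omega>)) = no_regen_prob j"
      unfolding no_regen_prob_def
    proof (rule finite_measure_eq_AE)
      show "AE \<omega> in N. \<omega> \<in> {\<omega>\<in>space N. j < fst (Z 0 \<omega>)} \<longleftrightarrow>
          \<omega> \<in> {\<omega>\<in>space N. \<forall>i\<in>{1..j}. \<not> regen T (traj \<omega>) i}"
        using AE_infinitely_many_regens AE_space
      proof eventually_elim
        case (elim \<omega>)
        then show ?case using first_block_Z_0(1)[of \<omega>] unfolding first_regen_def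
          by (auto simp: not_less)
      qed
    qed auto
    then show ?thesis by (simp add: emeasure_eq_measure)
  qed
  have "(\<integral>\<^sup>+\<omega>. ennreal (real (fst (Z 0 \<omega>))) \<partial>N) = (\<integral>\<^sup>+\<omega>. of_nat (fst (Z 0 \<omega>)) \<partial>N)"
    by (simp add: ennreal_of_nat_eq_real_of_nat)
  also have "\<dots> = (\<Sum>j. emeasure N {\<omega>\<in>space N. j < fst (Z 0 \<omega>)})"
    by (rule nn_integral_nat_function) (rule measurable_compose[OF Z_measurable], simp)
  also have "\<dots> = ennreal (suminf no_regen_prob)"
    unfolding tail by (rule suminf_ennreal2) (auto simp: no_regen_prob_nonneg no_regen_prob_summable)
  finally show "(\<integral>\<^sup>+\<omega>. ennreal (real (fst (Z 0 \<omega>))) \<partial>N) < \<infinity>" by simp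
qed auto

lemma mark_integrable: "integrable N (\<lambda>\<omega>. real (snd (Z 0 \<omega>)))"
proof (rule Bochner_Integration.integrable_bound[OF gap_integrable])
  show "AE \<omega> in N. norm (real (snd (Z 0 \<omega>))) \<le> norm (real (fst (Z 0 \<omega>)))"
    using AE_infinitely_many_regens AE_space
  proof eventually_elim
    case (elim \<omega>)
    then show ?case using first_block_Z_0(2)[of \<omega>]
        multi_range_le_length[of r "map (traj \<omega>) [0..<fst (Z 0 \<omega>)]"] by simp
  qed
qed auto

lemma mean_eq: "(\<integral>z. F z \<partial>density (count_space UNIV) (\<lambda>z. ennreal (block_law z))) = expectation (\<lambda>\<omega>. F (Z 0 \<omega>))"
  for F :: "nat \<times> nat \<Rightarrow> real"
  unfolding Z_distr[symmetric] by (rule integral_distr) auto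

lemma mean_gap_pos: "0 < expectation (\<lambda>\<omega>. real (fst (Z 0 \<omega>)))"
proof -
  have "expectation (\<lambda>\<omega>. 1) \<le> expectation (\<lambda>\<omega>. real (fst (Z 0 \<omega>)))"
  proof (rule integral_mono_AE)
    show "AE \<omega> in N. 1 \<le> real (fst (Z 0 \<omega>))"
      using AE_infinitely_many_regens AE_space
    proof eventually_elim
      case (elim \<omega>)
      then show ?case using first_block_Z_0(1)[of \<omega>] by (simp add: first_regen_def)
    qed
  qed (auto simp: gap_integrable)
  then show ?thesis by (simp add: prob_space)
qed

theorem multi_range_limit:
  "AE \<omega> in N. (\<lambda>n. real (multi_range r (map (traj \<omega>) [0..<Suc n])) / real n) \<longlonglongrightarrow> limit_of_law block_law"
  using AE_infinitely_many_regens AE_space averages[OF gap_integrable] averages[OF mark_integrable]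
proof eventually_elim
  case (elim \<omega>)
  let ?y = "\<lambda>k. Y k \<omega>"
  have y0: "?y 0 = []" using Y_0 elim by simp
  note rt = regen_times_props[of ?y, OF y0 elim(1)]
  have Z: "Z i \<omega> = block T r i ?y" for i using elim by (simp add: Z_def)
  have e: "regen_times T ?y k = (\<Sum>i<k. fst (Z i \<omega>))" for k
    by (rule blocks_cylinder_iff(2)[OF y0 elim(1), where r=r]) (simp add: Z)
  show ?case unfolding limit_of_law_def
  proof (rule renewal_reward_limit[where e="regen_times T ?y" and g="\<lambda>i. snd (Z i \<omega>)"])
    show "(\<lambda>k. real (regen_times T ?y k) / real k) \<longlonglongrightarrow>
        (\<integral>z. real (fst z) \<partial>density (count_space UNIV) (\<lambda>z. ennreal (block_law z)))"
      using elim(3) by (simp add: e)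
    show "(\<lambda>k. real (\<Sum>i<k. snd (Z i \<omega>)) / real k) \<longlonglongrightarrow>
        (\<integral>z. real (snd z) \<partial>density (count_space UNIV) (\<lambda>z. ennreal (block_law z)))"
      using elim(4) by simp
    show "0 < (\<integral>z. real (fst z) \<partial>density (count_space UNIV) (\<lambda>z. ennreal (block_law z)))"
      using mean_gap_pos mean_eq[of "\<lambda>z. real (fst z)"] by simp
    show "(\<Sum>i<k. snd (Z i \<omega>)) \<le> multi_range r (map ?y [0..<Suc n]) \<and>
       multi_range r (map ?y [0..<Suc n]) \<le> (\<Sum>i<k. snd (Z i \<omega>)) + (regen_times T ?y (Suc k) - regen_times T ?y k)"
      if "regen_times T ?y k \<le> n" "n < regen_times T ?y (Suc k)" for k n
      unfolding Z by (rule multi_range_between_regens[OF y0 elim(1) that])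
  qed (use rt in auto)
qed

text \<open>After the first positive regeneration time the empty word is not visited any more. So on the event
  below all of its r visits belong to the first piece, which then has a vertex of multiplicity r.\<close>
lemma limit_pos:
  assumes K: "0 < \<P>(\<omega> in N. visits [] (map (traj \<omega>) [0..<K]) = r \<and> regen T (traj \<omega>) K)"
    and K0: "0 < K" and r0: "1 \<le> r"
  shows "0 < limit_of_law block_law"
proof -
  have [measurable]: "Measurable.pred N (\<lambda>\<omega>. visits [] (map (traj \<omega>) [0..<K]) = r)"
    by (rule pred_Y[OF adapted_map[of K K]]) simp
  have "expectation (\<lambda>\<omega>. real (snd (Z 0 \<omega>))) \<noteq> 0"
  proof
    assume "expectation (\<lambda>\<omega>. real (snd (Z 0 \<omega>))) = 0"
    then have "AE \<omega> in N. real (snd (Z 0 \<omega>)) = 0"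
      by (subst (asm) integral_nonneg_eq_0_iff_AE) (auto simp: mark_integrable)
    then have "AE \<omega> in N. \<not> (visits [] (map (traj \<omega>) [0..<K]) = r \<and> regen T (traj \<omega>) K)"
      using AE_infinitely_many_regens AE_space
    proof eventually_elim
      case (elim \<omega>)
      let ?y = "\<lambda>k. Y k \<omega>"
      let ?a = "fst (Z 0 \<omega>)"
      have fr: "first_regen T ?y ?a" using first_block_Z_0(1) elim by simp
      have z: "multi_range r (map ?y [0..<?a]) = 0"
        using first_block_Z_0(2)[of \<omega>] elim by simp
      show ?case
      proof
        assume A: "visits [] (map ?y [0..<K]) = r \<and> regen T ?y K"
        have aK: "?a \<le> K" using fr A K0 unfolding first_regen_def by (metis greaterThanLessThan_iff not_less)
        have ne: "?y j \<noteq> []" if "?a \<le> j" for j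
        proof -
          have "T (?y ?a)" "prefix (?y ?a) (?y j)"
            using fr that unfolding first_regen_def regen_def fresh_def by auto
          then show ?thesis using T_Nil by auto
        qed
        have "[] \<notin> set (map ?y [?a..<K])"
        proof
          assume "[] \<in> set (map ?y [?a..<K])"
          then obtain j where "?a \<le> j" "?y j = []" by auto
          with ne[of j] show False by simp
        qed
        then have "visits [] (map ?y [?a..<K]) = 0" by (rule visits_eq_0_iff[THEN iffD2])
        moreover have "[0..<K] = [0..<?a] @ [?a..<K]"
          using aK upt_add_eq_append[of 0 ?a "K - ?a"] by simp
        ultimately have v: "visits [] (map ?y [0..<?a]) = r" using A by (simp add: visits_append)
        then have "[] \<in> set (map ?y [0..<?a])" using r0 visits_eq_0_iff[of "[]" "map ?y [0..<?a]"] by auto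
        then have "{u \<in> set (map ?y [0..<?a]). visits u (map ?y [0..<?a]) = r} \<noteq> {}" using v by blast
        then show False using z unfolding multi_range_def by (subst (asm) card_0_eq) auto
      qed
    qed
    then show False using K
      by (subst (asm) AE_iff_measurable[OF _ refl]) (auto simp: emeasure_eq_measure)
  qed
  moreover have "0 \<le> expectation (\<lambda>\<omega>. real (snd (Z 0 \<omega>)))" by (rule Bochner_Integration.integral_nonneg) simp
  ultimately have "0 < expectation (\<lambda>\<omega>. real (snd (Z 0 \<omega>)))" by linarith
  then show ?thesis
    unfolding limit_of_law_def mean_eq by (rule divide_pos_pos[OF _ mean_gap_pos])
qed

end

section \<open>The walk on the free product\<close>

context word_chain
begin

lemma AE_steps_nonzero: "AE \<omega> in M. \<forall>n. q (X n \<omega>) (X (Suc n) \<omega>) \<noteq> 0"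
  unfolding AE_all_countable
proof
  fix n
  let ?I = "PiE {..Suc n} (\<lambda>_. S)"
  have C: "countable ?I" by (intro countable_PiE) (use countable_S in auto)
  have Y: "(\<lambda>\<omega>. \<lambda>k\<in>{..Suc n}. X k \<omega>) \<in> measurable M (count_space ?I)"
    by (rule pred_adapted(2)[OF countable_S X_measurable adapted_const[where c=True]])
  have "\<P>(\<omega> in M. q (X n \<omega>) (X (Suc n) \<omega>) = 0) = 0 * \<P>(\<omega> in M. True)"
  proof (rule prob_proportional_by_values[OF C _ _ Y Y])
    fix x assume x: "x \<in> ?I"
    show "\<P>(\<omega> in M. q (X n \<omega>) (X (Suc n) \<omega>) = 0 \<and> (\<lambda>k\<in>{..Suc n}. X k \<omega>) = x) =
      0 * \<P>(\<omega> in M. True \<and> (\<lambda>k\<in>{..Suc n}. X k \<omega>) = x)"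
    proof (cases "q (x n) (x (Suc n)) = 0")
      case True
      have "\<P>(\<omega> in M. q (X n \<omega>) (X (Suc n) \<omega>) = 0 \<and> (\<lambda>k\<in>{..Suc n}. X k \<omega>) = x) \<le>
          \<P>(\<omega> in M. \<forall>k\<le>Suc n. X k \<omega> = x k)"
        by (rule finite_measure_mono) (auto simp: fun_eq_iff)
      also have "\<dots> = 0"
        by (subst path_probability) (use x True in \<open>auto simp: PiE_iff\<close>)
      finally show ?thesis by (simp add: measure_le_0_iff)
    next
      case False
      then have "{\<omega>\<in>space M. q (X n \<omega>) (X (Suc n) \<omega>) = 0 \<and> (\<lambda>k\<in>{..Suc n}. X k \<omega>) = x} = {}" by auto
      then show ?thesis by (simp only: measure_empty mult_zero_left)
    qed
  qed auto
  then show "AE \<omega> in M. q (X n \<omega>) (X (Suc n) \<omega>) \<noteq> 0"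
    by (subst (asm) mult_zero_left, subst (asm) prob_Collect_eq_0) auto
qed

lemma translates_Nil: "translates [] S"
  by (simp add: translates_def)

end

lemma nstep_nonneg:
  assumes "\<And>x y. x \<in> S \<Longrightarrow> y \<in> S \<Longrightarrow> 0 \<le> q x y" "x \<in> S"
  shows "0 \<le> nstep S q n x y"
  using assms by (induction n arbitrary: x) (auto intro!: infsum_nonneg mult_nonneg_nonneg)

lemma nstep_pos_path:
  assumes q: "\<And>x y. x \<in> S \<Longrightarrow> y \<in> S \<Longrightarrow> 0 \<le> q x y" and x: "x \<in> S" and pos: "0 < nstep S q n x y"
  shows "\<exists>z. z 0 = x \<and> z n = y \<and> (\<forall>k\<le>n. z k \<in> S) \<and> (\<forall>k<n. 0 < q (z k) (z (Suc k)))"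
  using x pos
proof (induction n arbitrary: x)
  case 0
  then show ?case by (intro exI[of _ "\<lambda>_. x"]) (auto split: if_splits)
next
  case (Suc n)
  have "\<exists>w\<in>S. q x w * nstep S q n w y \<noteq> 0"
  proof (rule ccontr)
    assume "\<not> ?thesis"
    then have "nstep S q (Suc n) x y = 0" by (simp add: infsum_0)
    then show False using Suc.prems by simp
  qed
  then obtain w where w: "w \<in> S" "q x w \<noteq> 0" "nstep S q n w y \<noteq> 0" by auto
  then have "0 < q x w" "0 < nstep S q n w y"
    using q[OF Suc.prems(1) w(1)] nstep_nonneg[where q = q and n = n and y = y, OF q w(1)] by (auto simp: less_le)
  with Suc.IH[OF w(1)] obtain z where z: "z 0 = w" "z n = y" "\<forall>k\<le>n. z k \<in> S" "\<forall>k<n. 0 < q (z k) (z (Suc k))"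
    by blast
  show ?case
    by (rule exI[of _ "case_nat x z"])
       (use z Suc.prems \<open>0 < q x w\<close> in \<open>auto split: nat.splits\<close>)
qed

text \<open>The hypotheses on the two factors and on the walk that describe its transition probabilities.
  The transience of the walk enters separately, as summability of the return probabilities.\<close>
locale free_product_walk =
  fixes V :: "nat \<Rightarrow> 'a set" and rt :: "nat \<Rightarrow> 'a"
    and p :: "nat \<Rightarrow> 'a \<Rightarrow> 'a \<Rightarrow> real" and \<alpha> :: real
    and M :: "'w measure" and X :: "nat \<Rightarrow> 'w \<Rightarrow> 'a list"
  assumes factors: "\<forall>i\<in>{1, 2}. rooted_factor (V i) (rt i) (p i)"
    and disjoint: "V 1 \<inter> V 2 = {}"
    and alpha: "0 < \<alpha>" "\<alpha> < 1"
    and walk: "markov_chain M (free_product V rt) (walk_matrix V rt p \<alpha>) [] X"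
begin

abbreviation "S \<equiv> free_product V rt"
abbreviation "q \<equiv> walk_matrix V rt p \<alpha>"
abbreviation "L i \<equiv> nonroots V rt i"
abbreviation "typ i w \<equiv> has_type V rt w i"

lemma factor:
  assumes "i \<in> {1, 2}"
  shows "countable (V i)" "rt i \<in> V i" "\<And>x. x \<in> V i \<Longrightarrow> p i x x = 0"
    "\<And>x y. x \<in> V i \<Longrightarrow> y \<in> V i \<Longrightarrow> 0 \<le> p i x y" "\<And>x. x \<in> V i \<Longrightarrow> (p i x has_sum 1) (V i)"
    "\<And>x. x \<in> V i \<Longrightarrow> \<exists>n\<ge>1. 0 < nstep (V i) (p i) n (rt i) x"
  using factors assms unfolding rooted_factor_def transition_matrix_def by blast+

lemma letters_disjoint: "x \<in> L 1 \<Longrightarrow> x \<notin> L 2" "x \<in> L 2 \<Longrightarrow> x \<notin> L 1"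
  using disjoint by (auto simp: nonroots_def)

lemma L_V: "x \<in> L i \<Longrightarrow> x \<in> V i" "x \<in> L i \<Longrightarrow> x \<noteq> rt i"
  by (auto simp: nonroots_def)

lemma in_S_iff:
  "w \<in> S \<longleftrightarrow> set w \<subseteq> L 1 \<union> L 2 \<and> successively (\<lambda>a b. \<not> (\<exists>i\<in>{1, 2}. a \<in> L i \<and> b \<in> L i)) w"
  unfolding free_product_def by (simp add: successively_conv_nth)

lemma countable_S: "countable S"
proof (rule countable_subset)
  show "S \<subseteq> lists (L 1 \<union> L 2)" unfolding free_product_def by auto
  have "countable (L i)" if "i \<in> {1, 2}" for i
    using factor(1)[OF that] unfolding nonroots_def by (rule countable_Diff)
  then show "countable (lists (L 1 \<union> L 2))" by (intro countable_lists countable_Un) auto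
qed

sublocale word_chain M S q X
  by unfold_locales (rule walk, rule countable_S)

lemma typ_append: "v \<noteq> [] \<Longrightarrow> typ i (u @ v) = typ i v"
  by (simp add: has_type_def)

lemma typ_Nil: "\<not> typ i []"
  by (simp add: has_type_def)

sublocale typed_words "\<lambda>w. typ 1 w"
  by unfold_locales (simp_all add: typ_append typ_Nil)

lemma typ_cases: "w \<in> S \<Longrightarrow> w = [] \<or> typ 1 w \<or> typ 2 w"
  unfolding has_type_def in_S_iff using last_in_set by blast

lemma typ_disjoint: "typ 1 w \<Longrightarrow> \<not> typ 2 w"
  using letters_disjoint by (auto simp: has_type_def)

lemma append_in_S_D: "u @ x \<in> S \<Longrightarrow> u \<in> S \<and> x \<in> S"
  unfolding in_S_iff by (auto simp: successively_append_iff)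

lemma drop_in_S: "w \<in> S \<Longrightarrow> drop n w \<in> S"
  using append_in_S_D[of "take n w" "drop n w"] by simp

text \<open>The words that may follow a word of type i; after removal of the prefix u, the cone of a word u
  of type i becomes \<open>A i\<close>.\<close>
definition A :: "nat \<Rightarrow> 'a list set" where
  "A i = {x \<in> S. x = [] \<or> hd x \<notin> L i}"

lemma append_in_S_iff:
  assumes u: "u \<in> S" and t: "typ i u" and i: "i \<in> {1, 2}"
  shows "u @ x \<in> S \<longleftrightarrow> x \<in> A i"
proof (cases "x = []")
  case False
  have l: "last u \<in> L i" "u \<noteq> []" using t by (auto simp: has_type_def)
  have "(\<exists>k\<in>{1, 2}. last u \<in> L k \<and> hd x \<in> L k) \<longleftrightarrow> hd x \<in> L i"
    using l i letters_disjoint by auto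
  then show ?thesis
    using u l False unfolding A_def in_S_iff by (auto simp: successively_append_iff)
qed (use u in \<open>auto simp: A_def in_S_iff\<close>)

lemma Nil_in_A: "[] \<in> A i" using Nil_in_S by (simp add: A_def)

lemma A_subset_S: "A i \<subseteq> S" by (auto simp: A_def)

lemma lifted_step:
  assumes "lifted_matrix V rt p i x y \<noteq> 0" and i: "i \<in> {1, 2}"
  shows "\<exists>u v w. same_copy V rt i x y u v w \<and> v \<noteq> w \<and> lifted_matrix V rt p i x y = p i v w"
proof -
  have "\<exists>u v w. same_copy V rt i x y u v w"
    using assms(1) unfolding lifted_matrix_def by (auto split: if_splits)
  then obtain u v w where c: "same_copy V rt i x y u v w" by blast
  then have "lifted_matrix V rt p i x y = p i v w"
    unfolding same_copy_def using lifted_matrix_eq[of u V rt i v w p] by simp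
  with c assms(1) factor(3)[OF i] show ?thesis unfolding same_copy_def by metis
qed

lemma lifted_same_copy: "same_copy V rt i x y u v w \<Longrightarrow> lifted_matrix V rt p i x y = p i v w"
  unfolding same_copy_def using lifted_matrix_eq[of u V rt i v w p] by simp

lemma lifted_nonneg: "i \<in> {1, 2} \<Longrightarrow> 0 \<le> lifted_matrix V rt p i x y"
  using lifted_step[of i x y] factor(4)[of i]
  by (cases "lifted_matrix V rt p i x y = 0") (auto simp: same_copy_def)

lemma step_copy:
  assumes "q x y \<noteq> 0"
  shows "\<exists>i\<in>{1, 2}. \<exists>u v w. same_copy V rt i x y u v w \<and> v \<noteq> w"
  using assms lifted_step[of 1 x y] lifted_step[of 2 x y] unfolding walk_matrix_def by fastforce

text \<open>A copy of a factor that contains two different words of the cone of u lies in this cone: its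
  base has u as a prefix. The only other copy through u is the one in which u has its last letter, and
  it meets the cone in u alone.\<close>
lemma lifted_translate:
  assumes u: "u \<in> S" and t: "typ i u" and i: "i \<in> {1, 2}" and j: "j \<in> {1, 2}"
    and a: "a \<in> A i" and b: "b \<in> A i"
  shows "lifted_matrix V rt p j (u @ a) (u @ b) = lifted_matrix V rt p j a b"
proof (cases "lifted_matrix V rt p j a b = 0")
  case False
  then obtain u' v w where c: "same_copy V rt j a b u' v w" and vw: "v \<noteq> w" using lifted_step[OF _ j] by blast
  then have ab: "a = u' @ word_of (rt j) v" "b = u' @ word_of (rt j) w" "v \<in> V j" "w \<in> V j" "\<not> typ j u'" "u' \<in> S"
    by (auto simp: same_copy_def)
  have "u @ a \<in> S" using append_in_S_iff[OF u t i] a by simp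
  then have uS: "u @ u' \<in> S" using ab(1) append_in_S_D[of "u @ u'"] by simp
  have "\<not> typ j (u @ u')"
  proof (cases "u' = []")
    case True
    have "j \<noteq> i"
    proof
      assume "j = i"
      then have "v = rt j \<or> v \<in> L i" "w = rt j \<or> w \<in> L i" using ab by (auto simp: nonroots_def)
      then show False using vw a b ab True \<open>j = i\<close> L_V(2) by (auto simp: A_def word_of_def split: if_splits)
    qed
    then show ?thesis using True t i j typ_disjoint by auto
  qed (use ab typ_append in auto)
  then have "same_copy V rt j (u @ a) (u @ b) (u @ u') v w"
    using ab uS by (simp add: same_copy_def)
  then show ?thesis using lifted_same_copy c by metis
next
  case True
  show ?thesis
  proof (rule ccontr)
    assume "lifted_matrix V rt p j (u @ a) (u @ b) \<noteq> lifted_matrix V rt p j a b"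
    then have nz: "lifted_matrix V rt p j (u @ a) (u @ b) \<noteq> 0" using True by simp
    then obtain u' v w where c: "same_copy V rt j (u @ a) (u @ b) u' v w" and vw: "v \<noteq> w"
      and val: "lifted_matrix V rt p j (u @ a) (u @ b) = p j v w"
      using lifted_step[OF _ j] by blast
    then have ab: "u @ a = u' @ word_of (rt j) v" "u @ b = u' @ word_of (rt j) w" "v \<in> V j" "w \<in> V j"
        "\<not> typ j u'" "u' \<in> S"
      by (auto simp: same_copy_def)
    have "prefix u u'"
    proof (rule ccontr)
      assume np: "\<not> prefix u u'"
      have "u = u' @ word_of (rt j) z" if "u @ x = u' @ word_of (rt j) z" for x z
      proof (cases "z = rt j")
        case False
        then have "prefix u (u' @ [z])" using that by (metis prefixI word_of_def)
        then show ?thesis using np False by (simp add: word_of_def)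
      next
        case True
        then have "prefix u u'" using that by (metis append_Nil2 prefixI word_of_def)
        then show ?thesis using np by simp
      qed
      from this[OF ab(1)] this[OF ab(2)] have "word_of (rt j) v = word_of (rt j) w" by simp
      then show False using vw by (auto simp: word_of_def split: if_splits)
    qed
    then obtain u2 where u2: "u' = u @ u2" by (auto simp: prefix_def)
    then have "a = u2 @ word_of (rt j) v" "b = u2 @ word_of (rt j) w" using ab by auto
    moreover have "\<not> typ j u2" using ab(5) u2 typ_append[where v = u2 and i = j and u = u] typ_Nil by auto
    moreover have "u2 \<in> S" using ab(6) u2 append_in_S_D by blast
    ultimately have "same_copy V rt j a b u2 v w" using ab by (simp add: same_copy_def)
    then show False using lifted_same_copy True val nz by metis
  qed
qed

lemma translates_A:
  assumes u: "u \<in> S" and t: "typ i u" and i: "i \<in> {1, 2}"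
  shows "translates u (A i)"
proof -
  have tr: "q (u @ a) (u @ b) = q a b" if "a \<in> A i" "b \<in> A i" for a b
    using that by (simp add: walk_matrix_def lifted_translate[OF u t i])
  show ?thesis
    unfolding translates_def
  proof (intro conjI ballI A_subset_S)
    show "u @ b \<in> S" if "b \<in> A i" for b using that append_in_S_iff[OF u t i] by simp
    show "q (u @ a) (u @ b) = q a b" if "a \<in> insert [] (A i)" "b \<in> A i" for a b
      using tr[of a b] that Nil_in_A by blast
  qed
qed

definition letters :: "nat \<Rightarrow> 'a list set" where "letters i = (\<lambda>v. [v]) ` L i"

lemma letters_in_A: "i \<in> {1, 2} \<Longrightarrow> j \<in> {1, 2} \<Longrightarrow> i \<noteq> j \<Longrightarrow> letters i \<subseteq> A j"
  using letters_disjoint unfolding letters_def A_def in_S_iff by auto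

lemma translates_letters:
  assumes u: "u \<in> S" and t: "\<not> typ i u" and i: "i \<in> {1, 2}"
  shows "translates u (letters i)"
proof -
  have "letters i \<subseteq> S" using i by (auto simp: letters_def in_S_iff)
  then have *: "translates [] (letters i)" by (rule translates_mono[OF translates_Nil])
  consider "u = []" | "i = 1" "typ 2 u" | "i = 2" "typ 1 u" using typ_cases[OF u] t i by blast
  then show ?thesis
    using * translates_mono[OF translates_A[OF u]] letters_in_A[of 1 2] letters_in_A[of 2 1] by cases auto
qed

lemma step_enters_cone_at_apex:
  assumes "q x y \<noteq> 0" "prefix z y" "\<not> prefix z x"
  shows "y = z"
proof -
  obtain i u v w where "same_copy V rt i x y u v w" using step_copy[OF assms(1)] by blast
  then have xy: "x = u @ word_of (rt i) v" "y = u @ word_of (rt i) w" by (auto simp: same_copy_def)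
  have "\<not> prefix z u" using assms(3) xy by (auto simp: prefix_def)
  then show ?thesis using assms(2) xy by (auto simp: word_of_def split: if_splits)
qed

lemma step_keeps_first_factor:
  assumes "q x y \<noteq> 0" "x \<noteq> []" "y \<noteq> []" "i \<in> {1, 2}" "hd x \<in> L i"
  shows "hd y \<in> L i"
proof -
  obtain j u v w where j: "j \<in> {1, 2}" and "same_copy V rt j x y u v w" using step_copy[OF assms(1)] by blast
  then have xy: "x = u @ word_of (rt j) v" "y = u @ word_of (rt j) w" "v \<in> V j" "w \<in> V j"
    by (auto simp: same_copy_def)
  show ?thesis
  proof (cases "u = []")
    case True
    then have "v \<in> L j" "w \<in> L j" "hd x = v" "hd y = w"
      using xy assms by (auto simp: word_of_def nonroots_def split: if_splits)
    moreover have "i = j" using calculation assms j letters_disjoint by auto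
    ultimately show ?thesis by simp
  qed (use assms xy in auto)
qed

text \<open>From the root, the probabilities of a first step in factor i, of never making a step in factor
  i at the root (so that the walk stays in \<open>A i\<close>), and of doing so without returning to the root.\<close>
definition letter_prob :: "nat \<Rightarrow> real" where "letter_prob i = \<P>(\<omega> in M. X 1 \<omega> \<in> letters i)"
definition stay_prob :: "nat \<Rightarrow> real" where "stay_prob i = \<P>(\<omega> in M. \<forall>s\<ge>1. X s \<omega> \<in> A i)"
definition escape_prob :: "nat \<Rightarrow> real" where "escape_prob i = \<P>(\<omega> in M. \<forall>s\<ge>1. X s \<omega> \<in> A i - {[]})"

lemma letter_step_pos:
  assumes i: "i \<in> {1, 2}"
  shows "\<exists>v\<in>L i. 0 < p i (rt i) v"
proof (rule ccontr)
  assume "\<not> ?thesis"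
  then have "p i (rt i) v = 0" if "v \<in> V i" for v
    using factor(3,4)[OF i] factor(2)[OF i] that by (cases "v = rt i") (force simp: nonroots_def)+
  then have "(p i (rt i) has_sum 0) (V i)" by (intro has_sum_0) auto
  then show False using factor(5)[OF i factor(2)[OF i]] has_sum_unique by fastforce
qed

lemma q_pos:
  assumes i: "i \<in> {1, 2}" and c: "same_copy V rt i x y u v w" and pos: "0 < p i v w"
  shows "0 < q x y"
proof -
  have l: "0 < lifted_matrix V rt p i x y" using lifted_same_copy[OF c] pos by simp
  have n: "0 \<le> \<alpha> * lifted_matrix V rt p 1 x y" "0 \<le> (1 - \<alpha>) * lifted_matrix V rt p 2 x y"
    using lifted_nonneg[of 1 x y] lifted_nonneg[of 2 x y] alpha by auto
  consider "i = 1" | "i = 2" using i by blast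
  then show ?thesis
  proof cases
    case 1
    then have "0 < \<alpha> * lifted_matrix V rt p 1 x y" using l alpha by simp
    then show ?thesis using n(2) unfolding walk_matrix_def by (rule add_pos_nonneg)
  next
    case 2
    then have "0 < (1 - \<alpha>) * lifted_matrix V rt p 2 x y" using l alpha by simp
    with n(1) show ?thesis unfolding walk_matrix_def by (rule add_nonneg_pos)
  qed
qed

lemma letter_copy:
  assumes "u \<in> S" "\<not> typ i u" "i \<in> {1, 2}" "v \<in> L i"
  shows "same_copy V rt i u (u @ [v]) u (rt i) v"
  using assms factor(2)[of i] L_V by (auto simp: same_copy_def word_of_def)

lemma single_letter_prob_pos:
  assumes i: "i \<in> {1, 2}"
  shows "\<exists>v\<in>L i. 0 < \<P>(\<omega> in M. X 1 \<omega> = [v])"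
proof -
  obtain v where v: "v \<in> L i" "0 < p i (rt i) v" using letter_step_pos[OF i] by blast
  have vS: "[v] \<in> S" using v i by (auto simp: in_S_iff)
  define x where "x k = (if k = 0 then [] else [v])" for k :: nat
  have "0 < q [] [v]"
    using q_pos[OF i letter_copy[OF Nil_in_S typ_Nil i v(1)] v(2)] by simp
  also have "\<dots> = \<P>(\<omega> in M. \<forall>k\<le>1. X k \<omega> = x k)"
    by (subst path_probability) (use vS Nil_in_S in \<open>auto simp: x_def\<close>)
  also have "\<dots> \<le> \<P>(\<omega> in M. X 1 \<omega> = [v])"
    by (rule finite_measure_mono) (auto simp: x_def)
  finally show ?thesis using v(1) by blast
qed

lemma letter_prob_pos:
  assumes i: "i \<in> {1, 2}"
  shows "0 < letter_prob i"
proof -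
  obtain v where v: "v \<in> L i" "0 < \<P>(\<omega> in M. X 1 \<omega> = [v])" using single_letter_prob_pos[OF i] by blast
  note v(2)
  also have "\<P>(\<omega> in M. X 1 \<omega> = [v]) \<le> letter_prob i"
    unfolding letter_prob_def by (rule finite_measure_mono) (use v in \<open>auto simp: letters_def\<close>)
  finally show ?thesis .
qed

lemma letter_prob_le_1: "letter_prob i \<le> 1" and stay_prob_le_1: "stay_prob i \<le> 1" and escape_prob_le_1: "escape_prob i \<le> 1"
  by (simp_all add: letter_prob_def stay_prob_def escape_prob_def)

lemma escape_prob_le_stay_prob: "escape_prob i \<le> stay_prob i"
  unfolding escape_prob_def stay_prob_def by (rule finite_measure_mono) auto

lemma append_letter_prob:
  assumes P: "adapted n P" and i: "i \<in> {1, 2}" and t: "\<And>y. P y \<Longrightarrow> \<not> typ i (y n)"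
  shows "\<P>(\<omega> in M. P (traj \<omega>) \<and> (\<exists>v\<in>L i. X (Suc n) \<omega> = X n \<omega> @ [v])) = \<P>(\<omega> in M. P (traj \<omega>)) * letter_prob i"
proof -
  have "\<P>(\<omega> in M. P (traj \<omega>) \<and> (\<forall>s\<in>{1..1}. \<exists>b\<in>letters i. X (n + s) \<omega> = X n \<omega> @ b) \<and> True) =
    \<P>(\<omega> in M. P (traj \<omega>)) * \<P>(\<omega> in M. (\<forall>s\<in>{1..1}. X s \<omega> \<in> letters i) \<and> True)"
    by (rule markov_property_translated[where Q = "\<lambda>_. True"])
       (use P adapted_const translates_letters[OF _ _ i] t in auto)
  then show ?thesis by (simp add: letter_prob_def letters_def)
qed

text \<open>A first step to a letter v of factor i followed by a walk that stays in the cone of v is an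
  escape that avoids factor j.\<close>
lemma escape_prob_lower:
  assumes i: "i \<in> {1, 2}" and j: "j \<in> {1, 2}" and ij: "i \<noteq> j"
  shows "letter_prob i * stay_prob i \<le> escape_prob j"
proof -
  have "\<P>(\<omega> in M. X 1 \<omega> \<in> letters i \<and> (\<forall>s\<ge>1. \<exists>b\<in>A i. X (1 + s) \<omega> = X 1 \<omega> @ b)) =
     \<P>(\<omega> in M. X 1 \<omega> \<in> letters i) * \<P>(\<omega> in M. \<forall>s\<ge>1. X s \<omega> \<in> A i)"
  proof (rule markov_property_forever[where P = "\<lambda>y. y 1 \<in> letters i"])
    show "adapted 1 (\<lambda>y. y 1 \<in> letters i)" by (simp add: adapted_def)
    show "translates (x 1) (A i)" if "x 1 \<in> letters i" "\<And>k. k \<le> 1 \<Longrightarrow> x k \<in> S" for x :: "nat \<Rightarrow> 'a list"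
    proof (rule translates_A[OF _ _ i])
      show "x 1 \<in> S" by (rule that(2)) simp
      show "typ i (x 1)" using that(1) by (auto simp: letters_def has_type_def)
    qed
  qed
  then have "letter_prob i * stay_prob i = \<P>(\<omega> in M. X 1 \<omega> \<in> letters i \<and> (\<forall>s\<ge>1. \<exists>b\<in>A i. X (1 + s) \<omega> = X 1 \<omega> @ b))"
    by (simp add: letter_prob_def stay_prob_def)
  also have "\<dots> \<le> escape_prob j"
    unfolding escape_prob_def
  proof (rule finite_measure_mono, safe)
    fix \<omega> and s :: nat assume \<omega>: "\<omega> \<in> space M" and 1: "X 1 \<omega> \<in> letters i"
      and st: "\<forall>s\<ge>1. \<exists>b\<in>A i. X (1 + s) \<omega> = X 1 \<omega> @ b" and s: "1 \<le> s"
    obtain v where v: "v \<in> L i" "X 1 \<omega> = [v]" using 1 by (auto simp: letters_def)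
    have *: "X s \<omega> \<noteq> [] \<and> hd (X s \<omega>) = v"
    proof (cases "s = 1")
      case False
      then have "1 \<le> s - 1" using s by simp
      then obtain a where "X (1 + (s - 1)) \<omega> = X 1 \<omega> @ a" using st by blast
      then show ?thesis using s v by simp
    qed (use v in auto)
    have "v \<notin> L j" using v i j ij letters_disjoint by auto
    then show "X s \<omega> \<in> A j" using * X_in_S[OF \<omega>] by (simp add: A_def)
    show "X s \<omega> = [] \<Longrightarrow> False" using * by simp
  qed measurable
  finally show ?thesis .
qed

text \<open>To change the factor of its first letter, the walk has to pass through the root.\<close>
lemma no_return_le: "\<P>(\<omega> in M. \<forall>s\<ge>1. X s \<omega> \<noteq> []) \<le> escape_prob 1 + escape_prob 2"
proof -
  let ?E = "\<lambda>i. {\<omega>\<in>space M. \<forall>s\<ge>1. X s \<omega> \<in> A i - {[]}}"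
  have "\<P>(\<omega> in M. \<forall>s\<ge>1. X s \<omega> \<noteq> []) \<le> prob (?E 1 \<union> ?E 2)"
  proof (rule finite_measure_mono_AE)
    show "AE \<omega> in M. \<omega> \<in> {\<omega>\<in>space M. \<forall>s\<ge>1. X s \<omega> \<noteq> []} \<longrightarrow> \<omega> \<in> ?E 1 \<union> ?E 2"
      using AE_steps_nonzero
    proof eventually_elim
      case (elim \<omega>)
      show ?case
      proof
        assume "\<omega> \<in> {\<omega>\<in>space M. \<forall>s\<ge>1. X s \<omega> \<noteq> []}"
        then have \<omega>: "\<omega> \<in> space M" and ne: "\<And>s. 1 \<le> s \<Longrightarrow> X s \<omega> \<noteq> []" by auto
        have "hd (X 1 \<omega>) \<in> L 1 \<union> L 2"
          using X_in_S[OF \<omega>, of 1] ne[of 1] by (auto simp: in_S_iff dest: hd_in_set)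
        then obtain i where i: "i \<in> {1, 2}" "hd (X 1 \<omega>) \<in> L i" by blast
        have hd: "hd (X s \<omega>) \<in> L i" if "1 \<le> s" for s
          using that
        proof (induction s rule: nat_induct_at_least)
          case base
          show ?case by (rule i(2))
        next
          case (Suc s)
          then show ?case using step_keeps_first_factor[of "X s \<omega>" "X (Suc s) \<omega>" i] elim ne i by simp
        qed
        have "X s \<omega> \<in> A (3 - i) - {[]}" if "1 \<le> s" for s
          using hd[OF that] ne[OF that] X_in_S[OF \<omega>, of s] i(1) letters_disjoint unfolding A_def by auto
        then show "\<omega> \<in> ?E 1 \<union> ?E 2" using i(1) \<omega> by auto
      qed
    qed
  qed measurable
  also have "\<dots> \<le> prob (?E 1) + prob (?E 2)" by (rule measure_Un_le) measurable
  finally show ?thesis by (simp add: escape_prob_def)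
qed

text \<open>If the walk returned to the root almost surely, it would do so infinitely often, against the
  Borel-Cantelli lemma.\<close>
lemma no_return_pos:
  assumes sum: "summable (\<lambda>n. \<P>(\<omega> in M. X n \<omega> = []))"
  shows "0 < \<P>(\<omega> in M. \<forall>s\<ge>1. X s \<omega> \<noteq> [])"
proof (rule ccontr)
  assume "\<not> ?thesis"
  then have zero: "\<P>(\<omega> in M. \<forall>s\<ge>1. X s \<omega> \<noteq> []) = 0" by (simp add: zero_less_measure_iff)
  have "AE \<omega> in M. \<forall>k. \<not> (X k \<omega> = [] \<and> (\<forall>s\<ge>1. \<exists>b\<in>S - {[]}. X (k + s) \<omega> = X k \<omega> @ b))"
    unfolding AE_all_countable
  proof
    fix k
    have "\<P>(\<omega> in M. X k \<omega> = [] \<and> (\<forall>s\<ge>1. \<exists>b\<in>S - {[]}. X (k + s) \<omega> = X k \<omega> @ b)) =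
      \<P>(\<omega> in M. X k \<omega> = []) * \<P>(\<omega> in M. \<forall>s\<ge>1. X s \<omega> \<in> S - {[]})"
      by (rule markov_property_forever[where P = "\<lambda>y. y k = []"])
         (auto simp: adapted_def intro: translates_mono[OF translates_Nil])
    also have "\<P>(\<omega> in M. \<forall>s\<ge>1. X s \<omega> \<in> S - {[]}) = 0"
      unfolding zero[symmetric] by (intro arg_cong[where f=prob]) (auto simp: X_in_S)
    finally have "\<P>(\<omega> in M. X k \<omega> = [] \<and> (\<forall>s\<ge>1. \<exists>b\<in>S - {[]}. X (k + s) \<omega> = X k \<omega> @ b)) = 0" by simp
    then show "AE \<omega> in M. \<not> (X k \<omega> = [] \<and> (\<forall>s\<ge>1. \<exists>b\<in>S - {[]}. X (k + s) \<omega> = X k \<omega> @ b))"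
      by (subst (asm) prob_Collect_eq_0) (auto, measurable)
  qed
  moreover have "AE \<omega> in M. eventually (\<lambda>n. \<omega> \<in> space M - {\<omega>\<in>space M. X n \<omega> = []}) sequentially"
    by (rule borel_cantelli_AE1) (use sum in \<open>auto simp: emeasure_eq_measure\<close>)
  ultimately have "AE \<omega> in M. False"
    using X_0 AE_space
  proof eventually_elim
    case (elim \<omega>)
    from elim(2) have "eventually (\<lambda>n. X n \<omega> \<noteq> []) sequentially"
      by (rule eventually_mono) (use elim(4) in auto)
    then obtain l where l: "\<And>n. l \<le> n \<Longrightarrow> X n \<omega> \<noteq> []" by (auto simp: eventually_sequentially)
    let ?K = "{k. X k \<omega> = []}"
    have fin: "finite ?K" by (rule finite_subset[of _ "{..<l}"]) (use l in \<open>auto simp: not_le[symmetric]\<close>)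
    have "0 \<in> ?K" using elim(3) by simp
    then have m: "Max ?K \<in> ?K" using fin by (intro Max_in) auto
    have "X (Max ?K + s) \<omega> \<noteq> []" if "1 \<le> s" for s
      using Max_ge[OF fin, of "Max ?K + s"] that by auto
    then show ?case using elim(1) m X_in_S[OF elim(4)] by force
  qed
  then show False by simp
qed

lemma escape_prob_pos:
  assumes sum: "summable (\<lambda>n. \<P>(\<omega> in M. X n \<omega> = []))" and i: "i \<in> {1, 2}"
  shows "0 < escape_prob i"
proof -
  have other: "0 < escape_prob k" if "0 < escape_prob j" "j \<in> {1, 2}" "k \<in> {1, 2}" "j \<noteq> k" for j k
  proof -
    have "0 < letter_prob j * stay_prob j" using letter_prob_pos[OF that(2)] escape_prob_le_stay_prob[of j] that(1) by simp
    also have "\<dots> \<le> escape_prob k" by (rule escape_prob_lower[OF that(2-4)])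
    finally show ?thesis .
  qed
  have "0 < escape_prob 1 + escape_prob 2" using no_return_pos[OF sum] no_return_le by linarith
  then have "0 < escape_prob 1 \<or> 0 < escape_prob 2" by linarith
  then show ?thesis using other[of 1 2] other[of 2 1] i by auto
qed

section \<open>Linear growth of the number of fresh words\<close>

definition stay :: "nat \<Rightarrow> (nat \<Rightarrow> 'a list) \<Rightarrow> bool" where
  "stay k y \<longleftrightarrow> (\<forall>s\<ge>1. \<exists>a\<in>A 1. y (k + s) = y k @ a)"

lemma pred_stay[measurable]: "Measurable.pred M (\<lambda>\<omega>. stay k (traj \<omega>))"
  unfolding stay_def by measurable

lemma stay_iff:
  assumes "\<And>k. y k \<in> S" "typ 1 (y k)"
  shows "stay k y \<longleftrightarrow> (\<forall>s\<ge>k. prefix (y k) (y s))"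
proof
  assume s: "stay k y"
  show "\<forall>s\<ge>k. prefix (y k) (y s)"
  proof safe
    fix s assume "k \<le> s"
    show "prefix (y k) (y s)"
    proof (cases "s = k")
      case False
      with \<open>k \<le> s\<close> have "1 \<le> s - k" by simp
      then obtain a where "y (k + (s - k)) = y k @ a" using s unfolding stay_def by blast
      then show ?thesis using \<open>k \<le> s\<close> by simp
    qed simp
  qed
next
  assume p: "\<forall>s\<ge>k. prefix (y k) (y s)"
  show "stay k y"
    unfolding stay_def
  proof safe
    fix s :: nat
    from p have "prefix (y k) (y (k + s))" by simp
    then obtain a where a: "y (k + s) = y k @ a" by (auto simp: prefix_def)
    have "a \<in> A 1"
      using append_in_S_iff[where u = "y k" and x = a and i = 1] assms(1)[of k] assms(1)[of "k + s"] assms(2) a by simp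
    with a show "\<exists>a\<in>A 1. y (k + s) = y k @ a" by blast
  qed
qed

lemma prob_stay:
  assumes P: "adapted n P" and t: "\<And>y. P y \<Longrightarrow> typ 1 (y n)"
  shows "\<P>(\<omega> in M. P (traj \<omega>) \<and> stay n (traj \<omega>)) = \<P>(\<omega> in M. P (traj \<omega>)) * stay_prob 1"
  unfolding stay_def stay_prob_def
  by (rule markov_property_forever[OF P]) (use t translates_A in auto)

definition inside :: "nat \<Rightarrow> (nat \<Rightarrow> 'a list) \<Rightarrow> bool" where
  "inside n y \<longleftrightarrow> (\<forall>k\<in>{1..n}. y k \<in> A 1)"

lemma adapted_inside: "adapted n (inside n)"
  by (auto simp: adapted_def inside_def)

text \<open>As long as the walk avoids factor 1 at the root, it reaches a word of type 1 within two
  steps with a probability bounded below: in one step from a word of type 2, and from the root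
  through a letter of factor 2.\<close>
lemma prob_inside_typ1:
  "letter_prob 1 * letter_prob 2 * stay_prob 1 \<le> \<P>(\<omega> in M. inside k (traj \<omega>) \<and> typ 1 (X k \<omega>)) +
     \<P>(\<omega> in M. inside (Suc k) (traj \<omega>) \<and> typ 1 (X (Suc k) \<omega>)) +
     \<P>(\<omega> in M. inside (Suc (Suc k)) (traj \<omega>) \<and> typ 1 (X (Suc (Suc k)) \<omega>))"
proof -
  let ?a = "\<lambda>k i. \<P>(\<omega> in M. inside k (traj \<omega>) \<and> typ i (X k \<omega>))"
  let ?e = "\<P>(\<omega> in M. inside k (traj \<omega>) \<and> X k \<omega> = [])"
  note [measurable] = pred_X[OF adapted_inside]
  have grow: "\<P>(\<omega> in M. inside k (traj \<omega>) \<and> B (X k \<omega>)) * letter_prob i \<le> ?a (Suc k) i"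
    if i: "i \<in> {1, 2}" and B: "\<And>w. B w \<Longrightarrow> \<not> typ i w" "\<And>w. i = 2 \<Longrightarrow> B w \<Longrightarrow> w = []"
      "\<And>w. i = 1 \<Longrightarrow> B w \<Longrightarrow> w \<noteq> []" for k i B
  proof -
    have ad: "adapted k (\<lambda>y. inside k y \<and> B (y k))"
      by (intro adapted_conj adapted_inside) (auto simp: adapted_def)
    have "\<P>(\<omega> in M. inside k (traj \<omega>) \<and> B (X k \<omega>)) * letter_prob i =
      \<P>(\<omega> in M. (inside k (traj \<omega>) \<and> B (X k \<omega>)) \<and> (\<exists>v\<in>L i. X (Suc k) \<omega> = X k \<omega> @ [v]))"
      by (rule append_letter_prob[OF ad i, symmetric]) (use B in auto)
    also have "\<dots> \<le> ?a (Suc k) i"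
    proof (rule finite_measure_mono_AE)
      show "AE \<omega> in M. \<omega> \<in> {\<omega>\<in>space M. (inside k (traj \<omega>) \<and> B (X k \<omega>)) \<and> (\<exists>v\<in>L i. X (Suc k) \<omega> = X k \<omega> @ [v])}
        \<longrightarrow> \<omega> \<in> {\<omega>\<in>space M. inside (Suc k) (traj \<omega>) \<and> typ i (X (Suc k) \<omega>)}"
        using X_0
      proof eventually_elim
        case (elim \<omega>)
        show ?case
        proof safe
          fix v assume \<omega>: "\<omega> \<in> space M" and ins: "inside k (traj \<omega>)" and Bk: "B (X k \<omega>)"
            and v: "v \<in> L i" "X (Suc k) \<omega> = X k \<omega> @ [v]"
          show "typ i (X (Suc k) \<omega>)" using v by (simp add: has_type_def)
          have "X (Suc k) \<omega> \<in> A 1"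
          proof (cases "X k \<omega> = []")
            case True
            then have "i = 2" using B(3)[of "X k \<omega>"] Bk i by auto
            then show ?thesis using True v X_in_S[OF \<omega>, of "Suc k"] letters_disjoint by (auto simp: A_def)
          next
            case False
            then have "k \<noteq> 0" using elim by (intro notI) simp
            then have "X k \<omega> \<in> A 1" using ins by (simp add: inside_def)
            then show ?thesis using False v X_in_S[OF \<omega>, of "Suc k"] by (auto simp: A_def)
          qed
          with ins show "inside (Suc k) (traj \<omega>)" by (auto simp: inside_def le_Suc_eq)
        qed
      qed
    qed measurable
    finally show ?thesis .
  qed
  have e2: "?e * letter_prob 2 \<le> ?a (Suc k) 2"
    by (rule grow[of 2 "\<lambda>w. w = []"]) (auto simp: typ_Nil)
  have 21: "?a l 2 * letter_prob 1 \<le> ?a (Suc l) 1" for l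
    by (rule grow[of 1 "\<lambda>w. typ 2 w"]) (use typ_disjoint typ_Nil in auto)
  have "stay_prob 1 \<le> \<P>(\<omega> in M. inside k (traj \<omega>))"
    unfolding stay_prob_def by (rule finite_measure_mono) (auto simp: inside_def)
  also have "\<dots> \<le> prob ({\<omega>\<in>space M. inside k (traj \<omega>) \<and> X k \<omega> = []} \<union>
      ({\<omega>\<in>space M. inside k (traj \<omega>) \<and> typ 1 (X k \<omega>)} \<union> {\<omega>\<in>space M. inside k (traj \<omega>) \<and> typ 2 (X k \<omega>)}))"
    by (rule finite_measure_mono) (use typ_cases X_in_S in auto)
  also have "\<dots> \<le> ?e + prob ({\<omega>\<in>space M. inside k (traj \<omega>) \<and> typ 1 (X k \<omega>)} \<union> {\<omega>\<in>space M. inside k (traj \<omega>) \<and> typ 2 (X k \<omega>)})"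
    by (rule measure_Un_le) measurable
  also have "prob ({\<omega>\<in>space M. inside k (traj \<omega>) \<and> typ 1 (X k \<omega>)} \<union> {\<omega>\<in>space M. inside k (traj \<omega>) \<and> typ 2 (X k \<omega>)})
      \<le> ?a k 1 + ?a k 2"
    by (rule measure_Un_le) measurable
  finally have h1: "stay_prob 1 \<le> ?e + (?a k 1 + ?a k 2)" by simp
  have bb: "0 < letter_prob 1" "0 < letter_prob 2" "letter_prob 1 \<le> 1" "letter_prob 2 \<le> 1" using letter_prob_pos[of 1] letter_prob_pos[of 2] letter_prob_le_1 by auto
  have "letter_prob 1 * letter_prob 2 * stay_prob 1 \<le> letter_prob 1 * letter_prob 2 * (?e + (?a k 1 + ?a k 2))"
    using h1 bb by (intro mult_left_mono) auto
  also have "\<dots> = letter_prob 1 * (?e * letter_prob 2) + (letter_prob 1 * letter_prob 2) * ?a k 1 + letter_prob 2 * (?a k 2 * letter_prob 1)"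
    by (simp add: algebra_simps)
  also have "\<dots> \<le> ?a (Suc (Suc k)) 1 + ?a k 1 + ?a (Suc k) 1"
  proof (intro add_mono)
    have "letter_prob 1 * (?e * letter_prob 2) \<le> letter_prob 1 * ?a (Suc k) 2" using e2 bb by (intro mult_left_mono) auto
    also have "\<dots> \<le> ?a (Suc (Suc k)) 1" using 21[of "Suc k"] by (simp add: mult.commute)
    finally show "letter_prob 1 * (?e * letter_prob 2) \<le> ?a (Suc (Suc k)) 1" .
    show "(letter_prob 1 * letter_prob 2) * ?a k 1 \<le> ?a k 1" using bb by (intro mult_left_le_one_le mult_le_one) auto
    have "letter_prob 2 * (?a k 2 * letter_prob 1) \<le> ?a k 2 * letter_prob 1" using bb by (intro mult_left_le_one_le) auto
    also have "\<dots> \<le> ?a (Suc k) 1" by (rule 21)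
    finally show "letter_prob 2 * (?a k 2 * letter_prob 1) \<le> ?a (Suc k) 1" .
  qed
  finally show ?thesis by (simp add: add_ac)
qed

end

text \<open>Expected numbers of occurring events are compared through the numbers themselves.\<close>
lemma (in prob_space) sum_prob_le_if_card_le:
  assumes [measurable]: "\<And>k. k \<in> I \<Longrightarrow> Measurable.pred M (A k)" "\<And>k. k \<in> I \<Longrightarrow> Measurable.pred M (B k)"
    and I: "finite I"
    and le: "AE \<omega> in M. card {k\<in>I. A k \<omega>} \<le> card {k\<in>I. B k \<omega>}"
  shows "(\<Sum>k\<in>I. \<P>(\<omega> in M. A k \<omega>)) \<le> (\<Sum>k\<in>I. \<P>(\<omega> in M. B k \<omega>))"
proof -
  have eq: "(\<Sum>k\<in>I. \<P>(\<omega> in M. A k \<omega>)) = expectation (\<lambda>\<omega>. real (card {k\<in>I. A k \<omega>}))"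
    and int: "integrable M (\<lambda>\<omega>. real (card {k\<in>I. A k \<omega>}))"
    if [measurable]: "\<And>k. k \<in> I \<Longrightarrow> Measurable.pred M (A k)" for A :: "'b \<Rightarrow> 'a \<Rightarrow> bool"
  proof -
    have c: "real (card {k\<in>I. A k \<omega>}) = (\<Sum>k\<in>I. indicator {\<omega>\<in>space M. A k \<omega>} \<omega>)" if "\<omega> \<in> space M" for \<omega>
      using that I by (simp add: indicator_def sum.If_cases Int_def)
    have i: "integrable M (\<lambda>\<omega>. \<Sum>k\<in>I. indicator {\<omega>\<in>space M. A k \<omega>} \<omega> :: real)"
      by (intro Bochner_Integration.integrable_sum) (auto simp: emeasure_eq_measure)
    show "integrable M (\<lambda>\<omega>. real (card {k\<in>I. A k \<omega>}))"
      using i by (subst Bochner_Integration.integrable_cong[OF refl c])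
    have "expectation (\<lambda>\<omega>. real (card {k\<in>I. A k \<omega>})) = expectation (\<lambda>\<omega>. \<Sum>k\<in>I. indicator {\<omega>\<in>space M. A k \<omega>} \<omega>)"
      by (rule Bochner_Integration.integral_cong) (auto simp: c)
    also have "\<dots> = (\<Sum>k\<in>I. expectation (indicator {\<omega>\<in>space M. A k \<omega>}))"
      by (rule Bochner_Integration.integral_sum) (auto simp: emeasure_eq_measure)
    finally show "(\<Sum>k\<in>I. \<P>(\<omega> in M. A k \<omega>)) = expectation (\<lambda>\<omega>. real (card {k\<in>I. A k \<omega>}))"
      by simp
  qed
  have "expectation (\<lambda>\<omega>. real (card {k\<in>I. A k \<omega>})) \<le> expectation (\<lambda>\<omega>. real (card {k\<in>I. B k \<omega>}))"
    by (rule integral_mono_AE) (use int[of A, OF assms(1)] int[of B, OF assms(2)] le in auto)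
  then show ?thesis using eq[of A, OF assms(1)] eq[of B, OF assms(2)] by linarith
qed

lemma multi_range_append_close:
  "multi_range r (xs @ ys) \<le> multi_range r ys + length xs"
  "multi_range r ys \<le> multi_range r (xs @ ys) + length xs"
proof -
  let ?A = "{u \<in> set (xs @ ys). visits u (xs @ ys) = r}" and ?B = "{u \<in> set ys. visits u ys = r}"
  have out: "visits u (xs @ ys) = visits u ys" if "u \<notin> set xs" for u
    using that by (simp add: visits_append visits_eq_0_iff[THEN iffD2])
  have "?A \<subseteq> ?B \<union> set xs" "?B \<subseteq> ?A \<union> set xs" using out by auto
  then have "card ?A \<le> card (?B \<union> set xs)" "card ?B \<le> card (?A \<union> set xs)" by (auto intro!: card_mono)
  moreover have "card (C \<union> set xs) \<le> card C + length xs" for C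
    using card_Un_le[of C "set xs"] card_length[of xs] by linarith
  ultimately show "multi_range r (xs @ ys) \<le> multi_range r ys + length xs"
    "multi_range r ys \<le> multi_range r (xs @ ys) + length xs"
    unfolding multi_range_def by (meson order_trans)+
qed

text \<open>The first k positions affect the multiplicity of at most k vertices.\<close>
lemma multi_range_limit_if_shifted:
  assumes sh: "\<And>s. y (k + s) = y k @ shift k y s"
    and lim: "(\<lambda>n. real (multi_range r (map (shift k y) [0..<Suc n])) / real n) \<longlonglongrightarrow> c"
  shows "(\<lambda>n. real (multi_range r (map y [0..<Suc n])) / real n) \<longlonglongrightarrow> c"
proof (rule LIMSEQ_offset[where k = k])
  let ?R = "\<lambda>n. real (multi_range r (map (shift k y) [0..<Suc n]))"
  let ?X = "\<lambda>n. real (multi_range r (map y [0..<Suc (n + k)]))"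
  have close: "\<bar>?X n - ?R n\<bar> \<le> real k" for n
  proof -
    have "[0..<Suc (n + k)] = [0..<k] @ [k..<k + Suc n]"
      using upt_add_eq_append[of 0 k "Suc n"] by (simp add: add.commute)
    moreover have "map y [k..<k + Suc n] = map ((@) (y k)) (map (shift k y) [0..<Suc n])"
      by (rule nth_equalityI) (auto simp: sh simp del: upt_Suc)
    ultimately have X: "map y [0..<Suc (n + k)] = map y [0..<k] @ map ((@) (y k)) (map (shift k y) [0..<Suc n])"
      by (metis map_append)
    have "multi_range r (map ((@) (y k)) (map (shift k y) [0..<Suc n])) = multi_range r (map (shift k y) [0..<Suc n])"
      by (rule multi_range_map_inj) (simp add: inj_on_def)
    then show ?thesis
      using multi_range_append_close[where r = r and xs = "map y [0..<k]" and
          ys = "map ((@) (y k)) (map (shift k y) [0..<Suc n])"]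
      unfolding X by (simp del: map_map upt_Suc)
  qed
  have d: "(\<lambda>n. (?X n - ?R n) / real n) \<longlonglongrightarrow> 0"
  proof (rule Lim_null_comparison)
    show "\<forall>\<^sub>F n in sequentially. norm ((?X n - ?R n) / real n) \<le> real k / real n"
      by (rule always_eventually) (use close in \<open>auto simp del: upt_Suc intro!: divide_right_mono\<close>)
    show "(\<lambda>n. real k / real n) \<longlonglongrightarrow> 0" by real_asymp
  qed
  have "(\<lambda>n. real n / real (n + k)) \<longlonglongrightarrow> 1" by real_asymp
  from tendsto_mult[OF tendsto_add[OF lim d] this]
  have "(\<lambda>n. (?R n / real n + (?X n - ?R n) / real n) * (real n / real (n + k))) \<longlonglongrightarrow> c" by simp
  then show "(\<lambda>n. ?X n / real (n + k)) \<longlonglongrightarrow> c"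
  proof (rule Lim_transform_eventually)
    show "\<forall>\<^sub>F n in sequentially. (?R n / real n + (?X n - ?R n) / real n) * (real n / real (n + k)) = ?X n / real (n + k)"
      using eventually_gt_at_top[of 0]
    proof eventually_elim
      case (elim n)
      have "?R n / real n + (?X n - ?R n) / real n = ?X n / real n"
        by (simp add: add_divide_distrib[symmetric] del: upt_Suc)
      then show ?case using elim by simp
    qed
  qed
qed

context free_product_walk
begin

abbreviation "T \<equiv> \<lambda>w. typ 1 w"

text \<open>The probability of an adapted event P together with the finite part of a regeneration at time
  n. It turns out to be the probability of P and a regeneration at time n for the walk conditioned
  to stay in a cone, seen relative to this cone.\<close>
definition \<phi> :: "nat \<Rightarrow> ((nat \<Rightarrow> 'a list) \<Rightarrow> bool) \<Rightarrow> real" where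
  "\<phi> n P = \<P>(\<omega> in M. inside n (traj \<omega>) \<and> P (traj \<omega>) \<and> fresh T (traj \<omega>) n)"

text \<open>Each word of type 1 that is visited for the last time at some time up to n is also visited for
  the first time at some time up to n, and its cone is then entered for the first time.\<close>
lemma fresh_sum_ge_visits:
  "(\<Sum>k\<le>n. \<P>(\<omega> in M. inside k (traj \<omega>) \<and> typ 1 (X k \<omega>) \<and> (\<forall>s\<ge>1. X (k + s) \<omega> \<noteq> X k \<omega>))) \<le>
   (\<Sum>k\<le>n. \<phi> k (\<lambda>_. True))"
  unfolding \<phi>_def
proof (rule sum_prob_le_if_card_le)
  note [measurable] = pred_X[OF adapted_inside] pred_X[OF adapted_fresh[OF order_refl]]
  show "Measurable.pred M (\<lambda>\<omega>. inside k (traj \<omega>) \<and> typ 1 (X k \<omega>) \<and> (\<forall>s\<ge>1. X (k + s) \<omega> \<noteq> X k \<omega>))" for k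
    by measurable
  show "Measurable.pred M (\<lambda>\<omega>. inside k (traj \<omega>) \<and> True \<and> fresh T (traj \<omega>) k)" for k by measurable
  show "AE \<omega> in M. card {k \<in> {..n}. inside k (traj \<omega>) \<and> typ 1 (X k \<omega>) \<and> (\<forall>s\<ge>1. X (k + s) \<omega> \<noteq> X k \<omega>)}
     \<le> card {k \<in> {..n}. inside k (traj \<omega>) \<and> True \<and> fresh T (traj \<omega>) k}"
    using AE_steps_nonzero X_0
  proof eventually_elim
    case (elim \<omega>)
    let ?y = "\<lambda>k. X k \<omega>"
    define f where "f k = (LEAST j. prefix (?y k) (?y j))" for k
    have f: "prefix (?y k) (?y (f k))" "f k \<le> k" "\<And>j. j < f k \<Longrightarrow> \<not> prefix (?y k) (?y j)" for k
      unfolding f_def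
      using LeastI[of "\<lambda>j. prefix (?y k) (?y j)" k] Least_le[of "\<lambda>j. prefix (?y k) (?y j)" k] not_less_Least by auto
    have yf: "?y (f k) = ?y k" if t: "typ 1 (?y k)" for k
    proof (cases "f k")
      case 0
      then have "?y k = []" using f(1)[of k] elim(2) by simp
      then show ?thesis using t typ_Nil by simp
    next
      case (Suc j)
      then show ?thesis
        using step_enters_cone_at_apex[of "?y j" "?y (f k)" "?y k"] elim(1) f(1)[of k] f(3)[of j k] by simp
    qed
    show ?case
    proof (rule card_inj_on_le[where f = f])
      show "inj_on f {k \<in> {..n}. inside k ?y \<and> typ 1 (?y k) \<and> (\<forall>s\<ge>1. ?y (k + s) \<noteq> ?y k)}"
      proof (rule inj_onI)
        fix k l assume k: "k \<in> {k \<in> {..n}. inside k ?y \<and> typ 1 (?y k) \<and> (\<forall>s\<ge>1. ?y (k + s) \<noteq> ?y k)}"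
          and l: "l \<in> {k \<in> {..n}. inside k ?y \<and> typ 1 (?y k) \<and> (\<forall>s\<ge>1. ?y (k + s) \<noteq> ?y k)}" and fkl: "f k = f l"
        have tk: "typ 1 (?y k)" "\<forall>s\<ge>1. ?y (k + s) \<noteq> ?y k" using k by blast+
        have tl: "typ 1 (?y l)" "\<forall>s\<ge>1. ?y (l + s) \<noteq> ?y l" using l by blast+
        have eq: "?y k = ?y l" using yf[OF tk(1)] yf[OF tl(1)] fkl by metis
        have no: False if "i < j" "?y j = ?y i" "\<forall>s\<ge>1. ?y (i + s) \<noteq> ?y i" for i j
        proof -
          have "1 \<le> j - i" using that(1) by simp
          then have "?y (i + (j - i)) \<noteq> ?y i" using that(3) by blast
          then show False using that(1,2) by simp
        qed
        show "k = l"
        proof (cases k l rule: linorder_cases)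
          case less
          then show ?thesis using no[OF less eq[symmetric] tk(2)] by blast
        next
          case greater
          then show ?thesis using no[OF greater eq tl(2)] by blast
        qed
      qed
      show "f ` {k \<in> {..n}. inside k ?y \<and> typ 1 (?y k) \<and> (\<forall>s\<ge>1. ?y (k + s) \<noteq> ?y k)} \<subseteq>
          {k \<in> {..n}. inside k ?y \<and> True \<and> fresh T ?y k}"
      proof safe
        fix k assume k: "k \<le> n" "inside k ?y" "typ 1 (?y k)"
        show "f k \<le> n" using f(2)[of k] k by simp
        show "inside (f k) ?y" using k f(2)[of k] by (auto simp: inside_def)
        show "fresh T ?y (f k)" using yf[OF k(3)] k(3) f(3)[of _ k] by (simp add: fresh_def)
      qed
    qed simp
  qed
qed simp

lemma visits_prob_ge:
  "\<P>(\<omega> in M. inside k (traj \<omega>) \<and> typ 1 (X k \<omega>)) * escape_prob 1 \<le>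
   \<P>(\<omega> in M. inside k (traj \<omega>) \<and> typ 1 (X k \<omega>) \<and> (\<forall>s\<ge>1. X (k + s) \<omega> \<noteq> X k \<omega>))"
proof -
  note [measurable] = pred_X[OF adapted_inside]
  have "\<P>(\<omega> in M. (inside k (traj \<omega>) \<and> typ 1 (X k \<omega>)) \<and> (\<forall>s\<ge>1. \<exists>a\<in>A 1 - {[]}. X (k + s) \<omega> = X k \<omega> @ a)) =
    \<P>(\<omega> in M. inside k (traj \<omega>) \<and> typ 1 (X k \<omega>)) * escape_prob 1"
    unfolding escape_prob_def
  proof (rule markov_property_forever[where P = "\<lambda>y. inside k y \<and> typ 1 (y k)"])
    show "adapted k (\<lambda>y. inside k y \<and> typ 1 (y k))"
      by (intro adapted_conj adapted_inside) (auto simp: adapted_def)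
    show "translates (x k) (A 1 - {[]})" if "inside k x \<and> typ 1 (x k)" "\<And>j. j \<le> k \<Longrightarrow> x j \<in> S" for x
    proof (rule translates_mono[OF translates_A])
      show "x k \<in> S" by (rule that(2)) simp
      show "typ 1 (x k)" using that(1) by simp
    qed auto
  qed
  moreover have "\<P>(\<omega> in M. (inside k (traj \<omega>) \<and> typ 1 (X k \<omega>)) \<and> (\<forall>s\<ge>1. \<exists>a\<in>A 1 - {[]}. X (k + s) \<omega> = X k \<omega> @ a)) \<le>
    \<P>(\<omega> in M. inside k (traj \<omega>) \<and> typ 1 (X k \<omega>) \<and> (\<forall>s\<ge>1. X (k + s) \<omega> \<noteq> X k \<omega>))"
  proof (rule finite_measure_mono)
    show "{\<omega> \<in> space M. (inside k (traj \<omega>) \<and> typ 1 (X k \<omega>)) \<and> (\<forall>s\<ge>1. \<exists>a\<in>A 1 - {[]}. X (k + s) \<omega> = X k \<omega> @ a)}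
      \<subseteq> {\<omega> \<in> space M. inside k (traj \<omega>) \<and> typ 1 (X k \<omega>) \<and> (\<forall>s\<ge>1. X (k + s) \<omega> \<noteq> X k \<omega>)}"
    proof
      fix \<omega>
      assume mem: "\<omega> \<in> {\<omega> \<in> space M. (inside k (traj \<omega>) \<and> typ 1 (X k \<omega>)) \<and> (\<forall>s\<ge>1. \<exists>a\<in>A 1 - {[]}. X (k + s) \<omega> = X k \<omega> @ a)}"
      then have \<omega>: "\<omega> \<in> space M \<and> inside k (traj \<omega>) \<and> typ 1 (X k \<omega>)"
        by (elim CollectE conjE, intro conjI)
      from mem have st: "\<forall>s\<ge>1. \<exists>a\<in>A 1 - {[]}. X (k + s) \<omega> = X k \<omega> @ a"
        by (elim CollectE conjE)
      have ne: "X (k + s) \<omega> \<noteq> X k \<omega>" if "1 \<le> s" for s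
      proof -
        from st that have "\<exists>a\<in>A 1 - {[]}. X (k + s) \<omega> = X k \<omega> @ a" by (simp only: simp_thms)
        then obtain a where "a \<in> A 1 - {[]}" "X (k + s) \<omega> = X k \<omega> @ a" ..
        then show ?thesis by simp
      qed
      have "\<forall>s\<ge>1. X (k + s) \<omega> \<noteq> X k \<omega>" by (intro allI impI ne)
      with \<omega> show "\<omega> \<in> {\<omega> \<in> space M. inside k (traj \<omega>) \<and> typ 1 (X k \<omega>) \<and> (\<forall>s\<ge>1. X (k + s) \<omega> \<noteq> X k \<omega>)}"
        by (simp only: mem_Collect_eq simp_thms)
    qed
  qed measurable
  ultimately show ?thesis by (simp only:)
qed

text \<open>The constant stems from \<open>prob_inside_typ1\<close>: it bounds from below the sum of the probabilities
  of being at a word of type 1 over three consecutive times, and each such visit is the last one with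
  probability at least \<open>escape_prob 1\<close>. The factor 6 accounts for the overlapping triples and for rounding.\<close>
lemma fresh_sum_linear_growth:
  "(letter_prob 1 * letter_prob 2 * stay_prob 1 * escape_prob 1 / 6) * real n \<le> (\<Sum>k\<le>n. \<phi> k (\<lambda>_. True))"
proof -
  define a where "a k = \<P>(\<omega> in M. inside k (traj \<omega>) \<and> typ 1 (X k \<omega>))" for k
  define \<kappa> where "\<kappa> = letter_prob 1 * letter_prob 2 * stay_prob 1"
  have a0: "0 \<le> a k" for k by (simp add: a_def)
  have \<phi>0: "0 \<le> \<phi> k P" for k P by (simp add: \<phi>_def)
  have g0: "0 \<le> escape_prob 1" by (simp add: escape_prob_def)
  have k01: "0 \<le> \<kappa>" "\<kappa> \<le> 1" unfolding \<kappa>_def using letter_prob_pos[of 1] letter_prob_pos[of 2] letter_prob_le_1 stay_prob_le_1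
    by (auto intro!: mult_nonneg_nonneg mult_le_one simp: stay_prob_def)
  have three: "\<kappa> \<le> a k + a (Suc k) + a (Suc (Suc k))" for k
    using prob_inside_typ1[of k] by (simp add: a_def \<kappa>_def)
  have low: "escape_prob 1 * (\<Sum>k\<le>n. a k) \<le> (\<Sum>k\<le>n. \<phi> k (\<lambda>_. True))"
  proof -
    have "escape_prob 1 * (\<Sum>k\<le>n. a k) = (\<Sum>k\<le>n. a k * escape_prob 1)" by (subst mult.commute) (rule sum_distrib_right)
    also have "\<dots> \<le> (\<Sum>k\<le>n. \<P>(\<omega> in M. inside k (traj \<omega>) \<and> typ 1 (X k \<omega>) \<and> (\<forall>s\<ge>1. X (k + s) \<omega> \<noteq> X k \<omega>)))"
      unfolding a_def by (intro sum_mono visits_prob_ge)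
    also have "\<dots> \<le> (\<Sum>k\<le>n. \<phi> k (\<lambda>_. True))" by (rule fresh_sum_ge_visits)
    finally show ?thesis .
  qed
  have "n = 0 \<or> n = 1 \<or> n = (n - 2) + 2" by arith
  then consider "n = 0" | "n = 1" | m where "n = m + 2" by blast
  then have "(\<kappa> * escape_prob 1 / 6) * real n \<le> (\<Sum>k\<le>n. \<phi> k (\<lambda>_. True))"
  proof cases
    case 1
    then show ?thesis using \<phi>0 by simp
  next
    case 2
    have "\<phi> 0 (\<lambda>_. True) = 1" by (simp add: \<phi>_def fresh_def inside_def prob_space)
    moreover have "\<kappa> * escape_prob 1 \<le> 1" using k01 g0 escape_prob_le_1 by (intro mult_le_one) auto
    moreover have "(\<Sum>k\<le>n. \<phi> k (\<lambda>_. True)) = \<phi> 0 (\<lambda>_. True) + \<phi> 1 (\<lambda>_. True)"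
      unfolding 2 by (simp add: atMost_Suc)
    moreover have "\<kappa> * escape_prob 1 / 6 * real n = \<kappa> * escape_prob 1 / 6" using 2 by simp
    ultimately show ?thesis using \<phi>0[of 1 "\<lambda>_. True"] by linarith
  next
    case 3
    have sub: "(\<Sum>k<Suc m. a (k + i)) \<le> (\<Sum>k\<le>n. a k)" if "i \<le> 2" for i
    proof -
      have "(\<Sum>k<Suc m. a (k + i)) = (\<Sum>k\<in>(\<lambda>k. k + i) ` {..<Suc m}. a k)"
        by (subst sum.reindex) (auto simp: inj_on_def)
      also have "\<dots> \<le> (\<Sum>k\<le>n. a k)" by (rule sum_mono2) (use that 3 a0 in auto)
      finally show ?thesis .
    qed
    have "\<kappa> * real (Suc m) = (\<Sum>k<Suc m. \<kappa>)" by simp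
    also have "\<dots> \<le> (\<Sum>k<Suc m. a k + a (Suc k) + a (Suc (Suc k)))" by (intro sum_mono three)
    also have "\<dots> \<le> 3 * (\<Sum>k\<le>n. a k)"
    proof -
      have "(\<Sum>k<Suc m. a k + a (Suc k) + a (Suc (Suc k))) =
          (\<Sum>k<Suc m. a (k + 0)) + (\<Sum>k<Suc m. a (k + 1)) + (\<Sum>k<Suc m. a (k + 2))"
        by (simp only: sum.distrib add_0_right Suc_eq_plus1 add.assoc one_add_one)
      then show ?thesis using sub[of 0] sub[of 1] sub[of 2] by linarith
    qed
    finally have 4: "\<kappa> * real (Suc m) \<le> 3 * (\<Sum>k\<le>n. a k)" .
    have "\<kappa> * real n \<le> \<kappa> * (2 * real (Suc m))" using k01 3 by (intro mult_left_mono) auto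
    then have "\<kappa> * real n \<le> 6 * (\<Sum>k\<le>n. a k)" using 4 by linarith
    then have "escape_prob 1 * (\<kappa> * real n) \<le> escape_prob 1 * (6 * (\<Sum>k\<le>n. a k))" using g0 by (rule mult_left_mono)
    then have "\<kappa> * escape_prob 1 / 6 * real n \<le> escape_prob 1 * (\<Sum>k\<le>n. a k)" by (simp add: field_simps)
    then show ?thesis using low by (rule order_trans)
  qed
  then show ?thesis by (simp add: \<kappa>_def)
qed

text \<open>Whatever happened so far, the walk has a chance of at least \<open>letter_prob 1 * stay_prob 1\<close> to be
  now or after one step at a word of type 1 whose cone it never leaves. Failing such a trial is
  noticed at a finite time, where the next trial can start; so the probability that j trials
  fail decays geometrically in j.\<close>
lemma AE_eventually_stay:
  assumes h: "0 < stay_prob 1"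
  shows "AE \<omega> in M. \<exists>n. typ 1 (X n \<omega>) \<and> stay n (traj \<omega>)"
proof -
  let ?N = "\<lambda>\<omega>. \<forall>n. \<not> (typ 1 (X n \<omega>) \<and> stay n (traj \<omega>))"
  define s where "s = 1 - letter_prob 1 * stay_prob 1"
  have s: "0 \<le> s" "s < 1" unfolding s_def using letter_prob_pos[of 1] letter_prob_le_1[of 1] h stay_prob_le_1[of 1]
    by (auto intro: mult_le_one)
  have [measurable]: "Measurable.pred M ?N" by measurable
  have decay: "\<P>(\<omega> in M. P (traj \<omega>) \<and> ?N \<omega>) \<le> s ^ j * \<P>(\<omega> in M. P (traj \<omega>))" if "adapted n P" for j n P
    using that
  proof (induction j arbitrary: n P)
    case 0
    note [measurable] = pred_X[OF 0]
    show ?case by (simp, rule finite_measure_mono) auto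
  next
    case (Suc j)
    have cone: "\<P>(\<omega> in M. P (traj \<omega>) \<and> ?N \<omega>) \<le> s ^ j * (1 - stay_prob 1) * \<P>(\<omega> in M. P (traj \<omega>))"
      if P: "adapted n P" and t: "\<And>y. P y \<Longrightarrow> typ 1 (y n)" for n P
    proof -
      note [measurable] = pred_X[OF P]
      let ?St = "\<lambda>l \<omega>. \<forall>s\<in>{1..l}. \<exists>a\<in>A 1. X (n + s) \<omega> = X n \<omega> @ a"
      let ?p = "\<P>(\<omega> in M. P (traj \<omega>))"
      let ?f = "\<lambda>l. \<P>(\<omega> in M. P (traj \<omega>) \<and> ?St l \<omega>)"
      have st: "\<P>(\<omega> in M. P (traj \<omega>) \<and> stay n (traj \<omega>)) = ?p * stay_prob 1"
        by (rule prob_stay) (use P t in auto)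
      have lim: "?f \<longlonglongrightarrow> ?p * stay_prob 1"
        using prob_forall_from_1[of "\<lambda>s \<omega>. \<exists>a\<in>A 1. X (n + s) \<omega> = X n \<omega> @ a" "\<lambda>\<omega>. P (traj \<omega>)"]
          st unfolding stay_def by simp
      (* If the cone is left within l steps, the induction hypothesis applies at time n + l;
         leaving it later has a probability that vanishes as l grows. *)
      have bound: "\<P>(\<omega> in M. P (traj \<omega>) \<and> ?N \<omega>) \<le> s ^ j * (?p - ?f l) + (?f l - ?p * stay_prob 1)" for l
      proof -
        have ad: "adapted (n + l) (\<lambda>y. P y \<and> \<not> (\<forall>s\<in>{1..l}. \<exists>a\<in>A 1. y (n + s) = y n @ a))"
          by (intro adapted_conj adapted_mono[OF P]) (auto simp: adapted_def)
        note [measurable] = pred_X[OF ad]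
        have sub: "stay n (traj \<omega>) \<Longrightarrow> ?St l \<omega>" for \<omega> by (auto simp: stay_def)
        have "?p = prob ({\<omega>\<in>space M. P (traj \<omega>) \<and> \<not> ?St l \<omega>} \<union> {\<omega>\<in>space M. P (traj \<omega>) \<and> ?St l \<omega>})"
          by (rule arg_cong[where f=prob]) blast
        also have "\<dots> = \<P>(\<omega> in M. P (traj \<omega>) \<and> \<not> ?St l \<omega>) + ?f l"
          by (rule finite_measure_Union) auto
        finally have 1: "\<P>(\<omega> in M. P (traj \<omega>) \<and> \<not> ?St l \<omega>) = ?p - ?f l" by simp
        have "?f l = prob ({\<omega>\<in>space M. P (traj \<omega>) \<and> ?St l \<omega> \<and> \<not> stay n (traj \<omega>)} \<union>
            {\<omega>\<in>space M. P (traj \<omega>) \<and> stay n (traj \<omega>)})"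
          by (rule arg_cong[where f=prob]) (use sub in blast)
        also have "\<dots> = \<P>(\<omega> in M. P (traj \<omega>) \<and> ?St l \<omega> \<and> \<not> stay n (traj \<omega>)) + ?p * stay_prob 1"
          unfolding st[symmetric] by (rule finite_measure_Union) auto
        finally have 2: "\<P>(\<omega> in M. P (traj \<omega>) \<and> ?St l \<omega> \<and> \<not> stay n (traj \<omega>)) = ?f l - ?p * stay_prob 1" by simp
        have "\<P>(\<omega> in M. P (traj \<omega>) \<and> ?N \<omega>) \<le>
            prob ({\<omega>\<in>space M. (P (traj \<omega>) \<and> \<not> ?St l \<omega>) \<and> ?N \<omega>} \<union>
              {\<omega>\<in>space M. P (traj \<omega>) \<and> ?St l \<omega> \<and> \<not> stay n (traj \<omega>)})"
        proof (rule finite_measure_mono)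
          show "{\<omega>\<in>space M. P (traj \<omega>) \<and> ?N \<omega>} \<subseteq> {\<omega>\<in>space M. (P (traj \<omega>) \<and> \<not> ?St l \<omega>) \<and> ?N \<omega>} \<union>
              {\<omega>\<in>space M. P (traj \<omega>) \<and> ?St l \<omega> \<and> \<not> stay n (traj \<omega>)}"
            using t by blast
        qed measurable
        also have "\<dots> \<le> \<P>(\<omega> in M. (P (traj \<omega>) \<and> \<not> ?St l \<omega>) \<and> ?N \<omega>) +
            \<P>(\<omega> in M. P (traj \<omega>) \<and> ?St l \<omega> \<and> \<not> stay n (traj \<omega>))"
          by (rule measure_Un_le) measurable
        also have "\<P>(\<omega> in M. (P (traj \<omega>) \<and> \<not> ?St l \<omega>) \<and> ?N \<omega>) \<le> s ^ j * (?p - ?f l)"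
          using Suc.IH[OF ad] unfolding 1 .
        finally show ?thesis unfolding 2 by simp
      qed
      have "(\<lambda>l. s ^ j * (?p - ?f l) + (?f l - ?p * stay_prob 1)) \<longlonglongrightarrow> s ^ j * (?p - ?p * stay_prob 1) + (?p * stay_prob 1 - ?p * stay_prob 1)"
        by (intro tendsto_intros lim)
      then have "\<P>(\<omega> in M. P (traj \<omega>) \<and> ?N \<omega>) \<le> s ^ j * (?p - ?p * stay_prob 1) + (?p * stay_prob 1 - ?p * stay_prob 1)"
        by (rule LIMSEQ_le_const) (use bound in blast)
      then show ?thesis by (simp add: algebra_simps)
    qed
    note P = Suc.prems
    note [measurable] = pred_X[OF P]
    let ?P1 = "\<lambda>y. P y \<and> typ 1 (y n)" and ?P0 = "\<lambda>y. P y \<and> \<not> typ 1 (y n)"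
    let ?Q = "\<lambda>y. ?P0 y \<and> (\<exists>v\<in>L 1. y (Suc n) = y n @ [v])"
    let ?Q' = "\<lambda>y. ?P0 y \<and> \<not> (\<exists>v\<in>L 1. y (Suc n) = y n @ [v])"
    have ad1: "adapted n ?P1" and ad0: "adapted n ?P0"
      by (intro adapted_conj P; simp add: adapted_def)+
    have adQ: "adapted (Suc n) ?Q" and adQ': "adapted (Suc n) ?Q'"
      by (intro adapted_conj adapted_mono[OF P]; simp add: adapted_def)+
    note [measurable] = pred_X[OF ad1] pred_X[OF ad0] pred_X[OF adQ] pred_X[OF adQ']
    have split: "\<P>(\<omega> in M. P (traj \<omega>) \<and> R \<omega>) = \<P>(\<omega> in M. ?P1 (traj \<omega>) \<and> R \<omega>) +
        (\<P>(\<omega> in M. ?Q (traj \<omega>) \<and> R \<omega>) + \<P>(\<omega> in M. ?Q' (traj \<omega>) \<and> R \<omega>))"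
      if [measurable]: "Measurable.pred M R" for R
    proof -
      have "\<P>(\<omega> in M. P (traj \<omega>) \<and> R \<omega>) =
        prob ({\<omega>\<in>space M. ?P1 (traj \<omega>) \<and> R \<omega>} \<union> ({\<omega>\<in>space M. ?Q (traj \<omega>) \<and> R \<omega>} \<union> {\<omega>\<in>space M. ?Q' (traj \<omega>) \<and> R \<omega>}))"
        by (rule arg_cong[where f=prob]) blast
      also have "\<dots> = \<P>(\<omega> in M. ?P1 (traj \<omega>) \<and> R \<omega>) +
        prob ({\<omega>\<in>space M. ?Q (traj \<omega>) \<and> R \<omega>} \<union> {\<omega>\<in>space M. ?Q' (traj \<omega>) \<and> R \<omega>})"
        by (rule finite_measure_Union) auto
      also have "prob ({\<omega>\<in>space M. ?Q (traj \<omega>) \<and> R \<omega>} \<union> {\<omega>\<in>space M. ?Q' (traj \<omega>) \<and> R \<omega>}) =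
        \<P>(\<omega> in M. ?Q (traj \<omega>) \<and> R \<omega>) + \<P>(\<omega> in M. ?Q' (traj \<omega>) \<and> R \<omega>)"
        by (rule finite_measure_Union) auto
      finally show ?thesis .
    qed
    let ?p1 = "\<P>(\<omega> in M. ?P1 (traj \<omega>))" and ?q = "\<P>(\<omega> in M. ?Q (traj \<omega>))" and ?q' = "\<P>(\<omega> in M. ?Q' (traj \<omega>))"
    have q: "?q = (?q + ?q') * letter_prob 1"
    proof -
      have "?q = \<P>(\<omega> in M. ?P0 (traj \<omega>)) * letter_prob 1"
        by (rule append_letter_prob[OF ad0]) auto
      moreover have "\<P>(\<omega> in M. ?P0 (traj \<omega>)) = prob ({\<omega>\<in>space M. ?Q (traj \<omega>)} \<union> {\<omega>\<in>space M. ?Q' (traj \<omega>)})"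
        by (rule arg_cong[where f=prob]) blast
      moreover have "\<dots> = ?q + ?q'"
        by (rule finite_measure_Union) auto
      ultimately show ?thesis by simp
    qed
    have n1: "\<P>(\<omega> in M. ?P1 (traj \<omega>) \<and> ?N \<omega>) \<le> s ^ j * (1 - stay_prob 1) * ?p1"
      by (rule cone[OF ad1]) simp
    have n2: "\<P>(\<omega> in M. ?Q (traj \<omega>) \<and> ?N \<omega>) \<le> s ^ j * (1 - stay_prob 1) * ?q"
      by (rule cone[OF adQ]) (auto simp: has_type_def)
    have n3: "\<P>(\<omega> in M. ?Q' (traj \<omega>) \<and> ?N \<omega>) \<le> s ^ j * ?q'"
      by (rule Suc.IH[OF adQ'])
    have "\<P>(\<omega> in M. P (traj \<omega>) \<and> ?N \<omega>) \<le> s ^ j * ((1 - stay_prob 1) * ?p1 + ((1 - stay_prob 1) * ?q + ?q'))"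
      unfolding split[of ?N, OF \<open>Measurable.pred M ?N\<close>] using n1 n2 n3 by (simp add: algebra_simps)
    also have "\<dots> \<le> s ^ j * (s * ?p1 + s * (?q + ?q'))"
    proof (intro mult_left_mono add_mono)
      show "(1 - stay_prob 1) * ?p1 \<le> s * ?p1"
        unfolding s_def using letter_prob_le_1[of 1] h by (intro mult_right_mono) (auto intro: mult_left_le_one_le)
      have "(1 - stay_prob 1) * ?q + ?q' = (?q + ?q') - stay_prob 1 * ?q" by (simp add: algebra_simps)
      also have "\<dots> = (?q + ?q') - stay_prob 1 * ((?q + ?q') * letter_prob 1)" using q by simp
      also have "\<dots> = s * (?q + ?q')" by (simp add: s_def algebra_simps)
      finally show "(1 - stay_prob 1) * ?q + ?q' \<le> s * (?q + ?q')" by simp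
    qed (use s in auto)
    also have "\<dots> = s ^ Suc j * (?p1 + (?q + ?q'))" by (simp add: algebra_simps)
    also have "?p1 + (?q + ?q') = \<P>(\<omega> in M. P (traj \<omega>))"
      using split[of "\<lambda>_. True"] by simp
    finally show ?case .
  qed
  have "prob {\<omega>\<in>space M. ?N \<omega>} \<le> s ^ j" for j
    using decay[OF adapted_const[of 0 True], of j] by (simp add: prob_space)
  moreover have "(\<lambda>j. s ^ j) \<longlonglongrightarrow> 0" using s by (intro LIMSEQ_realpow_zero)
  ultimately have "prob {\<omega>\<in>space M. ?N \<omega>} \<le> 0" by (intro LIMSEQ_le_const[of "\<lambda>j. s ^ j"]) auto
  then have "prob {\<omega>\<in>space M. ?N \<omega>} = 0" by (simp add: measure_le_0_iff)
  then have "AE \<omega> in M. \<not> ?N \<omega>" by (subst (asm) prob_Collect_eq_0) auto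
  then show ?thesis by simp
qed

end

section \<open>The walk conditioned to stay in a cone\<close>

lemma shift_shift: "prefix (y t) (y (t + n)) \<Longrightarrow> shift n (shift t y) = shift (t + n) y"
  by (rule ext) (use prefix_length_le[of "y t" "y (t + n)"] in \<open>simp add: shift_def add.assoc\<close>)

lemma append_shift: "prefix (y t) (y (t + s)) \<Longrightarrow> y (t + s) = y t @ shift t y s"
  by (auto simp: shift_def prefix_def)

context free_product_walk
begin

text \<open>Between times t and t + n the path stays in the cone of its word at time t and is fresh relative
  to this cone at time t + n.\<close>
definition cone_segment :: "nat \<Rightarrow> nat \<Rightarrow> (nat \<Rightarrow> 'a list) \<Rightarrow> bool" where
  "cone_segment t n y \<longleftrightarrow> (\<forall>s\<in>{1..n}. \<exists>a\<in>A 1. y (t + s) = y t @ a) \<and> fresh T (shift t y) n"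

lemma adapted_cone_segment: "adapted (t + n) (cone_segment t n)"
  unfolding cone_segment_def
  by (intro adapted_conj adapted_shift adapted_fresh) (auto simp: adapted_def)

lemma cone_segment_prefix: "cone_segment t n y \<Longrightarrow> s \<le> n \<Longrightarrow> prefix (y t) (y (t + s))"
proof (cases "s = 0")
  case False
  assume "cone_segment t n y" "s \<le> n"
  moreover from False this(2) have "s \<in> {1..n}" by simp
  ultimately obtain a where "y (t + s) = y t @ a" unfolding cone_segment_def by blast
  then show ?thesis by simp
qed simp

lemma cone_segment_typ:
  assumes "cone_segment t n y" "typ 1 (y t)"
  shows "typ 1 (y (t + n))"
proof (cases "n = 0")
  case False
  then have "typ 1 (shift t y n)" using assms(1) by (simp add: cone_segment_def fresh_def)
  moreover from this have "shift t y n \<noteq> []" using typ_Nil by auto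
  ultimately show ?thesis
    by (simp add: append_shift[of y t n, OF cone_segment_prefix[OF assms(1) order_refl]] typ_append)
qed (use assms in simp)

text \<open>A regeneration relative to a cone is an adapted condition up to the regeneration time,
  followed by staying in the smaller cone that is entered there.\<close>
lemma stay_regen_iff:
  assumes S: "\<And>k. y k \<in> S" and t: "typ 1 (y t)"
  shows "stay t y \<and> regen T (shift t y) n \<longleftrightarrow> cone_segment t n y \<and> stay (t + n) y"
proof
  assume L: "stay t y \<and> regen T (shift t y) n"
  then have pt: "\<forall>s\<ge>t. prefix (y t) (y s)" using stay_iff[where y = y and k = t, OF S t] by blast
  then have ap: "y (t + s) = y t @ shift t y s" for s by (intro append_shift) simp
  have c: "cone_segment t n y"
    using L unfolding cone_segment_def stay_def regen_def by auto
  have "prefix (y (t + n)) (y s)" if s: "t + n \<le> s" for s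
  proof -
    have "prefix (shift t y n) (shift t y (s - t))" using L s by (simp add: regen_def)
    then show ?thesis using ap[of n] ap[of "s - t"] s by simp
  qed
  then show "cone_segment t n y \<and> stay (t + n) y"
    using c stay_iff[where y = y and k = "t + n", OF S cone_segment_typ[OF c t]] by blast
next
  assume R: "cone_segment t n y \<and> stay (t + n) y"
  then have c: "cone_segment t n y" by blast
  have pn: "prefix (y (t + n)) (y s)" if "t + n \<le> s" for s
    using R stay_iff[where y = y and k = "t + n", OF S cone_segment_typ[OF c t]] that by blast
  have pt: "prefix (y t) (y s)" if s: "t \<le> s" for s
  proof (cases "s \<le> t + n")
    case True
    then show ?thesis using cone_segment_prefix[OF c, of "s - t"] s by simp
  next
    case False
    then show ?thesis using pn[of s] cone_segment_prefix[OF c order_refl] by (meson nat_le_linear prefix_order.trans)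
  qed
  then have ap: "y (t + s) = y t @ shift t y s" for s by (intro append_shift) simp
  have "prefix (shift t y n) (shift t y s)" if "n \<le> s" for s
    using pn[of "t + s"] that ap[of n] ap[of s] by simp
  then have "regen T (shift t y) n" using c by (simp add: regen_def cone_segment_def)
  then show "stay t y \<and> regen T (shift t y) n" using pt stay_iff[where y = y and k = t, OF S t] by blast
qed

lemma cone_segment_prob:
  assumes P: "adapted t P" and t: "\<And>y. P y \<Longrightarrow> typ 1 (y t)" and Q: "adapted n Q"
  shows "\<P>(\<omega> in M. P (traj \<omega>) \<and> cone_segment t n (traj \<omega>) \<and> Q (shift t (traj \<omega>))) =
    \<P>(\<omega> in M. P (traj \<omega>)) * \<phi> n Q"
proof -
  have "\<P>(\<omega> in M. P (traj \<omega>) \<and> (\<forall>s\<in>{1..n}. \<exists>a\<in>A 1. X (t + s) \<omega> = X t \<omega> @ a) \<and>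
      (Q (shift t (traj \<omega>)) \<and> fresh T (shift t (traj \<omega>)) n)) =
    \<P>(\<omega> in M. P (traj \<omega>)) * \<P>(\<omega> in M. (\<forall>s\<in>{1..n}. X s \<omega> \<in> A 1) \<and> (Q (traj \<omega>) \<and> fresh T (traj \<omega>) n))"
  proof (rule markov_property_translated[where Q = "\<lambda>y. Q y \<and> fresh T y n"])
    show "adapted n (\<lambda>y. Q y \<and> fresh T y n)" by (intro adapted_conj Q adapted_fresh) simp
    show "translates (x t) (A 1)" if "P x" "\<And>k. k \<le> t \<Longrightarrow> x k \<in> S" for x
      by (rule translates_A) (use that t in auto)
  qed (rule P)
  then show ?thesis
    unfolding \<phi>_def inside_def cone_segment_def by (simp add: conj_ac)
qed

lemma cone_regen_prob:
  assumes P: "adapted t P" and t: "\<And>y. P y \<Longrightarrow> typ 1 (y t)" and Q: "adapted n Q"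
  shows "\<P>(\<omega> in M. P (traj \<omega>) \<and> stay t (traj \<omega>) \<and> Q (shift t (traj \<omega>)) \<and>
      regen T (shift t (traj \<omega>)) n) = \<P>(\<omega> in M. P (traj \<omega>)) * \<phi> n Q * stay_prob 1"
proof -
  let ?P = "\<lambda>y. P y \<and> cone_segment t n y \<and> Q (shift t y)"
  have "\<P>(\<omega> in M. P (traj \<omega>) \<and> stay t (traj \<omega>) \<and> Q (shift t (traj \<omega>)) \<and>
      regen T (shift t (traj \<omega>)) n) = \<P>(\<omega> in M. ?P (traj \<omega>) \<and> stay (t + n) (traj \<omega>))"
  proof (rule arg_cong[where f=prob], rule Collect_cong, rule conj_cong[OF refl])
    fix \<omega> assume "\<omega> \<in> space M"
    then show "(P (traj \<omega>) \<and> stay t (traj \<omega>) \<and> Q (shift t (traj \<omega>)) \<and> regen T (shift t (traj \<omega>)) n) =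
        (?P (traj \<omega>) \<and> stay (t + n) (traj \<omega>))"
      using stay_regen_iff[of "\<lambda>k. X k \<omega>" t n] t[of "\<lambda>k. X k \<omega>"] X_in_S[of \<omega>] by blast
  qed
  also have "\<dots> = \<P>(\<omega> in M. ?P (traj \<omega>)) * stay_prob 1"
  proof (rule prob_stay)
    show "adapted (t + n) ?P"
      by (intro adapted_conj adapted_mono[OF P] adapted_cone_segment adapted_shift Q) simp
    show "typ 1 (y (t + n))" if "?P y" for y using that t cone_segment_typ by blast
  qed
  also have "\<P>(\<omega> in M. ?P (traj \<omega>)) = \<P>(\<omega> in M. P (traj \<omega>)) * \<phi> n Q"
    by (rule cone_segment_prob[OF P _ Q]) (rule t)
  finally show ?thesis .
qed

definition cone_event :: "nat \<Rightarrow> 'a list \<Rightarrow> 'w set" where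
  "cone_event t w = {\<omega>\<in>space M. X t \<omega> = w \<and> stay t (traj \<omega>)}"

lemma cone_event_measurable[measurable]: "cone_event t w \<in> events"
  unfolding cone_event_def by measurable

text \<open>The common law of the pieces for the walks conditioned to stay in a cone. It does not mention the
  cone, which is why all cones lead to the same limit.\<close>
definition cone_law :: "nat \<Rightarrow> nat \<times> nat \<Rightarrow> real" where
  "cone_law r z = \<phi> (fst z) (\<lambda>y. multi_range r (map y [0..<fst z]) = snd z \<and> indecomposable T y (fst z))"

context
  fixes t :: nat and w :: "'a list"
  assumes w: "typ 1 w" and pos: "0 < \<P>(\<omega> in M. X t \<omega> = w)" and g: "0 < escape_prob 1"
begin

lemma prob_cone_event: "prob (cone_event t w) = \<P>(\<omega> in M. X t \<omega> = w) * stay_prob 1"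
  unfolding cone_event_def
  by (rule prob_stay[where P = "\<lambda>y. y t = w"]) (use w in \<open>auto simp: adapted_def\<close>)

lemma prob_cone_event_pos: "0 < prob (cone_event t w)"
  unfolding prob_cone_event using pos g escape_prob_le_stay_prob[of 1] by simp

lemma cone_measure:
  assumes "Measurable.pred M \<Phi>"
  shows "measure (uniform_measure M (cone_event t w)) {\<omega>\<in>space M. \<Phi> \<omega>} =
    \<P>(\<omega> in M. X t \<omega> = w \<and> stay t (traj \<omega>) \<and> \<Phi> \<omega>) / (\<P>(\<omega> in M. X t \<omega> = w) * stay_prob 1)"
proof -
  have "cone_event t w \<inter> {\<omega>\<in>space M. \<Phi> \<omega>} = {\<omega>\<in>space M. X t \<omega> = w \<and> stay t (traj \<omega>) \<and> \<Phi> \<omega>}"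
    by (auto simp: cone_event_def)
  then show ?thesis
    using prob_cone_event_pos assms
    by (subst measure_uniform_measure) (auto simp: emeasure_eq_measure prob_cone_event pred_def)
qed

lemma pred_shift_X: "adapted n P \<Longrightarrow> Measurable.pred M (\<lambda>\<omega>. P (shift t (traj \<omega>)))"
  by (rule pred_X[OF adapted_shift])

lemma shift_X_measurable[measurable]: "(\<lambda>\<omega>. shift t (traj \<omega>) s) \<in> measurable M (count_space S)"
  unfolding measurable_count_space_eq_countable[OF countable_S]
proof (intro conjI funcsetI ballI)
  show "shift t (traj \<omega>) s \<in> S" if "\<omega> \<in> space M" for \<omega>
    unfolding shift_def using drop_in_S X_in_S[OF that] by blast
  show "(\<lambda>\<omega>. shift t (traj \<omega>) s) -` {a} \<inter> space M \<in> events" for a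
    using pred_shift_X[of s "\<lambda>y. y s = a"]
    by (simp add: adapted_def pred_def vimage_def Int_def conj_commute)
qed

lemma pred_regen_shift_X[measurable]:
  "Measurable.pred M (\<lambda>\<omega>. regen T (shift t (traj \<omega>)) n)"
  "Measurable.pred M (\<lambda>\<omega>. regen T (shift n (shift t (traj \<omega>))) m)"
proof -
  have 1: "Measurable.pred M (\<lambda>\<omega>. P (shift n (shift t (traj \<omega>))))" if "adapted m P" for P m
    using pred_X[OF adapted_shift[OF adapted_shift[OF that]]] .
  have "Measurable.pred M (\<lambda>\<omega>. fresh T (shift n (shift t (traj \<omega>))) m)"
    by (rule 1[OF adapted_fresh[OF order_refl]])
  moreover have "Measurable.pred M (\<lambda>\<omega>. prefix (shift n (shift t (traj \<omega>)) m) (shift n (shift t (traj \<omega>)) s))" for s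
    by (rule 1[OF adapted_prefix[of m "max m s" s]]) auto
  ultimately show "Measurable.pred M (\<lambda>\<omega>. regen T (shift n (shift t (traj \<omega>))) m)"
    unfolding regen_def by measurable
  have "Measurable.pred M (\<lambda>\<omega>. fresh T (shift t (traj \<omega>)) n)"
    by (rule pred_shift_X[OF adapted_fresh[OF order_refl]])
  moreover have "Measurable.pred M (\<lambda>\<omega>. prefix (shift t (traj \<omega>) n) (shift t (traj \<omega>) s))" for s
    by (rule pred_shift_X[OF adapted_prefix[of n "max n s" s]]) auto
  ultimately show "Measurable.pred M (\<lambda>\<omega>. regen T (shift t (traj \<omega>)) n)"
    unfolding regen_def by measurable
qed

lemma cone_measure_regen:
  assumes P: "adapted n P"
  shows "measure (uniform_measure M (cone_event t w))
    {\<omega>\<in>space M. P (shift t (traj \<omega>)) \<and> regen T (shift t (traj \<omega>)) n} = \<phi> n P"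
proof -
  note [measurable] = pred_shift_X[OF P]
  have "\<P>(\<omega> in M. X t \<omega> = w \<and> stay t (traj \<omega>) \<and> P (shift t (traj \<omega>)) \<and> regen T (shift t (traj \<omega>)) n) =
      \<P>(\<omega> in M. X t \<omega> = w) * \<phi> n P * stay_prob 1"
    by (rule cone_regen_prob[where P = "\<lambda>y. y t = w"]) (use w P in \<open>auto simp: adapted_def\<close>)
  then show ?thesis
    unfolding cone_measure[OF pred_intros_logic(3)[OF pred_shift_X[OF P] pred_regen_shift_X(1)]]
    using pos g escape_prob_le_stay_prob[of 1] by simp
qed

lemma cone_measure_two_regens:
  assumes P: "adapted n P" and Q: "adapted m Q"
  shows "measure (uniform_measure M (cone_event t w))
    {\<omega>\<in>space M. P (shift t (traj \<omega>)) \<and> regen T (shift t (traj \<omega>)) n \<and>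
       Q (shift n (shift t (traj \<omega>))) \<and> regen T (shift n (shift t (traj \<omega>))) m} = \<phi> n P * \<phi> m Q"
proof -
  note [measurable] = pred_shift_X[OF P] pred_shift_X[OF adapted_shift[OF Q]]
  let ?P = "\<lambda>y. y t = w \<and> cone_segment t n y \<and> P (shift t y)"
  have ad: "adapted t (\<lambda>y. y t = w)" by (simp add: adapted_def)
  have "\<P>(\<omega> in M. X t \<omega> = w \<and> stay t (traj \<omega>) \<and> P (shift t (traj \<omega>)) \<and> regen T (shift t (traj \<omega>)) n \<and>
       Q (shift n (shift t (traj \<omega>))) \<and> regen T (shift n (shift t (traj \<omega>))) m) =
    \<P>(\<omega> in M. ?P (traj \<omega>) \<and> stay (t + n) (traj \<omega>) \<and> Q (shift (t + n) (traj \<omega>)) \<and>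
       regen T (shift (t + n) (traj \<omega>)) m)"
  proof (rule arg_cong[where f=prob], rule Collect_cong, rule conj_cong[OF refl])
    fix \<omega> assume \<omega>: "\<omega> \<in> space M"
    let ?y = "\<lambda>k. X k \<omega>"
    have iff: "stay t ?y \<and> regen T (shift t ?y) n \<longleftrightarrow> cone_segment t n ?y \<and> stay (t + n) ?y" if "?y t = w"
      by (rule stay_regen_iff) (use that w X_in_S[OF \<omega>] in auto)
    have sh: "shift n (shift t ?y) = shift (t + n) ?y" if "cone_segment t n ?y"
      by (rule shift_shift) (rule cone_segment_prefix[OF that order_refl])
    show "(X t \<omega> = w \<and> stay t ?y \<and> P (shift t ?y) \<and> regen T (shift t ?y) n \<and>
       Q (shift n (shift t ?y)) \<and> regen T (shift n (shift t ?y)) m) =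
       (?P ?y \<and> stay (t + n) ?y \<and> Q (shift (t + n) ?y) \<and> regen T (shift (t + n) ?y) m)"
    proof (cases "X t \<omega> = w \<and> cone_segment t n ?y")
      case True
      then show ?thesis using iff sh by metis
    next
      case False
      then show ?thesis using iff by blast
    qed
  qed
  also have "\<dots> = \<P>(\<omega> in M. ?P (traj \<omega>)) * \<phi> m Q * stay_prob 1"
  proof (rule cone_regen_prob[OF _ _ Q])
    show "adapted (t + n) ?P"
      by (intro adapted_conj adapted_mono[OF ad] adapted_cone_segment adapted_shift P) simp
    show "typ 1 (y (t + n))" if "?P y" for y using that w cone_segment_typ by blast
  qed
  also have "\<P>(\<omega> in M. ?P (traj \<omega>)) = \<P>(\<omega> in M. X t \<omega> = w) * \<phi> n P"
    by (rule cone_segment_prob[OF ad _ P]) (use w in simp)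
  finally have "\<P>(\<omega> in M. X t \<omega> = w \<and> stay t (traj \<omega>) \<and> P (shift t (traj \<omega>)) \<and> regen T (shift t (traj \<omega>)) n \<and>
       Q (shift n (shift t (traj \<omega>))) \<and> regen T (shift n (shift t (traj \<omega>))) m) =
    \<P>(\<omega> in M. X t \<omega> = w) * \<phi> n P * \<phi> m Q * stay_prob 1" .
  moreover have "Measurable.pred M (\<lambda>\<omega>. P (shift t (traj \<omega>)) \<and> regen T (shift t (traj \<omega>)) n \<and>
       Q (shift n (shift t (traj \<omega>))) \<and> regen T (shift n (shift t (traj \<omega>))) m)"
    by (intro pred_intros_logic(3) pred_regen_shift_X pred_shift_X[OF P] pred_shift_X[OF adapted_shift[OF Q]])
  ultimately show ?thesis
    using pos g escape_prob_le_stay_prob[of 1] by (simp add: cone_measure)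
qed

text \<open>The probability of staying in a cone is the same for every word of type 1. So it cancels when
  one conditions on staying, and the multiplicativity of path probabilities becomes independence at
  regeneration times.\<close>
lemma cone_process_regenerative:
  "regenerative_process (\<lambda>w. typ 1 w) (uniform_measure M (cone_event t w)) S
     (\<lambda>s \<omega>. shift t (traj \<omega>) s) (letter_prob 1 * letter_prob 2 * stay_prob 1 * escape_prob 1 / 6)"
proof -
  have "prob_space (uniform_measure M (cone_event t w))"
    by (rule prob_space_uniform_measure) (use prob_cone_event_pos in \<open>auto simp: emeasure_eq_measure\<close>)
  then show ?thesis
  proof (intro regenerative_process.intro regenerative_process_axioms.intro typed_words_axioms)
    show "countable S" by (rule countable_S)
    show "(\<lambda>\<omega>. shift t (traj \<omega>) n) \<in> measurable (uniform_measure M (cone_event t w)) (count_space S)" for n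
      using shift_X_measurable by simp
    show "shift t (traj \<omega>) 0 = []" for \<omega> by (rule shift_0)
    show "0 < letter_prob 1 * letter_prob 2 * stay_prob 1 * escape_prob 1 / 6"
      using letter_prob_pos[of 1] letter_prob_pos[of 2] g escape_prob_le_stay_prob[of 1] by simp
    show "letter_prob 1 * letter_prob 2 * stay_prob 1 * escape_prob 1 / 6 * real n \<le>
        (\<Sum>k\<le>n. measure (uniform_measure M (cone_event t w))
          {\<omega> \<in> space (uniform_measure M (cone_event t w)). regen T (shift t (traj \<omega>)) k})" for n
      using fresh_sum_linear_growth[of n] cone_measure_regen[OF adapted_const[where c = True]] by simp
    show "measure (uniform_measure M (cone_event t w)) {\<omega> \<in> space (uniform_measure M (cone_event t w)).
        P (shift t (traj \<omega>)) \<and> regen T (shift t (traj \<omega>)) n \<and>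
        Q (shift n (shift t (traj \<omega>))) \<and> regen T (shift n (shift t (traj \<omega>))) m} =
      measure (uniform_measure M (cone_event t w)) {\<omega> \<in> space (uniform_measure M (cone_event t w)).
        P (shift t (traj \<omega>)) \<and> regen T (shift t (traj \<omega>)) n} *
      measure (uniform_measure M (cone_event t w)) {\<omega> \<in> space (uniform_measure M (cone_event t w)).
        Q (shift t (traj \<omega>)) \<and> regen T (shift t (traj \<omega>)) m}"
      if "adapted n P" "adapted m Q" for n m P Q
      using cone_measure_two_regens[OF that] cone_measure_regen[OF that(1)] cone_measure_regen[OF that(2)]
      by simp
  qed
qed

lemma cone_block_law:
  "regenerative_process.block_law (\<lambda>w. typ 1 w) (uniform_measure M (cone_event t w))
     (\<lambda>s \<omega>. shift t (traj \<omega>) s) r = cone_law r"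
proof
  fix z
  have "adapted (fst z) (\<lambda>y. multi_range r (map y [0..<fst z]) = snd z \<and> indecomposable T y (fst z))"
    by (intro adapted_conj adapted_indecomposable adapted_map) simp
  from cone_measure_regen[OF this] show "regenerative_process.block_law (\<lambda>w. typ 1 w)
     (uniform_measure M (cone_event t w)) (\<lambda>s \<omega>. shift t (traj \<omega>) s) r z = cone_law r z"
    unfolding regenerative_process.block_law_def[OF cone_process_regenerative] cone_law_def
      first_block_def first_regen_iff by (simp add: conj_assoc)
qed

lemma cone_limit:
  "AE \<omega> in M. X t \<omega> = w \<and> stay t (traj \<omega>) \<longrightarrow>
     (\<lambda>n. real (multi_range r (map (traj \<omega>) [0..<Suc n])) / real n) \<longlonglongrightarrow> limit_of_law (cone_law r)"
proof -
  have "AE \<omega> in uniform_measure M (cone_event t w).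
      (\<lambda>n. real (multi_range r (map (shift t (traj \<omega>)) [0..<Suc n])) / real n) \<longlonglongrightarrow> limit_of_law (cone_law r)"
    using regenerative_process.multi_range_limit[OF cone_process_regenerative, of r]
    unfolding cone_block_law by simp
  then have "AE \<omega> in M. \<omega> \<in> cone_event t w \<longrightarrow>
      (\<lambda>n. real (multi_range r (map (shift t (traj \<omega>)) [0..<Suc n])) / real n) \<longlonglongrightarrow> limit_of_law (cone_law r)"
    by (subst (asm) AE_uniform_measure) (use prob_cone_event_pos in \<open>auto simp: emeasure_eq_measure\<close>)
  with AE_space show ?thesis
  proof eventually_elim
    case (elim \<omega>)
    show ?case
    proof
      assume A: "X t \<omega> = w \<and> stay t (traj \<omega>)"
      show "(\<lambda>n. real (multi_range r (map (traj \<omega>) [0..<Suc n])) / real n) \<longlonglongrightarrow> limit_of_law (cone_law r)"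
      proof (rule multi_range_limit_if_shifted)
        have "\<forall>s\<ge>t. prefix (X t \<omega>) (X s \<omega>)"
          using stay_iff[of "\<lambda>k. X k \<omega>" t] X_in_S[OF elim(1)] A w by simp
        then show "X (t + s) \<omega> = X t \<omega> @ shift t (traj \<omega>) s" for s
          using append_shift[of "\<lambda>k. X k \<omega>" t s] by simp
        show "(\<lambda>n. real (multi_range r (map (shift t (traj \<omega>)) [0..<Suc n])) / real n) \<longlonglongrightarrow> limit_of_law (cone_law r)"
          using elim A by (simp add: cone_event_def)
      qed
    qed
  qed
qed

lemma cone_limit_pos:
  assumes K: "0 < \<phi> K (\<lambda>y. visits [] (map y [0..<K]) = r)" and K0: "0 < K" and r: "1 \<le> r"
  shows "0 < limit_of_law (cone_law r)"
proof -
  have "adapted K (\<lambda>y :: nat \<Rightarrow> 'a list. visits [] (map y [0..<K]) = r)" by (rule adapted_map) simp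
  from cone_measure_regen[OF this] K
  have "0 < measure (uniform_measure M (cone_event t w)) {\<omega>\<in>space (uniform_measure M (cone_event t w)).
      visits [] (map (\<lambda>k. shift t (traj \<omega>) k) [0..<K]) = r \<and> regen T (\<lambda>k. shift t (traj \<omega>) k) K}" by simp
  from regenerative_process.limit_pos[OF cone_process_regenerative this K0 r]
  show ?thesis unfolding cone_block_law .
qed

end

section \<open>Positivity of the limit\<close>

text \<open>A shortest loop at the root of the second factor; by minimality it avoids the root in
  between.\<close>
lemma excursion_path:
  "\<exists>n z. 1 \<le> n \<and> z 0 = rt 2 \<and> z n = rt 2 \<and> (\<forall>k\<le>n. z k \<in> V 2) \<and>
     (\<forall>k<n. 0 < p 2 (z k) (z (Suc k))) \<and> (\<forall>k. 0 < k \<longrightarrow> k < n \<longrightarrow> z k \<noteq> rt 2)"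
proof -
  define LP where "LP n \<longleftrightarrow> 1 \<le> n \<and> (\<exists>z. z 0 = rt 2 \<and> z n = rt 2 \<and> (\<forall>k\<le>n. z k \<in> V 2) \<and>
      (\<forall>k<n. 0 < p 2 (z k) (z (Suc k))))" for n :: nat
  have two: "2 \<in> {1, 2 :: nat}" by simp
  obtain m where m: "1 \<le> m" "0 < nstep (V 2) (p 2) m (rt 2) (rt 2)"
    using factor(6)[OF two factor(2)[OF two]] by blast
  from m(1) nstep_pos_path[OF factor(4)[OF two] factor(2)[OF two] m(2)]
  have "LP m" unfolding LP_def by (rule conjI)
  then have L: "LP (LEAST n. LP n)" by (rule LeastI)
  define n where "n = (LEAST n. LP n)"
  obtain z where z: "1 \<le> n" "z 0 = rt 2" "z n = rt 2" "\<forall>k\<le>n. z k \<in> V 2" "\<forall>k<n. 0 < p 2 (z k) (z (Suc k))"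
    using L[folded n_def] unfolding LP_def by blast
  have ne: "z k \<noteq> rt 2" if "0 < k" "k < n" for k
  proof
    assume "z k = rt 2"
    then have "z 0 = rt 2 \<and> z k = rt 2 \<and> (\<forall>j\<le>k. z j \<in> V 2) \<and> (\<forall>j<k. 0 < p 2 (z j) (z (Suc j)))"
      using z(2,4,5) that(2) by simp
    then have "LP k" unfolding LP_def using that(1) by (intro conjI exI[of _ z]) simp_all
    then have "n \<le> k" unfolding n_def by (rule Least_le)
    then show False using that by simp
  qed
  then show ?thesis using z by (intro exI[of _ n] exI[of _ z] conjI) simp_all
qed

text \<open>The path runs r - 1 times through a shortest loop at the root inside the second factor, which
  gives r visits of the root, and then appends a letter of the second and a letter of the first
  factor. The word of two letters is longer than all words visited before, so its cone is new.\<close>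
lemma visits_root_prob_pos:
  assumes r: "1 \<le> r"
  shows "\<exists>K>0. 0 < \<phi> K (\<lambda>y. visits [] (map y [0..<K]) = r)"
proof -
  from excursion_path obtain n z where E: "1 \<le> n \<and> z 0 = rt 2 \<and> z n = rt 2 \<and> (\<forall>k\<le>n. z k \<in> V 2) \<and>
     (\<forall>k<n. 0 < p 2 (z k) (z (Suc k))) \<and> (\<forall>k. 0 < k \<longrightarrow> k < n \<longrightarrow> z k \<noteq> rt 2)" by (elim exE)
  note n = E[THEN conjunct1] and z0 = E[THEN conjunct2, THEN conjunct1]
    and zn = E[THEN conjunct2, THEN conjunct2, THEN conjunct1]
  note E' = E[THEN conjunct2, THEN conjunct2, THEN conjunct2]
  note zV = E'[THEN conjunct1] and zp = E'[THEN conjunct2, THEN conjunct1]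
    and ze = E'[THEN conjunct2, THEN conjunct2]
  obtain v where v: "v \<in> L 2" "0 < p 2 (rt 2) v" using letter_step_pos[of 2] by auto
  obtain v' where v': "v' \<in> L 1" "0 < p 1 (rt 1) v'" using letter_step_pos[of 1] by auto
  define l where "l = (r - 1) * n"
  define K where "K = l + 2"
  define x where "x k = (if k \<le> l then word_of (rt 2) (z (k mod n)) else if k = Suc l then [v] else [v, v'])" for k
  have mod: "k mod n < n" for k using n by simp
  have root: "z (k mod n) = rt 2 \<longleftrightarrow> n dvd k" for k
    using ze[rule_format, of "k mod n"] mod[of k] z0 by (auto simp: dvd_eq_mod_eq_0)
  have zL: "z (k mod n) = rt 2 \<or> z (k mod n) \<in> L 2" for k
    using zV[rule_format, of "k mod n"] mod[of k] by (auto simp: nonroots_def)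
  have xl: "x l = []" using root[of l] by (simp add: x_def word_of_def l_def)
  have one: "[a] \<in> A 1" if "a \<in> L 2" for a
    using that letters_disjoint(2)[OF that] unfolding A_def in_S_iff by simp
  have two: "[v, v'] \<in> A 1"
    using v(1) v'(1) letters_disjoint(2)[OF v(1)] letters_disjoint(1)[OF v'(1)] unfolding A_def in_S_iff by simp
  have xA: "x k \<in> A 1" for k
    using zL[of k] one[of "z (k mod n)"] one[OF v(1)] two Nil_in_A[of 1]
    unfolding x_def word_of_def by (simp split: if_splits) blast
  have step: "0 < q (x k) (x (Suc k))" if kK: "k < K" for k
  proof -
    consider "k < l" | "k = l" | "k = Suc l" using kK unfolding K_def by linarith
    then show ?thesis
    proof cases
      case 1
      have next': "z (Suc k mod n) = z (Suc (k mod n))"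
        using zn z0 by (simp add: mod_Suc)
      have "same_copy V rt 2 (x k) (x (Suc k)) [] (z (k mod n)) (z (Suc (k mod n)))"
        using 1 mod[of k] zV[rule_format, of "k mod n"] zV[rule_format, of "Suc (k mod n)"] Nil_in_S typ_Nil next'
        by (simp add: same_copy_def x_def)
      then show ?thesis by (rule q_pos[rotated]) (use zp mod in auto)
    next
      case 2
      have "same_copy V rt 2 [] ([] @ [v]) [] (rt 2) v"
        by (rule letter_copy) (use Nil_in_S typ_Nil v in auto)
      then have "0 < q [] [v]" using q_pos[of 2 "[]" "[v]"] v by simp
      then show ?thesis using 2 xl by (simp add: x_def)
    next
      case 3
      have "same_copy V rt 1 [v] ([v] @ [v']) [v] (rt 1) v'"
        by (rule letter_copy) (use v v' letters_disjoint in \<open>auto simp: in_S_iff has_type_def\<close>)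
      then have "0 < q [v] [v, v']" using q_pos[of 1 "[v]" "[v, v']"] v' by simp
      then show ?thesis using 3 by (simp add: x_def)
    qed
  qed
  have "{j. j < K \<and> x j = []} = (\<lambda>i. i * n) ` {..<r}"
  proof (intro set_eqI iffI)
    fix j assume "j \<in> {j. j < K \<and> x j = []}"
    then have j: "j \<le> l" "n dvd j" using root[of j] by (auto simp: x_def word_of_def split: if_splits)
    then obtain i where i: "j = i * n" by (auto simp: dvd_def mult.commute)
    then have "i \<le> r - 1" using j n unfolding l_def by simp
    then have "i < r" using r by simp
    then show "j \<in> (\<lambda>i. i * n) ` {..<r}" unfolding i by (intro imageI) simp
  next
    fix j assume "j \<in> (\<lambda>i. i * n) ` {..<r}"
    then obtain i where i: "i < r" "j = i * n" by auto
    then have "j \<le> l" unfolding l_def i by (intro mult_right_mono) auto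
    then show "j \<in> {j. j < K \<and> x j = []}" using root[of j] i by (simp add: x_def word_of_def K_def)
  qed
  moreover have "card ((\<lambda>i. i * n) ` {..<r}) = r"
    using n by (subst card_image) (auto simp: inj_on_def)
  ultimately have vis: "visits [] (map x [0..<K]) = r"
    unfolding visits_def by (simp cong: conj_cong)
  have short: "length (x j) \<le> 1" if "j < K" for j
    using that unfolding x_def K_def word_of_def by auto
  have xK: "x K = [v, v']" by (simp add: x_def K_def)
  have fr: "fresh T x K"
    unfolding fresh_def
  proof (intro disjI2 conjI allI impI)
    show "typ 1 (x K)" using v' by (simp add: xK has_type_def)
    show "\<not> prefix (x K) (x j)" if "j < K" for j
      using short[OF that] prefix_length_le[of "x K" "x j"] xK by auto
  qed
  have "0 < \<P>(\<omega> in M. \<forall>k\<le>K. X k \<omega> = x k)"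
  proof -
    have "x 0 = []" using root[of 0] by (simp add: x_def word_of_def)
    then show ?thesis
      by (subst path_probability) (use xA A_subset_S step in \<open>auto intro!: prod_pos\<close>)
  qed
  also have "\<dots> \<le> \<phi> K (\<lambda>y. visits [] (map y [0..<K]) = r)"
    unfolding \<phi>_def
  proof (rule finite_measure_mono, rule subsetI)
    fix \<omega> assume \<omega>: "\<omega> \<in> {\<omega>\<in>space M. \<forall>k\<le>K. X k \<omega> = x k}"
    have eq: "P (traj \<omega>) = P x" if "adapted K P" for P
      by (rule adaptedD[OF that]) (use \<omega> in auto)
    have "inside K x" unfolding inside_def by (intro ballI xA)
    then have "inside K (traj \<omega>)" by (rule eq[OF adapted_inside, THEN iffD2])
    moreover have "adapted K (\<lambda>y :: nat \<Rightarrow> 'a list. visits [] (map y [0..<K]) = r)" by (rule adapted_map) simp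
    from eq[OF this] vis have "visits [] (map (traj \<omega>) [0..<K]) = r" by simp
    moreover have "fresh T (traj \<omega>) K"
      using fr by (rule eq[OF adapted_fresh[OF order_refl], THEN iffD2])
    ultimately show "\<omega> \<in> {\<omega>\<in>space M. inside K (traj \<omega>) \<and> visits [] (map (traj \<omega>) [0..<K]) = r \<and> fresh T (traj \<omega>) K}"
      using \<omega> by blast
  next
    have "adapted K (\<lambda>y. inside K y \<and> visits [] (map y [0..<K]) = r \<and> fresh T y K)"
      by (intro adapted_conj adapted_inside adapted_map adapted_fresh) auto
    from pred_X[OF this] show "{\<omega>\<in>space M. inside K (traj \<omega>) \<and> visits [] (map (traj \<omega>) [0..<K]) = r \<and> fresh T (traj \<omega>) K} \<in> events"
      by (simp add: pred_def)
  qed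
  finally show ?thesis by (intro exI[of _ K]) (simp add: K_def)
qed

theorem multi_range_linear:
  assumes sum: "summable (\<lambda>n. \<P>(\<omega> in M. X n \<omega> = []))" and r: "1 \<le> r"
  shows "\<exists>c>0. AE \<omega> in M. (\<lambda>n. real (multi_range r (map (traj \<omega>) [0..<Suc n])) / real n) \<longlonglongrightarrow> c"
proof (intro exI conjI)
  have g: "0 < escape_prob 1" by (rule escape_prob_pos[OF sum]) simp
  then have h: "0 < stay_prob 1" using escape_prob_le_stay_prob[of 1] by simp
  obtain K where K: "0 < K" "0 < \<phi> K (\<lambda>y. visits [] (map y [0..<K]) = r)"
    using visits_root_prob_pos[OF r] by blast
  obtain v where v: "v \<in> L 1" "0 < \<P>(\<omega> in M. X 1 \<omega> = [v])" using single_letter_prob_pos[of 1] by auto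
  show "0 < limit_of_law (cone_law r)"
    by (rule cone_limit_pos[OF _ v(2) g K(2,1) r]) (use v(1) in \<open>simp add: has_type_def\<close>)
  have "AE \<omega> in M. \<forall>t. \<forall>w\<in>{w\<in>S. typ 1 w}. X t \<omega> = w \<and> stay t (traj \<omega>) \<longrightarrow>
     (\<lambda>n. real (multi_range r (map (traj \<omega>) [0..<Suc n])) / real n) \<longlonglongrightarrow> limit_of_law (cone_law r)"
    unfolding AE_all_countable
  proof (intro allI AE_ball_countable[THEN iffD2] ballI)
    show "countable {w\<in>S. typ 1 w}" by (rule countable_subset[OF _ countable_S]) auto
    fix t w assume w: "w \<in> {w\<in>S. typ 1 w}"
    show "AE \<omega> in M. X t \<omega> = w \<and> stay t (traj \<omega>) \<longrightarrow>
      (\<lambda>n. real (multi_range r (map (traj \<omega>) [0..<Suc n])) / real n) \<longlonglongrightarrow> limit_of_law (cone_law r)"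
    proof (cases "\<P>(\<omega> in M. X t \<omega> = w) = 0")
      case True
      then have "AE \<omega> in M. X t \<omega> \<noteq> w" by (subst (asm) prob_Collect_eq_0) auto
      then show ?thesis by eventually_elim simp
    next
      case False
      then show ?thesis using w g by (intro cone_limit) (auto simp: zero_less_measure_iff)
    qed
  qed
  with AE_eventually_stay[OF h] AE_space
  show "AE \<omega> in M. (\<lambda>n. real (multi_range r (map (traj \<omega>) [0..<Suc n])) / real n) \<longlonglongrightarrow> limit_of_law (cone_law r)"
  proof eventually_elim
    case (elim \<omega>)
    then obtain t where "typ 1 (X t \<omega>)" "stay t (traj \<omega>)" by blast
    then show ?case using elim(2,3) X_in_S by blast
  qed
qed

end

theorem theorem4p7:
  fixes V :: "nat \<Rightarrow> 'a set" and rt :: "nat \<Rightarrow> 'a"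
    and p :: "nat \<Rightarrow> 'a \<Rightarrow> 'a \<Rightarrow> real" and \<alpha> :: real
    and M :: "'w measure" and X :: "nat \<Rightarrow> 'w \<Rightarrow> 'a list" and r :: nat
  assumes factors: "\<forall>i\<in>{1, 2}. rooted_factor (V i) (rt i) (p i)"
    and disjoint: "V 1 \<inter> V 2 = {}"
    and not_both_two: "\<not> (card (V 1) = 2 \<and> card (V 2) = 2)"
    and alpha: "0 < \<alpha>" "\<alpha> < 1"
    and chain: "markov_chain M (free_product V rt) (walk_matrix V rt p \<alpha>) [] X"
    and radius: "conv_radius (\<lambda>n. \<P>(\<omega> in M. X n \<omega> = [])) > 1"
    and r: "r \<ge> 1"
  shows "\<exists>c::real. c > 0 \<and>
           (AE \<omega> in M. (\<lambda>n. real (multi_range r (map (\<lambda>k. X k \<omega>) [0..<Suc n])) / real n)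
                          \<longlonglongrightarrow> c)"
proof -
  interpret free_product_walk V rt p \<alpha> M X
    using factors disjoint alpha chain by (rule free_product_walk.intro)
  have "summable (\<lambda>n. \<P>(\<omega> in M. X n \<omega> = []) * 1 ^ n)"
    by (rule summable_in_conv_radius) (use radius in \<open>simp add: one_ereal_def[symmetric]\<close>)
  then show ?thesis using r by (intro multi_range_linear) simp_all
qed

end
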